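(* Let $\Pi_{\mathcal G}$ be a two step market evaluation, $\Pi_{\mathcal G}(H)=\mathbb E^{\mathbb Q_{\mathcal G}}[\Pi_{\mathcal F^S}(H)]$ with an $\mathcal F^S$-conditional evaluation $\Pi_{\mathcal F^S}$ having penalty function $\Pi^*_{\mathcal F^S}$. Let $i\in\{1,\dots,n\}$ and, for payoffs $\tilde H=H/S^i_T$ expressed in units of the $i$-th stock, let $\tilde\Pi_{\mathcal G}$ be the evaluation satisfying $S^i_0\,\tilde\Pi_{\mathcal G}(\tilde H)=\Pi_{\mathcal G}(H)$. Then $\tilde\Pi_{\mathcal G}$ is a two step market evaluation as well (with $S^i$ as numeraire), namely $$\tilde\Pi_{\mathcal G}(\tilde H)=\mathbb E^{\tilde{\mathbb Q}_{\mathcal G}}\big[\tilde\Pi_{\mathcal F^S}(\tilde H)\big],\qquad \frac{d\tilde{\mathbb Q}_{\mathcal G}}{d\mathbb P_{\mathcal G}}:=\frac{S^i_T}{S^i_0}\frac{d\mathbb Q_{\mathcal G}}{d\mathbb P_{\mathcal G}},$$ where $\tilde{\mathbb Q}_{\mathcal G}$ is the unique equivalent martingale measure on $\mathcal F^S$ with numeraire $S^i$. Furthermore, the penalty function of $\tilde\Pi_{\mathcal F^S}$ is given by the penalty function of $\Pi_{\mathcal F^S}$ converted into units of stock $i$, that is $$\tilde\Pi^*_{\mathcal F^S}(\xi)=\frac{\Pi^*_{\mathcal F^S}(\xi)}{S^i_T},\qquad \tilde\Pi_{\mathcal F^S}(\tilde H)=\operatorname{ess\,sup}_{\xi\in L^1(\mathcal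 F)}\Big\{\mathbb E[\xi\tilde H\mid\mathcal F^S]-\tilde\Pi^*_{\mathcal F^S}(\xi)\Big\}.$$
   Context: Setting. $(\Omega,\mathcal F,\mathbb P)$ is a probability space, $\mathcal G\subset\mathcal F$ a $\sigma$-algebra (initial information), $S=(S^1,\dots,S^n)$ the price process of $n$ traded stocks, with initial values $S^i_0$ and values $S^i_T$ at maturity $T$, $\bar{\mathcal F}^S\subset\mathcal F$ the $\sigma$-algebra generated by $S$, and $\mathcal F^S:=\bar{\mathcal F}^S\vee\mathcal G$. (In)equalities are $\mathbb P$-a.s. $L^\infty(\mathcal A)$ denotes the bounded $\mathcal A$-measurable random variables, $L^1(\mathcal A)$ the integrable ones. Payoffs are represented by random variables $H\in L^\infty(\mathcal F)$. The financial market given by $S$ is arbitrage free and complete conditional on $\mathcal G$: on $\mathcal F^S$ there is a unique conditional probability measure $\mathbb Q_{\mathcal G}$ under which $S$ is a martingale, and its ($\mathcal F^S$-measurable) conditional density $\frac{d\mathbb Q_{\mathcal G}}{d\mathbb P_{\mathcal G}}$, which satisfies $\mathbb E[\frac{d\mathbb Q_{\mathcal G}}{d\mathbb P_{\mathcal G}}\mid\mathcal G]=1$, is a.s. positive. For a conditional measure $\mathbb R_{\mathcal G}$ with conditional density $\xi$, $\mathbb E^{\mathbb R_{\mathcal G}}[X]:=\mathbb E[\xi X\mid\mathcal G]$. For a $\sigma$-algebra $\mathcal A\subset\mathcal F$, an $\mathcal A$-conditional evaluation is a map $\Pi:L^\infty(\mathcal F)\to L^\infty(\mathcal A)$ with: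 $\Pi(0)=0$; $\Pi(H+m)=\Pi(H)+m$ for $m\in L^\infty(\mathcal A)$; $\Pi(\lambda H_1+(1-\lambda)H_2)\le\lambda\Pi(H_1)+(1-\lambda)\Pi(H_2)$ for $\lambda\in L^\infty(\mathcal A)$, $0\le\lambda\le1$; $\Pi(I_AH_1+I_{A^c}H_2)=I_A\Pi(H_1)+I_{A^c}\Pi(H_2)$ for $A\in\mathcal A$; $\Pi(H)\le\liminf_n\Pi(H_n)$ for bounded sequences $H_n\to H$ a.s. Its penalty function is $\Pi^*(\xi)=\operatorname{ess\,sup}_{H\in L^\infty(\mathcal F)}\{\mathbb E[\xi H\mid\mathcal A]-\Pi(H)\}$, and by duality $\Pi(H)=\operatorname{ess\,sup}_{\xi}\{\mathbb E[\xi H\mid\mathcal A]-\Pi^*(\xi)\}$. A map $\Pi_{\mathcal G}:L^\infty(\mathcal F)\to L^\infty(\mathcal G)$ is called a two step market evaluation if there is an $\mathcal F^S$-conditional evaluation $\Pi_{\mathcal F^S}:L^\infty(\mathcal F)\to L^\infty(\mathcal F^S)$ with $\Pi_{\mathcal G}(H)=\mathbb E^{\mathbb Q_{\mathcal G}}[\Pi_{\mathcal F^S}(H)]$. When payoffs are expressed in units of $S^i$, the role of $\mathbb Q_{\mathcal G}$ is played by $\tilde{\mathbb Q}_{\mathcal G}$. *)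

theory Defs
  imports "HOL-Probability.Probability"
begin

text \<open>
  Random variables are represented by functions, so all (in)equalities between them are required
  almost surely only.  A \<open>\<sigma>\<close>-algebra contained in that of \<open>M\<close> is a measure \<open>A\<close> with
  \<open>subalgebra M A\<close>, as in \<open>real_cond_exp\<close>; only its \<open>\<sigma>\<close>-algebra matters.
\<close>

subsection \<open>Payoffs and essential suprema\<close>

text \<open>
  The \<open>A\<close>-measurable payoffs expressed in units of a positive numeraire \<open>N\<close>: those \<open>X\<close> whose cash
  value \<open>N X\<close> is bounded, i.e. \<open>X = H / N\<close> with \<open>H\<close> bounded.  For \<open>N = 1\<close> this is
  \<open>L\<^sup>\<infinity>(A)\<close>.  Neither \<open>N\<close> nor \<open>1 / N\<close> has to be bounded.
\<close>

definition Linf :: "'a measure \<Rightarrow> 'a measure \<Rightarrow> ('a \<Rightarrow> real) \<Rightarrow> ('a \<Rightarrow> real) set" where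
  "Linf M A N = {X \<in> borel_measurable A. \<exists>C. AE x in M. \<bar>N x * X x\<bar> \<le> C}"

text \<open>
  The essential supremum of a family of random variables, the a.s. smallest random variable
  dominating every member a.s.  It is determined up to null sets only; \<open>ess_sup\<close> picks a version.
\<close>

definition is_ess_sup :: "'a measure \<Rightarrow> ('a \<Rightarrow> ereal) set \<Rightarrow> ('a \<Rightarrow> ereal) \<Rightarrow> bool" where
  "is_ess_sup M \<Phi> Z \<longleftrightarrow>
     Z \<in> borel_measurable M \<and>
     (\<forall>X\<in>\<Phi>. AE x in M. X x \<le> Z x) \<and>
     (\<forall>Z'\<in>borel_measurable M. (\<forall>X\<in>\<Phi>. AE x in M. X x \<le> Z' x) \<longrightarrow> (AE x in M. Z x \<le> Z' x))"

definition ess_sup :: "'a measure \<Rightarrow> ('a \<Rightarrow> ereal) set \<Rightarrow> 'a \<Rightarrow> ereal" where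
  "ess_sup M \<Phi> = (SOME Z. is_ess_sup M \<Phi> Z)"

subsection \<open>Conditional evaluations\<close>

text \<open>
  An \<open>A\<close>-conditional evaluation of payoffs expressed in units of an \<open>A\<close>-measurable numeraire \<open>N\<close>.
  The first clause says that the evaluation is well defined on a.s. equivalence classes, the last
  one is lower semicontinuity along bounded sequences (bounded in cash value).
  The weights \<open>w\<close> are pure numbers and hence not converted.
\<close>

definition conditional_evaluation ::
  "'a measure \<Rightarrow> 'a measure \<Rightarrow> ('a \<Rightarrow> real) \<Rightarrow> (('a \<Rightarrow> real) \<Rightarrow> 'a \<Rightarrow> real) \<Rightarrow> bool" where
  "conditional_evaluation M A N \<pi> \<longleftrightarrow>
     (\<forall>H\<in>Linf M M N. \<forall>H'\<in>Linf M M N.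
        (AE x in M. H x = H' x) \<longrightarrow> (AE x in M. \<pi> H x = \<pi> H' x)) \<and>
     (\<forall>H\<in>Linf M M N. \<pi> H \<in> Linf M A N) \<and>
     (AE x in M. \<pi> (\<lambda>_. 0) x = 0) \<and>
     (\<forall>H\<in>Linf M M N. \<forall>m\<in>Linf M A N. AE x in M. \<pi> (\<lambda>y. H y + m y) x = \<pi> H x + m x) \<and>
     (\<forall>H1\<in>Linf M M N. \<forall>H2\<in>Linf M M N. \<forall>w\<in>borel_measurable A.
        (AE x in M. 0 \<le> w x \<and> w x \<le> 1) \<longrightarrow>
        (AE x in M. \<pi> (\<lambda>y. w y * H1 y + (1 - w y) * H2 y) x
                      \<le> w x * \<pi> H1 x + (1 - w x) * \<pi> H2 x)) \<and>
     (\<forall>H1\<in>Linf M M N. \<forall>H2\<in>Linf M M N. \<forall>B\<in>sets A.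
        AE x in M. \<pi> (\<lambda>y. indicator B y * H1 y + indicator (space M - B) y * H2 y) x
                     = indicator B x * \<pi> H1 x + indicator (space M - B) x * \<pi> H2 x) \<and>
     (\<forall>H\<in>Linf M M N. \<forall>Hs.
        (\<forall>k. Hs k \<in> Linf M M N) \<and>
        (\<exists>C. \<forall>k. AE x in M. \<bar>N x * Hs k x\<bar> \<le> C) \<and>
        (AE x in M. (\<lambda>k. Hs k x) \<longlonglongrightarrow> H x) \<longrightarrow>
        (AE x in M. ereal (\<pi> H x) \<le> liminf (\<lambda>k. ereal (\<pi> (Hs k) x))))"

definition penalty ::
  "'a measure \<Rightarrow> 'a measure \<Rightarrow> ('a \<Rightarrow> real) \<Rightarrow> (('a \<Rightarrow> real) \<Rightarrow> 'a \<Rightarrow> real)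
     \<Rightarrow> ('a \<Rightarrow> real) \<Rightarrow> 'a \<Rightarrow> ereal" where
  "penalty M A N \<pi> \<xi> =
     ess_sup M {\<lambda>x. ereal (real_cond_exp M A (\<lambda>y. \<xi> y * H y) x - \<pi> H x) |H. H \<in> Linf M M N}"

subsection \<open>The market conditional on the initial information\<close>

text \<open>
  Stocks are numbered \<open>1, \<dots>, n\<close> and traded at the times in \<open>TT\<close>; the asset with number \<open>0\<close> is the
  bank account, in units of which the prices \<open>S\<close> are given.
\<close>

definition asset :: "(nat \<Rightarrow> real \<Rightarrow> 'a \<Rightarrow> real) \<Rightarrow> nat \<Rightarrow> real \<Rightarrow> 'a \<Rightarrow> real" where
  "asset S j t x = (if j = 0 then 1 else S j t x)"

text \<open>
  The \<open>\<sigma>\<close>-algebra generated by \<open>G\<close> and the prices at the times in \<open>U\<close>.  The full stock information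
  \<open>\<F>\<^sup>S\<close> is the case \<open>U = TT\<close>, the information at time \<open>t\<close> is the case \<open>U = TT \<inter> {..t}\<close>.
\<close>

definition price_info ::
  "'a measure \<Rightarrow> 'a measure \<Rightarrow> nat \<Rightarrow> (nat \<Rightarrow> real \<Rightarrow> 'a \<Rightarrow> real) \<Rightarrow> real set \<Rightarrow> 'a measure" where
  "price_info M G n S U =
     sigma (space M)
       (sets G \<union> (\<Union>j\<in>{1..n}. \<Union>t\<in>U. {S j t -` B \<inter> space M |B. B \<in> sets borel}))"

text \<open>A conditional measure is given by its conditional density \<open>\<xi>\<close> with respect to \<open>M\<close>.\<close>

definition cond_exp_under ::
  "'a measure \<Rightarrow> 'a measure \<Rightarrow> ('a \<Rightarrow> real) \<Rightarrow> ('a \<Rightarrow> real) \<Rightarrow> 'a \<Rightarrow> real" where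
  "cond_exp_under M G \<xi> X = real_cond_exp M G (\<lambda>x. \<xi> x * X x)"

definition conditional_density ::
  "'a measure \<Rightarrow> 'a measure \<Rightarrow> 'a measure \<Rightarrow> ('a \<Rightarrow> real) \<Rightarrow> bool" where
  "conditional_density M G F \<xi> \<longleftrightarrow>
     \<xi> \<in> borel_measurable F \<and> (AE x in M. 0 \<le> \<xi> x) \<and> (AE x in M. real_cond_exp M G \<xi> x = 1)"

text \<open>
  Martingales under the conditional measure with density \<open>\<xi>\<close>.  Expectations are conditional on \<open>G\<close>
  throughout: \<open>X t\<close> has to be integrable given \<open>G\<close>, which is weaker than integrability under the
  measure \<open>\<xi> dM\<close> and, unlike the latter, stable under a change of numeraire.  (On such functions
  \<open>real_cond_exp\<close> is the difference of the finite conditional expectations of the positive and the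
  negative part.)
\<close>

definition conditional_martingale ::
  "'a measure \<Rightarrow> 'a measure \<Rightarrow> (real \<Rightarrow> 'a measure) \<Rightarrow> real set \<Rightarrow> ('a \<Rightarrow> real)
     \<Rightarrow> (real \<Rightarrow> 'a \<Rightarrow> real) \<Rightarrow> bool" where
  "conditional_martingale M G \<F> TT \<xi> X \<longleftrightarrow>
     (\<forall>t\<in>TT. X t \<in> borel_measurable (\<F> t)) \<and>
     (\<forall>t\<in>TT. AE x in M. nn_cond_exp M G (\<lambda>y. ennreal (\<xi> y * \<bar>X t y\<bar>)) x < \<infinity>) \<and>
     (\<forall>s\<in>TT. \<forall>t\<in>TT. s \<le> t \<longrightarrow> (\<forall>B\<in>sets (\<F> s).
        AE x in M. cond_exp_under M G \<xi> (\<lambda>y. indicator B y * X t y) x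
                     = cond_exp_under M G \<xi> (\<lambda>y. indicator B y * X s y) x))"

text \<open>
  Conditional martingale measures on \<open>\<F>\<^sup>S\<close> with numeraire \<open>N\<close>: all traded assets, including the bank
  account, are martingales when expressed in units of \<open>N\<close>.  For \<open>N = 1\<close> this says that \<open>S\<close> is a
  martingale.
\<close>

definition martingale_density ::
  "'a measure \<Rightarrow> 'a measure \<Rightarrow> real set \<Rightarrow> nat \<Rightarrow> (nat \<Rightarrow> real \<Rightarrow> 'a \<Rightarrow> real)
     \<Rightarrow> (real \<Rightarrow> 'a \<Rightarrow> real) \<Rightarrow> ('a \<Rightarrow> real) \<Rightarrow> bool" where
  "martingale_density M G TT n S N \<xi> \<longleftrightarrow>
     conditional_density M G (price_info M G n S TT) \<xi> \<and>
     (\<forall>j\<le>n. conditional_martingale M G (\<lambda>t. price_info M G n S (TT \<inter> {..t})) TT \<xi>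
              (\<lambda>t x. asset S j t x / N t x))"

text \<open>
  Uniqueness is among all conditional martingale measures, equivalent or not; the unique one is
  equivalent.
\<close>

definition unique_equivalent_martingale_density ::
  "'a measure \<Rightarrow> 'a measure \<Rightarrow> real set \<Rightarrow> nat \<Rightarrow> (nat \<Rightarrow> real \<Rightarrow> 'a \<Rightarrow> real)
     \<Rightarrow> (real \<Rightarrow> 'a \<Rightarrow> real) \<Rightarrow> ('a \<Rightarrow> real) \<Rightarrow> bool" where
  "unique_equivalent_martingale_density M G TT n S N \<xi> \<longleftrightarrow>
     martingale_density M G TT n S N \<xi> \<and>
     (AE x in M. 0 < \<xi> x) \<and>
     (\<forall>\<eta>. martingale_density M G TT n S N \<eta> \<longrightarrow> (AE x in M. \<eta> x = \<xi> x))"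

text \<open>
  \<open>\<pi>G\<close> is the two step evaluation built from the conditional density \<open>q\<close> and the \<open>F\<close>-conditional
  evaluation \<open>\<pi>F\<close>.  Payoffs and values at maturity are in units of \<open>NT\<close>, initial values in units
  of \<open>N0\<close>.  With \<open>F = \<F>\<^sup>S\<close> and \<open>q\<close> the density of the martingale measure for the numeraire, \<open>\<pi>G\<close> is a
  two step market evaluation iff this holds for some \<open>\<pi>F\<close>.
\<close>

definition two_step_evaluation ::
  "'a measure \<Rightarrow> 'a measure \<Rightarrow> 'a measure \<Rightarrow> ('a \<Rightarrow> real) \<Rightarrow> ('a \<Rightarrow> real) \<Rightarrow> ('a \<Rightarrow> real)
     \<Rightarrow> (('a \<Rightarrow> real) \<Rightarrow> 'a \<Rightarrow> real) \<Rightarrow> (('a \<Rightarrow> real) \<Rightarrow> 'a \<Rightarrow> real) \<Rightarrow> bool" where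
  "two_step_evaluation M G F N0 NT q \<pi>F \<pi>G \<longleftrightarrow>
     conditional_evaluation M F NT \<pi>F \<and>
     (\<forall>H\<in>Linf M M NT. \<pi>G H \<in> Linf M G N0) \<and>
     (\<forall>H\<in>Linf M M NT. AE x in M. \<pi>G H x = cond_exp_under M G q (\<pi>F H) x)"

end

theory Submission
  imports Defs
begin

text \<open>
  The change of numeraire is Bayes' formula: \<open>N = S i\<close> is a conditional martingale, so the density
  \<open>N T / N 0\<close> turns the asset prices in cash into prices in units of \<open>N\<close> and its inverse turns them back,
  which also transports uniqueness.  The converted evaluation is \<open>Ht \<mapsto> \<pi>F (N T Ht) / N T\<close>; as \<open>N T\<close> is
  known given the stock information, dividing by it commutes with conditional expectations and essential
  suprema.

  What remains is the dual representation of \<open>\<pi>F\<close>, which is not monotone.  It follows from an approximate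
  subgradient in \<open>L\<^sup>1\<close> of the convex functional \<open>H \<mapsto> E[\<pi>F H]\<close>, whose sublevel sets are closed under bounded
  almost sure convergence.  The subgradient is built as in the Krein--Smulian theorem: on the ball of radius
  \<open>n\<close> one works in \<open>L\<^sup>2\<close>, and passing from radius \<open>n\<close> to \<open>n + 1\<close> costs a correction \<open>\<eta>\<close> such that the sum of
  \<open>n E\<bar>\<eta>\<bar>\<close> is finite.  Locality turns inequalities between expectations into conditional ones.
\<close>

subsection \<open>Approximate subgradients of convex functionals of bounded random variables\<close>

text \<open>Without monotonicity nothing bounds \<open>\<pi> H\<close> from below uniformly over
  bounded \<open>H\<close>, while Fatou's lemma for the mean of \<open>\<pi> H\<close> needs one
  integrable minorant for a whole ball. The subgradient theorem is therefore used twice. Applied to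
  \<open>max (\<pi> H) (- 1)\<close>, which has a constant minorant, it yields an integrable
  minorant of \<open>\<pi>\<close> on every ball, outside an event of small probability; off that
  event it is then applied to \<open>\<pi>\<close> itself, at an arbitrary payoff. The excluded
  event and the error of the subgradient are small in probability and in mean only, so the dual
  inequality is first proved in probability.

  Separation by Hahn-Banach would need sublevel sets closed in the weak-star topology, whereas lower
  semicontinuity is given along bounded sequences; bridging this gap by hand also keeps the
  subgradient in \<open>L\<^sup>1\<close>, away from purely finitely additive functionals.

  Payoffs in units of the numeraire may be unbounded, so their products with an integrable density
  need not be integrable. Conditional expectations are therefore compared through their nonnegative
  extended parts.\<close>

definition ess_ball :: "'a measure \<Rightarrow> real \<Rightarrow> ('a \<Rightarrow> real) set" where
  "ess_ball M r = {H \<in> borel_measurable M. AE x in M. \<bar>H x\<bar> \<le> r}"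

lemma ess_ballD:
  assumes "H \<in> ess_ball M r"
  shows "H \<in> borel_measurable M" "AE x in M. \<bar>H x\<bar> \<le> r"
  using assms by (auto simp: ess_ball_def)

lemma ess_ballI: "H \<in> borel_measurable M \<Longrightarrow> AE x in M. \<bar>H x\<bar> \<le> r \<Longrightarrow> H \<in> ess_ball M r"
  by (simp add: ess_ball_def)

lemma ess_ball_mono: "H \<in> ess_ball M r \<Longrightarrow> r \<le> s \<Longrightarrow> H \<in> ess_ball M s"
  by (auto simp: ess_ball_def elim!: eventually_mono)

lemma zero_in_ess_ball: "0 \<le> r \<Longrightarrow> (\<lambda>_. 0) \<in> ess_ball M r"
  by (simp add: ess_ball_def)

lemma ess_ball_convex:
  assumes "H1 \<in> ess_ball M r" "H2 \<in> ess_ball M r" "0 \<le> t" "t \<le> 1"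
  shows "(\<lambda>x. t * H1 x + (1 - t) * H2 x) \<in> ess_ball M r"
proof (rule ess_ballI)
  show "(\<lambda>x. t * H1 x + (1 - t) * H2 x) \<in> borel_measurable M"
    using assms ess_ballD(1) by (intro borel_measurable_add borel_measurable_times) auto
  show "AE x in M. \<bar>t * H1 x + (1 - t) * H2 x\<bar> \<le> r"
    using ess_ballD(2)[OF assms(1)] ess_ballD(2)[OF assms(2)]
  proof eventually_elim
    case (elim x)
    have "\<bar>t * H1 x + (1 - t) * H2 x\<bar> \<le> t * \<bar>H1 x\<bar> + (1 - t) * \<bar>H2 x\<bar>"
      using assms by (metis abs_mult abs_of_nonneg abs_triangle_ineq diff_ge_0_iff_ge)
    also have "\<dots> \<le> r" using elim assms by (intro convex_bound_le) auto
    finally show ?case .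
  qed
qed

text \<open>
  \<open>h - clip r h\<close> is the derivative of half the squared distance from the interval \<open>[-r, r]\<close>.
\<close>

definition clip :: "real \<Rightarrow> real \<Rightarrow> real" where
  "clip r h = max (- r) (min r h)"

lemma clip_measurable [measurable]: "clip r \<in> borel_measurable borel"
  unfolding clip_def by measurable

lemma continuous_clip: "isCont (clip r) x"
  unfolding clip_def by (intro continuous_intros)

lemma abs_clip_le: "0 \<le> r \<Longrightarrow> \<bar>clip r h\<bar> \<le> r"
  by (auto simp: clip_def)

lemma clip_nearest: "\<bar>z\<bar> \<le> r \<Longrightarrow> (h - clip r h)\<^sup>2 \<le> (h - z)\<^sup>2"
  by (intro abs_le_square_iff[THEN iffD1]) (auto simp: clip_def)

lemma abs_minus_clip_le: "0 \<le> r \<Longrightarrow> \<bar>h - clip r h\<bar> \<le> \<bar>h\<bar>"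
  by (auto simp: clip_def)

text \<open>Outside \<open>[-r, r]\<close> the slope \<open>k * (h - clip r h) + d * h\<close> has
  the sign of \<open>h\<close> or vanishes, and \<open>\<bar>h\<bar> > r\<close>, so pairing it with
  \<open>h\<close> yields at least \<open>r\<close> times its modulus. Inside only
  \<open>d * h\<close> is left, and \<open>d * r\<^sup>2\<close> covers the defect. Integrated, this
  is the factor \<open>r\<close> in front of the \<open>L\<^sup>1\<close> norm in
  \<open>extend_bound\<close>.\<close>

lemma minus_clip_mult_ge:
  assumes "0 \<le> r" "0 \<le> k" "0 \<le> d"
  shows "r * \<bar>k * (h - clip r h) + d * h\<bar> - d * r\<^sup>2 \<le> (k * (h - clip r h) + d * h) * h"
proof -
  consider "\<bar>h\<bar> \<le> r" | "h > r" | "h < - r" by linarith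
  then show ?thesis
  proof cases
    case 1
    then have "clip r h = h" by (auto simp: clip_def)
    moreover have "r * (d * \<bar>h\<bar>) \<le> d * r\<^sup>2"
      using 1 assms mult_left_mono[of "\<bar>h\<bar>" r "r * d"] by (simp add: power2_eq_square mult_ac)
    ultimately show ?thesis using assms by (simp add: abs_mult) (smt (verit) mult_nonneg_nonneg zero_le_square mult.assoc)
  next
    case 2
    then have "clip r h = r" using assms by (auto simp: clip_def)
    moreover have "0 \<le> k * (h - r) + d * h" using 2 assms by simp
    moreover have "r * (k * (h - r) + d * h) \<le> h * (k * (h - r) + d * h)"
      using 2 \<open>0 \<le> k * (h - r) + d * h\<close> by (intro mult_right_mono) auto
    ultimately show ?thesis using assms by (simp add: mult.commute) (smt (verit) mult_nonneg_nonneg zero_le_power2)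
  next
    case 3
    then have "clip r h = - r" using assms by (auto simp: clip_def)
    moreover have a: "0 \<le> k * (- h - r) + d * (- h)" using 3 assms by (intro add_nonneg_nonneg mult_nonneg_nonneg) auto
    moreover have "r * (k * (- h - r) + d * (- h)) \<le> (- h) * (k * (- h - r) + d * (- h))"
      using 3 a by (intro mult_right_mono) auto
    moreover have "k * (h - - r) + d * h = - (k * (- h - r) + d * (- h))" by (simp add: algebra_simps)
    moreover have "0 \<le> d * r\<^sup>2" using assms by simp
    ultimately show ?thesis by (smt (verit) minus_mult_minus mult.commute)
  qed
qed

text \<open>The first term is the Moreau envelope, with parameter \<open>1 / k\<close>, of the
  convex indicator function of \<open>[-r, r]\<close>: it turns the hard constraint
  \<open>\<bar>h\<bar> \<le> r\<close> into a penalty that tightens as \<open>k\<close> grows. The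
  second is a Tikhonov term, which adds strong convexity with a modulus independent of
  \<open>k\<close>.\<close>

definition moreau :: "real \<Rightarrow> real \<Rightarrow> real \<Rightarrow> real \<Rightarrow> real" where
  "moreau r k d h = k / 2 * (h - clip r h)\<^sup>2 + d / 2 * h\<^sup>2"

lemma moreau_measurable [measurable]: "moreau r k d \<in> borel_measurable borel"
  unfolding moreau_def by measurable

lemma moreau_nonneg: "0 \<le> k \<Longrightarrow> 0 \<le> d \<Longrightarrow> 0 \<le> moreau r k d h"
  by (simp add: moreau_def)

lemma moreau_zero: "0 \<le> r \<Longrightarrow> moreau r k d 0 = 0"
  by (simp add: moreau_def clip_def)

lemma moreau_mono: "k \<le> l \<Longrightarrow> moreau r k d h \<le> moreau r l d h"
  by (simp add: moreau_def mult_right_mono)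

lemma moreau_bound:
  assumes "0 \<le> r" "0 \<le> k" "0 \<le> d" "\<bar>h\<bar> \<le> R"
  shows "\<bar>moreau r k d h\<bar> \<le> (k + d) / 2 * R\<^sup>2"
proof -
  have "h\<^sup>2 \<le> R\<^sup>2" using assms by (metis abs_ge_zero order_trans power2_abs power_mono)
  moreover have "(h - clip r h)\<^sup>2 \<le> h\<^sup>2" using clip_nearest[of 0 r h] assms by simp
  ultimately have "moreau r k d h \<le> k / 2 * R\<^sup>2 + d / 2 * R\<^sup>2"
    unfolding moreau_def using assms by (intro add_mono mult_left_mono) auto
  then show ?thesis using moreau_nonneg[of k d r h] assms by (simp add: algebra_simps add_divide_distrib)
qed

text \<open>The midpoint of the two nearest points competes in the distance of the midpoint, so the
  squared distance is convex; the gain \<open>d / 8 * (a - b)\<^sup>2\<close> is the parallelogram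
  identity for the quadratic term. It forces near-minimisers to be close to each other.\<close>

lemma moreau_midpoint:
  assumes "0 \<le> r" "0 \<le> k"
  shows "moreau r k d ((a + b) / 2) \<le> moreau r k d a / 2 + moreau r k d b / 2 - d / 8 * (a - b)\<^sup>2"
proof -
  let ?u = "\<lambda>h. h - clip r h"
  have "\<bar>(clip r a + clip r b) / 2\<bar> \<le> r"
    using abs_clip_le[OF assms(1), of a] abs_clip_le[OF assms(1), of b] by (simp add: field_simps)
  then have "(?u ((a + b) / 2))\<^sup>2 \<le> ((a + b) / 2 - (clip r a + clip r b) / 2)\<^sup>2"
    by (rule clip_nearest)
  also have "(a + b) / 2 - (clip r a + clip r b) / 2 = (?u a + ?u b) / 2"
    by (simp add: field_simps)
  also have "((?u a + ?u b) / 2)\<^sup>2 \<le> (?u a)\<^sup>2 / 2 + (?u b)\<^sup>2 / 2"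
  proof -
    have "(?u a)\<^sup>2 / 2 + (?u b)\<^sup>2 / 2 - ((?u a + ?u b) / 2)\<^sup>2 = ((?u a - ?u b) / 2)\<^sup>2"
      by (simp add: power2_eq_square field_simps)
    then show ?thesis using zero_le_power2[of "(?u a - ?u b) / 2"] by linarith
  qed
  finally have "k / 2 * (?u ((a + b) / 2))\<^sup>2 \<le> k / 2 * ((?u a)\<^sup>2 / 2 + (?u b)\<^sup>2 / 2)"
    using assms by (intro mult_left_mono) auto
  moreover have "d / 2 * ((a + b) / 2)\<^sup>2 = d / 2 * (a\<^sup>2 / 2 + b\<^sup>2 / 2) - d / 8 * (a - b)\<^sup>2"
    by (simp add: power2_eq_square field_simps)
  ultimately show ?thesis unfolding moreau_def by (simp add: algebra_simps add_divide_distrib)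
qed

text \<open>Keeping the nearest point of \<open>a\<close> as a competitor at \<open>a + s\<close>
  gives a quadratic majorant that touches at \<open>a\<close>. Its slope is the later correction
  \<open>\<eta>\<close>.\<close>

lemma moreau_descent:
  assumes "0 \<le> r" "0 \<le> k"
  shows "moreau r k d (a + s) \<le> moreau r k d a + (k * (a - clip r a) + d * a) * s + (k + d) / 2 * s\<^sup>2"
proof -
  have "((a + s) - clip r (a + s))\<^sup>2 \<le> ((a + s) - clip r a)\<^sup>2"
    using abs_clip_le[OF assms(1)] by (rule clip_nearest)
  then have "k / 2 * ((a + s) - clip r (a + s))\<^sup>2 \<le> k / 2 * ((a + s) - clip r a)\<^sup>2"
    using assms by (intro mult_left_mono) auto
  also have "\<dots> = k / 2 * (a - clip r a)\<^sup>2 + k * (a - clip r a) * s + k / 2 * s\<^sup>2"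
    by (simp add: power2_eq_square algebra_simps)
  finally show ?thesis unfolding moreau_def by (simp add: power2_eq_square algebra_simps add_divide_distrib)
qed

text \<open>\<open>closed\<close> is sequential and confined to balls because this is what lower
  semicontinuity along bounded sequences provides. Applied to constant sequences it also makes
  \<open>\<rho>\<close> respect almost sure equality. The bound in \<open>bounded_below\<close> may
  depend on the radius; it keeps the infima over balls finite.\<close>

locale convex_functional = prob_space M for M :: "'a measure" +
  fixes \<rho> :: "('a \<Rightarrow> real) \<Rightarrow> real"
  assumes convex: "\<And>H1 H2 r t. H1 \<in> ess_ball M r \<Longrightarrow> H2 \<in> ess_ball M r \<Longrightarrow> 0 \<le> t \<Longrightarrow> t \<le> 1 \<Longrightarrow>
      \<rho> (\<lambda>x. t * H1 x + (1 - t) * H2 x) \<le> t * \<rho> H1 + (1 - t) * \<rho> H2"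
    and closed: "\<And>Hs H r c. (\<And>k::nat. Hs k \<in> ess_ball M r) \<Longrightarrow> H \<in> ess_ball M r \<Longrightarrow>
      (AE x in M. (\<lambda>k. Hs k x) \<longlonglongrightarrow> H x) \<Longrightarrow> (\<And>k. \<rho> (Hs k) \<le> c) \<Longrightarrow> \<rho> H \<le> c"
    and bounded_below: "\<And>r. \<exists>L. \<forall>H\<in>ess_ball M r. L \<le> \<rho> H"

section \<open>Pairing integrable densities with bounded random variables\<close>

context prob_space
begin

lemma integrable_ess_ball:
  assumes "H \<in> ess_ball M r"
  shows "integrable M H"
  by (rule integrable_const_bound[where B=r]) (use ess_ballD[OF assms] in auto)

lemma integrable_mult_ess_ball:
  assumes "integrable M \<xi>" "H \<in> ess_ball M r"
  shows "integrable M (\<lambda>x. \<xi> x * H x)"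
proof (rule Bochner_Integration.integrable_bound[OF integrable_mult_right[OF integrable_abs[OF assms(1)], of r]])
  show "(\<lambda>x. \<xi> x * H x) \<in> borel_measurable M"
    using assms ess_ballD(1) by (intro borel_measurable_times) auto
  show "AE x in M. norm (\<xi> x * H x) \<le> norm (r * \<bar>\<xi> x\<bar>)"
    using ess_ballD(2)[OF assms(2)]
    by eventually_elim (auto simp: abs_mult mult.commute[of r] intro!: mult_left_mono)
qed

lemma integral_mult_ess_ball_le:
  assumes "integrable M \<xi>" "H \<in> ess_ball M r"
  shows "\<bar>\<integral>x. \<xi> x * H x \<partial>M\<bar> \<le> r * (\<integral>x. \<bar>\<xi> x\<bar> \<partial>M)"
proof -
  have "\<bar>\<integral>x. \<xi> x * H x \<partial>M\<bar> \<le> (\<integral>x. \<bar>\<xi> x * H x\<bar> \<partial>M)"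
    using integral_abs_bound by blast
  also have "\<dots> \<le> (\<integral>x. r * \<bar>\<xi> x\<bar> \<partial>M)"
  proof (rule integral_mono_AE)
    show "AE x in M. \<bar>\<xi> x * H x\<bar> \<le> r * \<bar>\<xi> x\<bar>"
      using ess_ballD(2)[OF assms(2)]
      by eventually_elim (auto simp: abs_mult mult.commute[of r] intro!: mult_left_mono)
  qed (use integrable_mult_ess_ball[OF assms] assms in auto)
  also have "\<dots> = r * (\<integral>x. \<bar>\<xi> x\<bar> \<partial>M)" by simp
  finally show ?thesis .
qed

lemma integral_mult_tendsto:
  assumes "integrable M \<xi>" "\<And>k::nat. Hs k \<in> ess_ball M r" "H \<in> borel_measurable M"
    and "AE x in M. (\<lambda>k. Hs k x) \<longlonglongrightarrow> H x"
  shows "(\<lambda>k. \<integral>x. \<xi> x * Hs k x \<partial>M) \<longlonglongrightarrow> (\<integral>x. \<xi> x * H x \<partial>M)"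
proof (rule integral_dominated_convergence[where w="\<lambda>x. r * \<bar>\<xi> x\<bar>"])
  show "(\<lambda>x. \<xi> x * H x) \<in> borel_measurable M" using assms by auto
  show "\<And>i. (\<lambda>x. \<xi> x * Hs i x) \<in> borel_measurable M"
    using assms ess_ballD(1) by (intro borel_measurable_times) auto
  show "AE x in M. (\<lambda>i. \<xi> x * Hs i x) \<longlonglongrightarrow> \<xi> x * H x"
    using assms(4) by eventually_elim (intro tendsto_intros)
  show "AE x in M. norm (\<xi> x * Hs i x) \<le> r * \<bar>\<xi> x\<bar>" for i
    using ess_ballD(2)[OF assms(2)]
    by eventually_elim (auto simp: abs_mult mult.commute[of r] intro!: mult_left_mono)
qed (use assms in auto)

end

text \<open>Subtracting the density found so far leaves a functional of the same kind, so that
  \<open>extend_bound\<close> can be iterated with a fresh correction each time.\<close>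

lemma (in convex_functional) tilt:
  assumes "integrable M \<xi>"
  shows "convex_functional M (\<lambda>H. \<rho> H - (\<integral>x. \<xi> x * H x \<partial>M))"
proof unfold_locales
  fix H1 H2 r t
  assume H: "H1 \<in> ess_ball M r" "H2 \<in> ess_ball M r" and t: "0 \<le> (t::real)" "t \<le> 1"
  have "(\<integral>x. \<xi> x * (t * H1 x + (1 - t) * H2 x) \<partial>M)
      = (\<integral>x. t * (\<xi> x * H1 x) + (1 - t) * (\<xi> x * H2 x) \<partial>M)"
    by (intro Bochner_Integration.integral_cong) (auto simp: algebra_simps)
  also have "\<dots> = t * (\<integral>x. \<xi> x * H1 x \<partial>M) + (1 - t) * (\<integral>x. \<xi> x * H2 x \<partial>M)"
    using integrable_mult_ess_ball[OF assms H(1)] integrable_mult_ess_ball[OF assms H(2)] by simp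
  finally show "\<rho> (\<lambda>x. t * H1 x + (1 - t) * H2 x) - (\<integral>x. \<xi> x * (t * H1 x + (1 - t) * H2 x) \<partial>M)
     \<le> t * (\<rho> H1 - (\<integral>x. \<xi> x * H1 x \<partial>M)) + (1 - t) * (\<rho> H2 - (\<integral>x. \<xi> x * H2 x \<partial>M))"
    using convex[OF H t] by (simp add: algebra_simps)
next
  fix Hs :: "nat \<Rightarrow> 'a \<Rightarrow> real" and H r c
  assume *: "\<And>k. Hs k \<in> ess_ball M r" "H \<in> ess_ball M r" "AE x in M. (\<lambda>k. Hs k x) \<longlonglongrightarrow> H x"
    "\<And>k. \<rho> (Hs k) - (\<integral>x. \<xi> x * Hs k x \<partial>M) \<le> c"
  have lim: "(\<lambda>k. \<integral>x. \<xi> x * Hs k x \<partial>M) \<longlonglongrightarrow> (\<integral>x. \<xi> x * H x \<partial>M)"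
    by (rule integral_mult_tendsto[OF assms *(1) ess_ballD(1)[OF *(2)] *(3)])
  show "\<rho> H - (\<integral>x. \<xi> x * H x \<partial>M) \<le> c"
  proof (rule field_le_epsilon)
    fix e :: real assume "0 < e"
    from order_tendstoD(2)[OF lim, of "(\<integral>x. \<xi> x * H x \<partial>M) + e"] \<open>0 < e\<close>
    obtain N where N: "\<And>k. N \<le> k \<Longrightarrow> (\<integral>x. \<xi> x * Hs k x \<partial>M) < (\<integral>x. \<xi> x * H x \<partial>M) + e"
      by (auto simp: eventually_sequentially)
    \<comment> \<open>Closedness needs one level for all members; dropping the first
      \<open>N\<close> of them replaces their varying integrals by the limit plus
      \<open>e\<close>.\<close>
    have "\<rho> H \<le> c + (\<integral>x. \<xi> x * H x \<partial>M) + e"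
    proof (rule closed[of "\<lambda>k. Hs (k + N)" r])
      show "AE x in M. (\<lambda>k. Hs (k + N) x) \<longlonglongrightarrow> H x"
        using *(3) by eventually_elim (rule LIMSEQ_ignore_initial_segment)
      show "\<rho> (Hs (k + N)) \<le> c + (\<integral>x. \<xi> x * H x \<partial>M) + e" for k
        using *(4)[of "k + N"] N[of "k + N"] by simp
    qed (use * in auto)
    then show "\<rho> H - (\<integral>x. \<xi> x * H x \<partial>M) \<le> c + e" by simp
  qed
next
  fix r
  obtain L where L: "\<And>H. H \<in> ess_ball M r \<Longrightarrow> L \<le> \<rho> H" using bounded_below by blast
  show "\<exists>L. \<forall>H\<in>ess_ball M r. L \<le> \<rho> H - (\<integral>x. \<xi> x * H x \<partial>M)"
  proof (intro exI ballI)
    fix H assume H: "H \<in> ess_ball M r"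
    show "L - r * (\<integral>x. \<bar>\<xi> x\<bar> \<partial>M) \<le> \<rho> H - (\<integral>x. \<xi> x * H x \<partial>M)"
      using L[OF H] integral_mult_ess_ball_le[OF assms H] by linarith
  qed
qed

text \<open>
  Krein--Smulian step.  A lower bound on the ball of radius \<open>r\<close> extends to a bigger ball after a linear
  correction \<open>\<eta>\<close> whose \<open>L\<^sup>1\<close> norm is controlled with the factor \<open>r\<close>.  One almost minimises
  \<open>\<rho>\<close> plus \<open>k\<close> times the squared distance from the small ball; the small quadratic term with coefficient
  \<open>d\<close> makes the minimisers converge in \<open>L\<^sup>2\<close> as \<open>k \<rightarrow> \<infinity>\<close>, and \<open>\<eta>\<close> is the derivative of the added terms.
\<close>

lemma (in convex_functional) extend_bound:
  assumes r: "0 \<le> r" "r < R" and c: "\<And>H. H \<in> ess_ball M r \<Longrightarrow> c \<le> \<rho> H" and "0 < \<epsilon>"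
  obtains \<eta> where "integrable M \<eta>"
    "\<And>H. H \<in> ess_ball M R \<Longrightarrow> c - \<epsilon> + r * (\<integral>x. \<bar>\<eta> x\<bar> \<partial>M) \<le> \<rho> H + (\<integral>x. \<eta> x * H x \<partial>M)"
proof -
  \<comment> \<open>Three errors of size \<open>s\<close> are made: by the quadratic term
    (\<open>d * r\<^sup>2 \<le> s\<close>), by the choice of the index \<open>k\<close>
    (\<open>c - s < \<rho> (Hs k)\<close>), and by the inexact minimality of \<open>Hs k\<close>
    (\<open>t k * D k \<le> s\<close>).\<close>
  define s where "s = min 1 (\<epsilon> / 3)"
  have s: "0 < s" "s \<le> 1" "3 * s \<le> \<epsilon>" using \<open>0 < \<epsilon>\<close> by (auto simp: s_def)
  define d where "d = s / (r\<^sup>2 + 1)"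
  have d: "0 < d" using s by (simp add: d_def add_nonneg_pos)
  have dr: "d * r\<^sup>2 \<le> s"
  proof -
    have "0 < r\<^sup>2 + 1" by (simp add: add_nonneg_pos)
    then show ?thesis using s by (simp add: d_def field_simps)
  qed
  have R: "0 \<le> R" using r by simp
  obtain L where L: "\<And>H. H \<in> ess_ball M R \<Longrightarrow> L \<le> \<rho> H" using bounded_below by blast
  define \<Phi> where "\<Phi> k H = \<rho> H + (\<integral>x. moreau r (real k) d (H x) \<partial>M)" for k :: nat and H
  define v where "v k = Inf (\<Phi> k ` ess_ball M R)" for k
  \<comment> \<open>\<open>t k\<close> is the length of the step from \<open>Hs k\<close> towards a
    competitor, and \<open>(t k)\<^sup>2\<close> the tolerance of the minimisation. On the ball of
    radius \<open>R\<close> the second-order term is at most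
    \<open>(t k)\<^sup>2 * (D k - 1)\<close>, and the \<open>1\<close> pays for the tolerance;
    division by \<open>t k\<close> leaves \<open>t k * D k\<close>. The summand \<open>k\<close> in
    the denominator of \<open>t k\<close> makes the tolerances vanish in the limit.\<close>
  define D where "D k = 1 + 2 * (real k + d) * R\<^sup>2" for k :: nat
  define t where "t k = s / (D k + k)" for k :: nat
  have Dk: "1 \<le> D k" for k using d by (simp add: D_def)
  have t: "0 < t k" "t k \<le> 1" "t k * D k \<le> s" "t k \<le> 1 / (real k + 1)" for k
  proof -
    have *: "0 < D k + real k" using Dk[of k] by linarith
    show "0 < t k" using s * by (simp add: t_def)
    show "t k \<le> 1" using s * Dk[of k] by (simp add: t_def field_simps)
    show "t k * D k \<le> s" using s * by (simp add: t_def field_simps)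
    show "t k \<le> 1 / (real k + 1)" unfolding t_def using s Dk[of k] by (intro frac_le) auto
  qed
  have int_moreau: "integrable M (\<lambda>x. moreau r (real k) d (H x))" if "H \<in> ess_ball M R" for k H
  proof (rule integrable_const_bound)
    show "AE x in M. norm (moreau r (real k) d (H x)) \<le> (k + d) / 2 * R\<^sup>2"
      using ess_ballD(2)[OF that] by eventually_elim (use moreau_bound[of r "real k" d] r d in auto)
  qed (use ess_ballD(1)[OF that] in measurable)
  have \<Phi>_ge: "L \<le> \<Phi> k H" if "H \<in> ess_ball M R" for k H
    unfolding \<Phi>_def using L[OF that] moreau_nonneg[of "real k" d] d
    by (smt (verit) Bochner_Integration.integral_nonneg of_nat_0_le_iff)
  have v_le: "v k \<le> \<Phi> k H" if "H \<in> ess_ball M R" for k H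
    unfolding v_def using \<Phi>_ge that by (intro cINF_lower bdd_belowI2) auto
  have "\<exists>H\<in>ess_ball M R. \<Phi> k H \<le> v k + (t k)\<^sup>2" for k
  proof (rule ccontr)
    assume "\<not> ?thesis"
    then have "v k + (t k)\<^sup>2 \<le> v k"
      unfolding v_def[of k] using zero_in_ess_ball[OF R] by (intro cINF_greatest) (auto simp: v_def)
    then show False using t(1)[of k] by simp
  qed
  then obtain Hs where Hs: "\<And>k. Hs k \<in> ess_ball M R" "\<And>k. \<Phi> k (Hs k) \<le> v k + (t k)\<^sup>2" by metis
  have Hs_meas[measurable]: "\<And>k. Hs k \<in> borel_measurable M" using Hs(1) ess_ballD(1) by blast
  have \<Phi>_mono: "\<Phi> k H \<le> \<Phi> l H" if "k \<le> l" "H \<in> ess_ball M R" for k l H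
    unfolding \<Phi>_def using that int_moreau
    by (intro add_left_mono integral_mono) (auto intro: moreau_mono)
  have v_mono: "v k \<le> v l" if "k \<le> l" for k l
    unfolding v_def[of l] using zero_in_ess_ball[OF R, of M] \<Phi>_mono[OF that] v_le
    by (intro cINF_greatest) (blast intro: order_trans)+
  have v_le_0: "v k \<le> \<rho> (\<lambda>_. 0)" for k
    using v_le[OF zero_in_ess_ball[OF R], of k] by (simp add: \<Phi>_def moreau_zero[OF r(1)])
  have L_le_v: "L \<le> v k" for k
    unfolding v_def using zero_in_ess_ball[OF R, of M] \<Phi>_ge by (intro cINF_greatest) blast+
  have "Bseq v"
  proof (rule BseqI'[where K="\<bar>L\<bar> + \<bar>\<rho> (\<lambda>_. 0)\<bar>"])
    show "norm (v k) \<le> \<bar>L\<bar> + \<bar>\<rho> (\<lambda>_. 0)\<bar>" for k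
      using L_le_v[of k] v_le_0[of k] by simp
  qed
  moreover have "monoseq v" using v_mono by (simp add: monoseq_def)
  ultimately have "Cauchy v" by (intro convergent_Cauchy Bseq_monoseq_convergent)

  have sq_int: "integrable M (\<lambda>x. (Hs k x - Hs l x)\<^sup>2)" for k l
  proof (rule integrable_const_bound)
    show "AE x in M. norm ((Hs k x - Hs l x)\<^sup>2) \<le> (2 * R)\<^sup>2"
      using ess_ballD(2)[OF Hs(1)[of k]] ess_ballD(2)[OF Hs(1)[of l]]
    proof eventually_elim
      case (elim x)
      then have "\<bar>Hs k x - Hs l x\<bar> \<le> \<bar>2 * R\<bar>" by linarith
      then have "(Hs k x - Hs l x)\<^sup>2 \<le> (2 * R)\<^sup>2" by (simp only: abs_le_square_iff)
      then show ?case by simp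
    qed
  qed auto
  \<comment> \<open>The midpoint of \<open>Hs k\<close> and \<open>Hs l\<close> competes in
    \<open>v k\<close>. Strong convexity then bounds their distance by the tolerances and the
    increase of \<open>v\<close>, which is small because \<open>v\<close> is monotone and
    bounded.\<close>
  have sq_le: "d / 4 * (\<integral>x. (Hs k x - Hs l x)\<^sup>2 \<partial>M) \<le> (v l - v k) + (t k)\<^sup>2 + (t l)\<^sup>2" if "k \<le> l" for k l
  proof -
    let ?m = "\<lambda>x. 1 / 2 * Hs k x + (1 - 1 / 2) * Hs l x"
    have m: "?m \<in> ess_ball M R" using Hs(1) by (intro ess_ball_convex) auto
    have "v k \<le> \<Phi> k ?m" using m by (rule v_le)
    also have "\<dots> \<le> (1 / 2 * \<rho> (Hs k) + (1 - 1 / 2) * \<rho> (Hs l)) + (\<integral>x. moreau r k d (Hs k x) / 2 + moreau r k d (Hs l x) / 2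
        - d / 8 * (Hs k x - Hs l x)\<^sup>2 \<partial>M)"
      unfolding \<Phi>_def
    proof (intro add_mono integral_mono convex[where r=R])
      show "moreau r (real k) d (?m x) \<le> moreau r k d (Hs k x) / 2 + moreau r k d (Hs l x) / 2
        - d / 8 * (Hs k x - Hs l x)\<^sup>2" for x
        using moreau_midpoint[OF r(1), of "real k" d "Hs k x" "Hs l x"] by (simp add: field_simps)
    qed (use m Hs(1) int_moreau sq_int in \<open>auto intro!: Bochner_Integration.integrable_diff\<close>)
    also have "\<dots> = \<Phi> k (Hs k) / 2 + \<Phi> k (Hs l) / 2 - d / 8 * (\<integral>x. (Hs k x - Hs l x)\<^sup>2 \<partial>M)"
      using int_moreau[OF Hs(1)] sq_int by (simp add: \<Phi>_def add_divide_distrib)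
    finally show ?thesis
      using Hs(2)[of k] Hs(2)[of l] \<Phi>_mono[OF that Hs(1)[of l]] by (simp add: field_simps)
  qed
  have t_sq: "(\<lambda>k. (t k)\<^sup>2) \<longlonglongrightarrow> 0"
  proof (rule tendsto_sandwich[of "\<lambda>_. 0" _ _ "\<lambda>k. 1 / (real k + 1)"])
    have "(t k)\<^sup>2 \<le> 1 / (real k + 1)" for k
      using t(1,2,4)[of k] mult_left_le[of "t k" "t k"] unfolding power2_eq_square by linarith
    then show "\<forall>\<^sub>F k in sequentially. (t k)\<^sup>2 \<le> 1 / (real k + 1)" by simp
  qed (auto simp: add.commute intro: LIMSEQ_inverse_real_of_nat[unfolded inverse_eq_divide of_nat_Suc])
  have cauchy1: "\<exists>N. \<forall>i\<ge>N. \<forall>j\<ge>N. (\<integral>x. norm (Hs i x - Hs j x) \<partial>M) < e" if "0 < e" for e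
  proof -
    \<comment> \<open>Chosen so that the squared \<open>L\<^sup>2\<close> distance falls below
      \<open>(e / 2)\<^sup>2\<close>; the passage to \<open>L\<^sup>1\<close> is Young's inequality
      \<open>\<bar>y\<bar> \<le> e / 4 + y\<^sup>2 / e\<close>, whose right-hand side then has mean
      below \<open>e / 2\<close>.\<close>
    define a where "a = d / 4 * (e\<^sup>2 / 4)"
    have a: "0 < a" using d that by (simp add: a_def)
    obtain N1 where N1: "\<And>m n. m \<ge> N1 \<Longrightarrow> n \<ge> N1 \<Longrightarrow> norm (v m - v n) < a / 2"
      using CauchyD[OF \<open>Cauchy v\<close>, of "a / 2"] a by auto
    obtain N2 where N2: "\<And>k. k \<ge> N2 \<Longrightarrow> (t k)\<^sup>2 < a / 4"
      using order_tendstoD(2)[OF t_sq, of "a / 4"] a by (auto simp: eventually_sequentially)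
    have main: "(\<integral>x. \<bar>Hs i x - Hs j x\<bar> \<partial>M) < e" if ij: "i \<ge> max N1 N2" "i \<le> j" for i j
    proof -
      have "d / 4 * (\<integral>x. (Hs i x - Hs j x)\<^sup>2 \<partial>M) < a"
        using sq_le[OF ij(2)] N1[of j i] N2[of i] N2[of j] ij unfolding real_norm_def by linarith
      then have "(\<integral>x. (Hs i x - Hs j x)\<^sup>2 \<partial>M) < (e / 2)\<^sup>2"
        using d by (simp add: a_def power2_eq_square)
      moreover have "(\<integral>x. \<bar>Hs i x - Hs j x\<bar> \<partial>M) \<le> (\<integral>x. e / 4 + (Hs i x - Hs j x)\<^sup>2 / e \<partial>M)"
      proof (rule integral_mono)
        show "\<bar>Hs i x - Hs j x\<bar> \<le> e / 4 + (Hs i x - Hs j x)\<^sup>2 / e" for x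
        proof -
          have "0 \<le> (\<bar>Hs i x - Hs j x\<bar> - e / 2)\<^sup>2" by simp
          then show ?thesis using \<open>0 < e\<close> by (simp add: power2_eq_square field_simps)
        qed
        show "integrable M (\<lambda>x. \<bar>Hs i x - Hs j x\<bar>)"
          using integrable_ess_ball[OF Hs(1)] by auto
      qed (use sq_int in auto)
      moreover have "(\<integral>x. e / 4 + (Hs i x - Hs j x)\<^sup>2 / e \<partial>M) = e / 4 + (\<integral>x. (Hs i x - Hs j x)\<^sup>2 \<partial>M) / e"
        using sq_int by (simp add: prob_space)
      moreover have "(\<integral>x. (Hs i x - Hs j x)\<^sup>2 \<partial>M) / e < e / 4"
        using calculation(1) \<open>0 < e\<close> by (simp only: power2_eq_square[of "e / 2"]) (simp add: field_simps)
      ultimately show ?thesis using \<open>0 < e\<close> by linarith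
    qed
    have "(\<integral>x. norm (Hs i x - Hs j x) \<partial>M) < e" if "i \<ge> max N1 N2" "j \<ge> max N1 N2" for i j
      using main[of i j] main[of j i] that by (cases "i \<le> j") (auto simp: abs_minus_commute)
    then show ?thesis by blast
  qed
  obtain f where f: "strict_mono f" "AE x in M. Cauchy (\<lambda>i. Hs (f i) x)"
    using cauchy_L1_AE_cauchy_subseq[of M Hs, OF integrable_ess_ball[OF Hs(1)] cauchy1] by auto
  define H where "H x = lim (\<lambda>i. Hs (f i) x)" for x
  have H_lim: "AE x in M. (\<lambda>i. Hs (f i) x) \<longlonglongrightarrow> H x"
    using f(2) by eventually_elim (simp add: H_def Cauchy_convergent_iff convergent_LIMSEQ_iff)
  have H_meas[measurable]: "H \<in> borel_measurable M" unfolding H_def by measurable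
  have AE_all: "AE x in M. \<forall>i. \<bar>Hs (f i) x\<bar> \<le> R"
    using ess_ballD(2)[OF Hs(1)] by (simp add: AE_all_countable)
  have H_R: "H \<in> ess_ball M R"
  proof (rule ess_ballI[OF H_meas])
    show "AE x in M. \<bar>H x\<bar> \<le> R" using H_lim AE_all
    proof eventually_elim
      case (elim x)
      then show ?case by (intro LIMSEQ_le_const2[OF tendsto_rabs]) auto
    qed
  qed
  let ?u = "\<lambda>h. (h - clip r h)\<^sup>2"
  have u_le: "?u h \<le> R\<^sup>2" if "\<bar>h\<bar> \<le> R" for h
  proof -
    have "?u h \<le> h\<^sup>2" using clip_nearest[of 0 r h] r by simp
    also have "\<dots> \<le> R\<^sup>2" using that R by (simp add: abs_le_square_iff[symmetric])
    finally show ?thesis .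
  qed
  \<comment> \<open>\<open>k / 2\<close> times the squared distance stays bounded while
    \<open>k\<close> grows, so the limit \<open>H\<close> has distance \<open>0\<close> from the
    ball of radius \<open>r\<close>, where the bound \<open>c\<close> applies.\<close>
  have u_small: "(\<integral>x. ?u (Hs k x) \<partial>M) \<le> 2 * (\<rho> (\<lambda>_. 0) + 1 - L) / k" if "0 < k" for k
  proof -
    have ui: "integrable M (\<lambda>x. ?u (Hs k x))"
    proof (rule integrable_const_bound)
      show "AE x in M. norm (?u (Hs k x)) \<le> R\<^sup>2"
        using ess_ballD(2)[OF Hs(1)[of k]] by eventually_elim (use u_le in auto)
    qed measurable
    have "real k / 2 * (\<integral>x. ?u (Hs k x) \<partial>M) = (\<integral>x. real k / 2 * ?u (Hs k x) \<partial>M)" by simp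
    also have "\<dots> \<le> (\<integral>x. moreau r k d (Hs k x) \<partial>M)"
      using ui int_moreau[OF Hs(1)] d by (intro integral_mono) (auto simp: moreau_def)
    also have "\<dots> = \<Phi> k (Hs k) - \<rho> (Hs k)" by (simp add: \<Phi>_def)
    also have "\<dots> \<le> \<rho> (\<lambda>_. 0) + 1 - L"
    proof -
      have "(t k)\<^sup>2 \<le> 1" using t[of k] by (simp add: power_le_one)
      then show ?thesis using Hs(2)[of k] v_le_0[of k] L[OF Hs(1)[of k]] by linarith
    qed
    finally show ?thesis using that by (simp add: field_simps)
  qed
  have "(\<lambda>i. \<integral>x. ?u (Hs (f i) x) \<partial>M) \<longlonglongrightarrow> (\<integral>x. ?u (H x) \<partial>M)"
  proof (rule integral_dominated_convergence[where w="\<lambda>_. R\<^sup>2"])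
    show "AE x in M. (\<lambda>i. ?u (Hs (f i) x)) \<longlonglongrightarrow> ?u (H x)"
      using H_lim by eventually_elim (intro tendsto_intros isCont_tendsto_compose[OF continuous_clip])
    show "AE x in M. norm (?u (Hs (f i) x)) \<le> R\<^sup>2" for i
      using ess_ballD(2)[OF Hs(1)[of "f i"]] by eventually_elim (use u_le in auto)
  qed auto
  moreover have "(\<lambda>i. \<integral>x. ?u (Hs (f i) x) \<partial>M) \<longlonglongrightarrow> 0"
  proof (rule tendsto_sandwich[of "\<lambda>_. 0" _ _ "\<lambda>i. 2 * (\<rho> (\<lambda>_. 0) + 1 - L) / real i"])
    have C: "0 \<le> \<rho> (\<lambda>_. 0) + 1 - L" using L[OF zero_in_ess_ball[OF R]] by simp
    have "(\<integral>x. ?u (Hs (f i) x) \<partial>M) \<le> 2 * (\<rho> (\<lambda>_. 0) + 1 - L) / real i" if "0 < i" for i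
    proof -
      have "i \<le> f i" using f(1) by (rule seq_suble)
      then show ?thesis using u_small[of "f i"] that C
        by (smt (verit) divide_left_mono gr_zeroI le_zero_eq mult_pos_pos of_nat_0_less_iff of_nat_mono)
    qed
    then show "\<forall>\<^sub>F i in sequentially. (\<integral>x. ?u (Hs (f i) x) \<partial>M) \<le> 2 * (\<rho> (\<lambda>_. 0) + 1 - L) / real i"
      by (intro eventually_mono[OF eventually_gt_at_top[of 0]])
    show "(\<lambda>i. 2 * (\<rho> (\<lambda>_. 0) + 1 - L) / real i) \<longlonglongrightarrow> 0"
      by (rule lim_const_over_n)
  qed auto
  ultimately have "(\<integral>x. ?u (H x) \<partial>M) = 0" using LIMSEQ_unique by blast
  moreover have "integrable M (\<lambda>x. ?u (H x))"
  proof (rule integrable_const_bound)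
    show "AE x in M. norm (?u (H x)) \<le> R\<^sup>2"
      using ess_ballD(2)[OF H_R] by eventually_elim (use u_le in auto)
  qed measurable
  ultimately have "AE x in M. ?u (H x) = 0"
    by (subst (asm) integral_nonneg_eq_0_iff_AE) auto
  then have "AE x in M. \<bar>H x\<bar> \<le> r"
    by eventually_elim (use abs_clip_le[OF r(1)] in \<open>metis eq_iff_diff_eq_0 power_eq_0_iff\<close>)
  then have "c \<le> \<rho> H" by (intro c ess_ballI) auto
  \<comment> \<open>Lower semicontinuity read backwards: were all terms at most
    \<open>c - s\<close>, closedness would push \<open>\<rho> H\<close> below \<open>c\<close>
    too.\<close>
  have "\<exists>i. c - s < \<rho> (Hs (f i))"
  proof (rule ccontr)
    assume "\<not> ?thesis"
    then have "\<rho> (Hs (f i)) \<le> c - s" for i by (simp add: not_less)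
    then have "\<rho> H \<le> c - s" using closed[of "\<lambda>i. Hs (f i)" R H] Hs(1) H_R H_lim by blast
    then show False using \<open>c \<le> \<rho> H\<close> s by simp
  qed
  then obtain k where k: "c - s < \<rho> (Hs k)" by blast
  define \<eta> where "\<eta> x = real k * (Hs k x - clip r (Hs k x)) + d * Hs k x" for x
  have \<eta>_ball: "\<eta> \<in> ess_ball M ((real k + d) * R)"
  proof (rule ess_ballI)
    show "AE x in M. \<bar>\<eta> x\<bar> \<le> (real k + d) * R"
      using ess_ballD(2)[OF Hs(1)[of k]]
    proof eventually_elim
      case (elim x)
      have "\<bar>\<eta> x\<bar> \<le> real k * \<bar>Hs k x - clip r (Hs k x)\<bar> + d * \<bar>Hs k x\<bar>"
        unfolding \<eta>_def using d by (intro order_trans[OF abs_triangle_ineq]) (simp add: abs_mult)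
      also have "\<dots> \<le> real k * R + d * R"
        using d elim abs_minus_clip_le[OF r(1), of "Hs k x"] by (intro add_mono mult_left_mono) auto
      finally show ?case by (simp add: algebra_simps)
    qed
  qed (unfold \<eta>_def, measurable)
  have \<eta>_int: "integrable M \<eta>" using integrable_ess_ball[OF \<eta>_ball] .
  show thesis
  proof (rule that[OF \<eta>_int])
    fix H' assume H': "H' \<in> ess_ball M R"
    have H'_int: "integrable M (\<lambda>x. \<eta> x * H' x)" and Hk_int: "integrable M (\<lambda>x. \<eta> x * Hs k x)"
      using integrable_mult_ess_ball[OF \<eta>_int] H' Hs(1) by auto
    \<comment> \<open>First-order condition at an inexact minimiser: move from \<open>Hs k\<close> a
      little towards \<open>H'\<close>, use convexity of \<open>\<rho>\<close> and the quadratic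
      majorant of \<open>moreau\<close>, and divide by \<open>t k\<close>.\<close>
    let ?m = "\<lambda>x. t k * H' x + (1 - t k) * Hs k x"
    have m: "?m \<in> ess_ball M R" using t[of k] H' Hs(1)[of k] by (intro ess_ball_convex) auto
    have "v k \<le> \<Phi> k ?m" using m by (rule v_le)
    also have "\<dots> \<le> (t k * \<rho> H' + (1 - t k) * \<rho> (Hs k)) + (\<integral>x. moreau r k d (Hs k x)
       + t k * (\<eta> x * H' x - \<eta> x * Hs k x) + (t k)\<^sup>2 * (D k - 1) \<partial>M)"
      unfolding \<Phi>_def
    proof (intro add_mono integral_mono_AE convex[where r=R])
      show "AE x in M. moreau r (real k) d (?m x) \<le> moreau r k d (Hs k x)
         + t k * (\<eta> x * H' x - \<eta> x * Hs k x) + (t k)\<^sup>2 * (D k - 1)"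
        using ess_ballD(2)[OF Hs(1)[of k]] ess_ballD(2)[OF H']
      proof eventually_elim
        case (elim x)
        let ?s = "t k * (H' x - Hs k x)"
        have "\<bar>H' x - Hs k x\<bar> \<le> \<bar>2 * R\<bar>" using elim by linarith
        then have "(H' x - Hs k x)\<^sup>2 \<le> (2 * R)\<^sup>2" by (simp only: abs_le_square_iff)
        then have "(real k + d) / 2 * ((t k)\<^sup>2 * (H' x - Hs k x)\<^sup>2) \<le> (real k + d) / 2 * ((t k)\<^sup>2 * (2 * R)\<^sup>2)"
          using d by (intro mult_left_mono) auto
        moreover have "moreau r k d (Hs k x + ?s) \<le> moreau r k d (Hs k x) + \<eta> x * ?s + (k + d) / 2 * ?s\<^sup>2"
          using moreau_descent[OF r(1), of k d "Hs k x" ?s] by (simp add: \<eta>_def)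
        moreover have m_eq: "?m x = Hs k x + ?s" by (simp add: algebra_simps)
        moreover have s_eq: "?s\<^sup>2 = (t k)\<^sup>2 * (H' x - Hs k x)\<^sup>2" by (rule power_mult_distrib)
        moreover have "(real k + d) / 2 * ((t k)\<^sup>2 * (2 * R)\<^sup>2) = (t k)\<^sup>2 * (D k - 1)"
          by (simp add: D_def power2_eq_square algebra_simps)
        moreover have "\<eta> x * ?s = t k * (\<eta> x * H' x - \<eta> x * Hs k x)" by (simp add: algebra_simps)
        ultimately show ?case unfolding m_eq s_eq by linarith
      qed
    qed (use m t[of k] H' H'_int Hk_int Hs(1) int_moreau in auto)
    also have "\<dots> = \<Phi> k (Hs k) + t k * (\<rho> H' - \<rho> (Hs k) + (\<integral>x. \<eta> x * H' x \<partial>M) - (\<integral>x. \<eta> x * Hs k x \<partial>M))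
        + (t k)\<^sup>2 * (D k - 1)"
    proof -
      have "(\<integral>x. moreau r k d (Hs k x) + t k * (\<eta> x * H' x - \<eta> x * Hs k x) + (t k)\<^sup>2 * (D k - 1) \<partial>M)
        = (\<integral>x. moreau r k d (Hs k x) \<partial>M)
          + t k * ((\<integral>x. \<eta> x * H' x \<partial>M) - (\<integral>x. \<eta> x * Hs k x \<partial>M)) + (t k)\<^sup>2 * (D k - 1)"
        using H'_int Hk_int int_moreau[OF Hs(1)] by (simp add: prob_space)
      then show ?thesis by (simp add: \<Phi>_def algebra_simps)
    qed
    finally have "0 \<le> t k * (\<rho> H' - \<rho> (Hs k) + (\<integral>x. \<eta> x * H' x \<partial>M) - (\<integral>x. \<eta> x * Hs k x \<partial>M)) + (t k)\<^sup>2 * D k"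
      using Hs(2)[of k] by (simp add: algebra_simps)
    also have "\<dots> = t k * (\<rho> H' - \<rho> (Hs k) + (\<integral>x. \<eta> x * H' x \<partial>M) - (\<integral>x. \<eta> x * Hs k x \<partial>M) + t k * D k)"
      by (simp add: power2_eq_square algebra_simps)
    finally have "\<rho> (Hs k) + (\<integral>x. \<eta> x * Hs k x \<partial>M) - s \<le> \<rho> H' + (\<integral>x. \<eta> x * H' x \<partial>M)"
      using t(1,3)[of k] by (simp add: zero_le_mult_iff)
    moreover have "r * (\<integral>x. \<bar>\<eta> x\<bar> \<partial>M) - s \<le> (\<integral>x. \<eta> x * Hs k x \<partial>M)"
    proof -
      have "r * (\<integral>x. \<bar>\<eta> x\<bar> \<partial>M) - d * r\<^sup>2 = (\<integral>x. r * \<bar>\<eta> x\<bar> - d * r\<^sup>2 \<partial>M)"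
        using \<eta>_int by (simp add: prob_space)
      also have "\<dots> \<le> (\<integral>x. \<eta> x * Hs k x \<partial>M)"
      proof (rule integral_mono)
        show "r * \<bar>\<eta> x\<bar> - d * r\<^sup>2 \<le> \<eta> x * Hs k x" for x
          unfolding \<eta>_def using d by (intro minus_clip_mult_ge r) auto
      qed (use Hk_int \<eta>_int in auto)
      finally show ?thesis using dr by linarith
    qed
    ultimately show "c - \<epsilon> + r * (\<integral>x. \<bar>\<eta> x\<bar> \<partial>M) \<le> \<rho> H' + (\<integral>x. \<eta> x * H' x \<partial>M)"
      using k s by linarith
  qed
qed

section \<open>Summing the corrections to an integrable density\<close>

lemma AE_summable_of_integral:
  fixes f :: "nat \<Rightarrow> 'a \<Rightarrow> real"
  assumes "\<And>n. integrable M (f n)" and "summable (\<lambda>n. \<integral>x. \<bar>f n x\<bar> \<partial>M)"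
  shows "AE x in M. summable (\<lambda>n. \<bar>f n x\<bar>)"
proof -
  have [measurable]: "\<And>n. f n \<in> borel_measurable M" using assms(1) by (rule borel_measurable_integrable)
  have "(\<integral>\<^sup>+x. (\<Sum>n. ennreal \<bar>f n x\<bar>) \<partial>M) = (\<Sum>n. \<integral>\<^sup>+x. ennreal \<bar>f n x\<bar> \<partial>M)"
    by (rule nn_integral_suminf) measurable
  also have "\<dots> = (\<Sum>n. ennreal (\<integral>x. \<bar>f n x\<bar> \<partial>M))"
    using assms(1) by (intro suminf_cong nn_integral_eq_integral) auto
  also have "\<dots> = ennreal (\<Sum>n. \<integral>x. \<bar>f n x\<bar> \<partial>M)"
    using assms(2) by (intro suminf_ennreal2) auto
  also have "\<dots> < \<infinity>" unfolding infinity_ennreal_def by (rule ennreal_less_top)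
  finally have "(\<integral>\<^sup>+x. (\<Sum>n. ennreal \<bar>f n x\<bar>) \<partial>M) \<noteq> \<infinity>" by (rule less_imp_neq)
  then have "AE x in M. (\<Sum>n. ennreal \<bar>f n x\<bar>) \<noteq> \<infinity>"
    by (rule nn_integral_PInf_AE[rotated]) measurable
  then show ?thesis
    by eventually_elim (rule summable_suminf_not_top, simp_all only: abs_ge_zero infinity_ennreal_def, simp)
qed

text \<open>At radius \<open>0\<close> the bound is \<open>\<rho> (\<lambda>_. 0)\<close>. Extending
  it from radius \<open>n\<close> to \<open>n + 1\<close> spends
  \<open>\<epsilon> / 2 ^ (n + 1)\<close> and earns \<open>n\<close> times the norm of the
  correction. Since the zero variable lies in every ball, the bound never exceeds
  \<open>\<rho> (\<lambda>_. 0)\<close>, so all earnings together are at most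
  \<open>\<epsilon>\<close> and the corrections can be summed in \<open>L\<^sup>1\<close>.\<close>

theorem (in convex_functional) approximate_subgradient:
  assumes "0 < \<epsilon>"
  obtains \<xi> where "integrable M \<xi>"
    "\<And>H r. H \<in> ess_ball M r \<Longrightarrow> \<rho> (\<lambda>_. 0) + (\<integral>x. \<xi> x * H x \<partial>M) - \<epsilon> \<le> \<rho> H"
proof -
  \<comment> \<open>A state consists of the density built so far and the lower bound that it
    guarantees on the ball of radius \<open>n\<close>; \<open>Q\<close> keeps the account of the
    bound.\<close>
  define P where "P n p \<longleftrightarrow> integrable M (fst p) \<and>
    (\<forall>H\<in>ess_ball M (real n). snd p \<le> \<rho> H - (\<integral>x. fst p x * H x \<partial>M))" for n :: nat and p :: "('a \<Rightarrow> real) \<times> real"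
  define Q where "Q n p p' \<longleftrightarrow>
    snd p' = snd p - \<epsilon> * (1/2) ^ Suc n + real n * (\<integral>x. \<bar>fst p' x - fst p x\<bar> \<partial>M)"
    for n :: nat and p p' :: "('a \<Rightarrow> real) \<times> real"
  have base: "P 0 (\<lambda>_. 0, \<rho> (\<lambda>_. 0))"
    unfolding P_def
  proof (intro conjI ballI)
    fix H assume H: "H \<in> ess_ball M (real 0)"
    have "\<rho> (\<lambda>_. 0) \<le> \<rho> H"
    proof (rule closed[of "\<lambda>_. H" "real 0"])
      show "AE x in M. (\<lambda>k. H x) \<longlonglongrightarrow> 0" using ess_ballD(2)[OF H] by eventually_elim simp
    qed (use H zero_in_ess_ball[of 0 M] in auto)
    then show "snd (\<lambda>_. 0, \<rho> (\<lambda>_. 0)) \<le> \<rho> H - (\<integral>x. fst (\<lambda>_. 0, \<rho> (\<lambda>_. 0)) x * H x \<partial>M)" by simp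
  qed auto
  have step: "\<exists>p'. P (Suc n) p' \<and> Q n p p'" if "P n p" for n p
  proof -
    have \<xi>: "integrable M (fst p)" using that by (simp add: P_def)
    interpret tilted: convex_functional M "\<lambda>H. \<rho> H - (\<integral>x. fst p x * H x \<partial>M)"
      using \<xi> by (rule tilt)
    obtain \<eta> where \<eta>: "integrable M \<eta>"
      "\<And>H. H \<in> ess_ball M (real (Suc n)) \<Longrightarrow> snd p - \<epsilon> * (1/2) ^ Suc n + real n * (\<integral>x. \<bar>\<eta> x\<bar> \<partial>M)
        \<le> \<rho> H - (\<integral>x. fst p x * H x \<partial>M) + (\<integral>x. \<eta> x * H x \<partial>M)"
    proof (rule tilted.extend_bound[of "real n" "real (Suc n)" "snd p" "\<epsilon> * (1/2) ^ Suc n"])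
      show "snd p \<le> \<rho> H - (\<integral>x. fst p x * H x \<partial>M)" if "H \<in> ess_ball M (real n)" for H
        using \<open>P n p\<close> that by (simp add: P_def)
      show "0 < \<epsilon> * (1/2) ^ Suc n" using assms by simp
      show "real n < real (Suc n)" by simp
    qed (simp, rule that)
    let ?p' = "(\<lambda>x. fst p x - \<eta> x, snd p - \<epsilon> * (1/2) ^ Suc n + real n * (\<integral>x. \<bar>\<eta> x\<bar> \<partial>M))"
    have "P (Suc n) ?p'"
      unfolding P_def
    proof (intro conjI ballI)
      fix H assume H: "H \<in> ess_ball M (real (Suc n))"
      have "(\<integral>x. (fst p x - \<eta> x) * H x \<partial>M) = (\<integral>x. fst p x * H x \<partial>M) - (\<integral>x. \<eta> x * H x \<partial>M)"
        using integrable_mult_ess_ball[OF \<xi> H] integrable_mult_ess_ball[OF \<eta>(1) H]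
        by (simp add: left_diff_distrib)
      then show "snd ?p' \<le> \<rho> H - (\<integral>x. fst ?p' x * H x \<partial>M)" using \<eta>(2)[OF H] by simp
    qed (use \<xi> \<eta>(1) in auto)
    moreover have "Q n p ?p'" by (simp add: Q_def)
    ultimately show ?thesis by blast
  qed
  obtain s where s: "\<And>n. P n (s n)" "\<And>n. Q n (s n) (s (Suc n))" "s 0 = (\<lambda>_. 0, \<rho> (\<lambda>_. 0))"
  proof -
    have "\<exists>f. \<forall>n. (P n (f n) \<and> (n = 0 \<longrightarrow> f n = (\<lambda>_. 0, \<rho> (\<lambda>_. 0)))) \<and> Q n (f n) (f (Suc n))"
    proof (rule dependent_nat_choice)
      show "\<exists>p. P 0 p \<and> ((0::nat) = 0 \<longrightarrow> p = (\<lambda>_. 0, \<rho> (\<lambda>_. 0)))" using base by blast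
      show "\<exists>p'. (P (Suc n) p' \<and> (Suc n = 0 \<longrightarrow> p' = (\<lambda>_. 0, \<rho> (\<lambda>_. 0)))) \<and> Q n p p'"
        if "P n p \<and> (n = 0 \<longrightarrow> p = (\<lambda>_. 0, \<rho> (\<lambda>_. 0)))" for p n
        using step[of n p] that by auto
    qed
    then show thesis using that by blast
  qed
  define \<eta> where "\<eta> n x = fst (s (Suc n)) x - fst (s n) x" for n x
  have s_int: "integrable M (fst (s n))" for n using s(1) by (simp add: P_def)
  then have \<eta>_int: "integrable M (\<eta> n)" for n unfolding \<eta>_def by simp
  have s_sum: "fst (s n) x = (\<Sum>k<n. \<eta> k x)" for n x
    by (induction n) (simp_all add: \<eta>_def s(3))
  have a_eq: "snd (s n) = \<rho> (\<lambda>_. 0) - \<epsilon> * (1 - (1/2) ^ n) + (\<Sum>k<n. real k * (\<integral>x. \<bar>\<eta> k x\<bar> \<partial>M))" for n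
  proof (induction n)
    case (Suc n)
    then show ?case using s(2)[of n] by (simp add: Q_def \<eta>_def algebra_simps)
  qed (simp add: s(3))
  have a_le: "snd (s n) \<le> \<rho> (\<lambda>_. 0)" for n
  proof -
    have "\<forall>H\<in>ess_ball M (real n). snd (s n) \<le> \<rho> H - (\<integral>x. fst (s n) x * H x \<partial>M)"
      using s(1)[of n] by (simp add: P_def)
    from bspec[OF this zero_in_ess_ball] show ?thesis by simp
  qed
  have "summable (\<lambda>k. real k * (\<integral>x. \<bar>\<eta> k x\<bar> \<partial>M))"
  proof (rule bounded_imp_summable[where B=\<epsilon>])
    fix n
    have "0 \<le> \<epsilon> * (1/2) ^ Suc n" using assms by simp
    then show "(\<Sum>k\<le>n. real k * (\<integral>x. \<bar>\<eta> k x\<bar> \<partial>M)) \<le> \<epsilon>"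
      using a_eq[of "Suc n"] a_le[of "Suc n"] by (simp add: lessThan_Suc_atMost algebra_simps)
  qed auto
  \<comment> \<open>The correction with index \<open>0\<close> carries the factor \<open>0\<close>
    and is not controlled by the weighted sum, hence the comparison from index \<open>1\<close>
    on.\<close>
  then have \<eta>_summable: "summable (\<lambda>k. \<integral>x. \<bar>\<eta> k x\<bar> \<partial>M)"
  proof (rule summable_comparison_test_ev[rotated])
    have "(\<integral>x. \<bar>\<eta> k x\<bar> \<partial>M) \<le> real k * (\<integral>x. \<bar>\<eta> k x\<bar> \<partial>M)" if "1 \<le> k" for k
      using mult_right_mono[of 1 "real k" "\<integral>x. \<bar>\<eta> k x\<bar> \<partial>M"] that by simp
    then show "\<forall>\<^sub>F k in sequentially. norm (\<integral>x. \<bar>\<eta> k x\<bar> \<partial>M) \<le> real k * (\<integral>x. \<bar>\<eta> k x\<bar> \<partial>M)"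
      by (intro eventually_mono[OF eventually_ge_at_top[of 1]]) simp
  qed
  have AE_\<eta>: "AE x in M. summable (\<lambda>k. \<bar>\<eta> k x\<bar>)"
    using \<eta>_int \<eta>_summable by (rule AE_summable_of_integral)
  define \<xi> where "\<xi> x = (\<Sum>k. \<eta> k x)" for x
  have \<xi>_int: "integrable M \<xi>"
    unfolding \<xi>_def using \<eta>_int \<eta>_summable AE_\<eta> by (intro integrable_suminf) auto
  show thesis
  proof (rule that[OF \<xi>_int])
    fix H r assume H: "H \<in> ess_ball M r"
    have \<eta>H_int: "integrable M (\<lambda>x. \<eta> k x * H x)" for k
      using \<eta>_int H by (rule integrable_mult_ess_ball)
    have "(\<lambda>k. \<integral>x. \<eta> k x * H x \<partial>M) sums (\<integral>x. (\<Sum>k. \<eta> k x * H x) \<partial>M)"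
    proof (rule sums_integral[OF \<eta>H_int])
      show "AE x in M. summable (\<lambda>k. norm (\<eta> k x * H x))"
        using AE_\<eta> by eventually_elim (simp add: abs_mult summable_mult2)
      show "summable (\<lambda>k. \<integral>x. norm (\<eta> k x * H x) \<partial>M)"
      proof (rule summable_comparison_test[OF _ summable_mult[OF \<eta>_summable, of r]], intro exI allI impI)
        fix k
        have "(\<integral>x. \<bar>\<eta> k x\<bar> * \<bar>H x\<bar> \<partial>M) \<le> r * (\<integral>x. \<bar>\<eta> k x\<bar> \<partial>M)"
        proof -
          have "(\<lambda>x. \<bar>H x\<bar>) \<in> ess_ball M r" using ess_ballD[OF H] by (intro ess_ballI) auto
          from integral_mult_ess_ball_le[OF integrable_abs[OF \<eta>_int[of k]] this] show ?thesis by simp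
        qed
        then show "norm (\<integral>x. norm (\<eta> k x * H x) \<partial>M) \<le> r * (\<integral>x. \<bar>\<eta> k x\<bar> \<partial>M)"
          by (simp add: abs_mult)
      qed
    qed
    moreover have "(\<integral>x. (\<Sum>k. \<eta> k x * H x) \<partial>M) = (\<integral>x. \<xi> x * H x \<partial>M)"
    proof (rule integral_cong_AE)
      have [measurable]: "\<And>k. \<eta> k \<in> borel_measurable M" "H \<in> borel_measurable M"
        using \<eta>_int ess_ballD(1)[OF H] by auto
      show "(\<lambda>x. \<Sum>k. \<eta> k x * H x) \<in> borel_measurable M" by measurable
      show "(\<lambda>x. \<xi> x * H x) \<in> borel_measurable M" unfolding \<xi>_def by measurable
      show "AE x in M. (\<Sum>k. \<eta> k x * H x) = \<xi> x * H x"
        using AE_\<eta> by eventually_elim (simp add: \<xi>_def suminf_mult2 summable_rabs_cancel)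
    qed
    moreover have "(\<Sum>k<n. \<integral>x. \<eta> k x * H x \<partial>M) = (\<integral>x. fst (s n) x * H x \<partial>M)" for n
      using \<eta>H_int by (simp add: s_sum sum_distrib_right)
    ultimately have lim: "(\<lambda>n. \<rho> (\<lambda>_. 0) - \<epsilon> + (\<integral>x. fst (s n) x * H x \<partial>M))
        \<longlonglongrightarrow> \<rho> (\<lambda>_. 0) - \<epsilon> + (\<integral>x. \<xi> x * H x \<partial>M)"
      by (intro tendsto_add tendsto_const) (simp add: sums_def)
    obtain N :: nat where N: "r \<le> real N" using real_arch_simple by blast
    have "\<rho> (\<lambda>_. 0) - \<epsilon> + (\<integral>x. fst (s n) x * H x \<partial>M) \<le> \<rho> H" if "N \<le> n" for n
    proof -
      have "H \<in> ess_ball M (real n)" using H N that by (intro ess_ball_mono[OF H]) linarith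
      then have "snd (s n) \<le> \<rho> H - (\<integral>x. fst (s n) x * H x \<partial>M)"
        using s(1)[of n] by (simp add: P_def)
      \<comment> \<open>The earnings are dropped here, and the expenses up to any \<open>n\<close>
        add up to less than \<open>\<epsilon>\<close>.\<close>
      moreover have "\<rho> (\<lambda>_. 0) - \<epsilon> \<le> snd (s n)"
      proof -
        have "0 \<le> (\<Sum>k<n. real k * (\<integral>x. \<bar>\<eta> k x\<bar> \<partial>M))" by (intro sum_nonneg) simp
        moreover have "0 \<le> \<epsilon> * (1/2) ^ n" using assms by simp
        ultimately show ?thesis unfolding a_eq[of n] by (simp only: right_diff_distrib mult_1_right)
      qed
      ultimately show ?thesis by linarith
    qed
    then have "\<rho> (\<lambda>_. 0) - \<epsilon> + (\<integral>x. \<xi> x * H x \<partial>M) \<le> \<rho> H"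
      by (intro LIMSEQ_le_const2[OF lim]) blast
    then show "\<rho> (\<lambda>_. 0) + (\<integral>x. \<xi> x * H x \<partial>M) - \<epsilon> \<le> \<rho> H" by linarith
  qed
qed

subsection \<open>Essential suprema\<close>

text \<open>A bounded strictly increasing copy of the extended line, so that a maximal random
  variable can be found by maximising an integral. The end points go to \<open>2\<close> and
  \<open>-2\<close>, strictly beyond the range of \<open>arctan\<close> because
  \<open>pi / 2 < 2\<close>.\<close>

definition squash :: "ereal \<Rightarrow> real" where
  "squash z = (if z = \<infinity> then 2 else if z = -\<infinity> then -2 else arctan (real_of_ereal z))"

lemma squash_measurable [measurable]: "squash \<in> borel_measurable borel"
  unfolding squash_def by measurable

lemma abs_arctan_less_2: "\<bar>arctan x\<bar> < 2"
  using arctan_bounded[of x] pi_less_4 by (auto simp: abs_less_iff)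

lemma abs_squash_le: "\<bar>squash z\<bar> \<le> 2"
  using abs_arctan_less_2[of "real_of_ereal z"] by (simp add: squash_def)

lemma squash_strict_mono: "squash y < squash z \<longleftrightarrow> y < z"
  using abs_arctan_less_2[of "real_of_ereal y"] abs_arctan_less_2[of "real_of_ereal z"]
  by (cases y; cases z) (auto simp: squash_def arctan_less_iff)

lemma squash_mono: "squash y \<le> squash z \<longleftrightarrow> y \<le> z"
  using squash_strict_mono[of z y] by (simp add: not_less[symmetric])

context prob_space
begin

lemma integrable_squash:
  assumes "f \<in> borel_measurable M"
  shows "integrable M (\<lambda>x. squash (f x))"
  by (rule integrable_const_bound[where B=2]) (use assms abs_squash_le in auto)

text \<open>Exhaustion: among suprema of countable subfamilies the integral of the squashed value is
  maximised. Merging a maximising sequence of subfamilies attains the maximum, and a member that was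
  not dominated would raise it further. The countable subfamily is used again in
  \<open>conditional_subgradient\<close>, where the supremum has to be integrated.\<close>

lemma ess_sup_countable:
  assumes meas: "\<Phi> \<subseteq> borel_measurable M" and "\<Phi> \<noteq> {}"
  obtains X :: "nat \<Rightarrow> 'a \<Rightarrow> ereal" where "range X \<subseteq> \<Phi>" "is_ess_sup M \<Phi> (\<lambda>x. SUP n. X n x)"
proof -
  define I where "I X = (\<integral>x. squash (SUP n. X n x) \<partial>M)" for X :: "nat \<Rightarrow> 'a \<Rightarrow> ereal"
  define s where "s = (SUP X\<in>{X. range X \<subseteq> \<Phi>}. I X)"
  have sup_meas: "(\<lambda>x. SUP n. X n x) \<in> borel_measurable M" if "range X \<subseteq> \<Phi>" for X :: "nat \<Rightarrow> 'a \<Rightarrow> ereal"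
    using that meas by (intro borel_measurable_SUP) auto
  have int: "integrable M (\<lambda>x. squash (SUP n. X n x))" if "range X \<subseteq> \<Phi>" for X :: "nat \<Rightarrow> 'a \<Rightarrow> ereal"
    using sup_meas[OF that] by (rule integrable_squash)
  have I_le_2: "I X \<le> 2" if "range X \<subseteq> \<Phi>" for X
  proof -
    have "I X \<le> (\<integral>x. 2 \<partial>M)"
      unfolding I_def using int[OF that] abs_squash_le by (intro integral_mono) (auto simp: abs_le_iff)
    then show ?thesis by (simp add: prob_space)
  qed
  have I_le: "I X \<le> s" if "range X \<subseteq> \<Phi>" for X
    unfolding s_def using that I_le_2 by (intro cSUP_upper bdd_aboveI2) auto
  have "\<exists>X. range X \<subseteq> \<Phi> \<and> s - 1 / real (Suc k) < I X" for k
  proof (rule ccontr)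
    obtain X0 where "X0 \<in> \<Phi>" using \<open>\<Phi> \<noteq> {}\<close> by blast
    then have ne: "{X. range X \<subseteq> \<Phi>} \<noteq> ({} :: (nat \<Rightarrow> 'a \<Rightarrow> ereal) set)"
      by (auto intro!: exI[of _ "\<lambda>_. X0"])
    assume "\<not> ?thesis"
    then have "s \<le> s - 1 / real (Suc k)"
      unfolding s_def[symmetric] by (subst s_def, intro cSUP_least[OF ne]) (auto simp: not_less)
    then show False by simp
  qed
  then obtain X where X: "\<And>k. range (X k) \<subseteq> \<Phi>" "\<And>k. s - 1 / real (Suc k) < I (X k)" by metis
  define Y where "Y m = X (fst (prod_decode m)) (snd (prod_decode m))" for m
  have Y: "range Y \<subseteq> \<Phi>" using X(1) by (auto simp: Y_def)
  have Y_ge: "X k n x \<le> (SUP m. Y m x)" for k n x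
    by (rule SUP_upper2[of "prod_encode (k, n)"]) (simp_all add: Y_def)
  have "I (X k) \<le> I Y" for k
    unfolding I_def using int X(1) Y Y_ge
    by (intro integral_mono) (auto simp: squash_mono intro!: SUP_least)
  then have "s - 1 / real (Suc k) < I Y" for k
    using X(2)[of k] by (meson less_le_trans)
  have "s \<le> I Y"
  proof (rule field_le_epsilon)
    fix e :: real assume "0 < e"
    then obtain k where "1 / real (Suc k) < e" using nat_approx_posE by blast
    then show "s \<le> I Y + e" using \<open>\<And>k. s - 1 / real (Suc k) < I Y\<close>[of k] by linarith
  qed
  have dom: "AE x in M. Z x \<le> (SUP m. Y m x)" if "Z \<in> \<Phi>" for Z
  proof -
    define W where "W = case_nat Z Y"
    have W: "range W \<subseteq> \<Phi>" using Y that by (auto simp: W_def image_subset_iff split: nat.splits)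
    have W_ge: "(SUP m. Y m x) \<le> (SUP m. W m x)" for x
      by (rule SUP_least, rule SUP_upper2[of "Suc _"]) (auto simp: W_def)
    have "(\<integral>x. squash (SUP m. W m x) - squash (SUP m. Y m x) \<partial>M) = I W - I Y"
      using int[OF W] int[OF Y] by (simp add: I_def)
    also have "\<dots> \<le> 0" using I_le[OF W] \<open>s \<le> I Y\<close> by simp
    finally have "(\<integral>x. squash (SUP m. W m x) - squash (SUP m. Y m x) \<partial>M) = 0"
      using W_ge by (intro antisym integral_nonneg) (auto simp: squash_mono)
    then have "AE x in M. squash (SUP m. W m x) - squash (SUP m. Y m x) = 0"
      using W_ge int[OF W] int[OF Y] by (subst (asm) integral_nonneg_eq_0_iff_AE) (auto simp: squash_mono)
    then show ?thesis
    proof eventually_elim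
      case (elim x)
      have "Z x \<le> (SUP m. W m x)" by (rule SUP_upper2[of 0]) (auto simp: W_def)
      also have "\<dots> \<le> (SUP m. Y m x)" using elim squash_mono[of "SUP m. W m x" "SUP m. Y m x"] by simp
      finally show ?case .
    qed
  qed
  have "is_ess_sup M \<Phi> (\<lambda>x. SUP m. Y m x)"
    unfolding is_ess_sup_def
  proof (intro conjI ballI impI)
    fix Z' assume "\<forall>X\<in>\<Phi>. AE x in M. X x \<le> Z' x"
    then have "AE x in M. \<forall>m. Y m x \<le> Z' x" using Y by (simp add: AE_all_countable image_subset_iff)
    then show "AE x in M. (SUP m. Y m x) \<le> Z' x" by eventually_elim (auto intro: SUP_least)
  qed (use dom sup_meas[OF Y] in auto)
  then show thesis using that Y by blast
qed

lemma is_ess_sup_ess_sup: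
  assumes "\<Phi> \<subseteq> borel_measurable M" "\<Phi> \<noteq> {}"
  shows "is_ess_sup M \<Phi> (ess_sup M \<Phi>)"
  unfolding ess_sup_def using ess_sup_countable[OF assms] by (metis someI_ex)

end

lemma is_ess_sup_upper: "is_ess_sup M \<Phi> Z \<Longrightarrow> X \<in> \<Phi> \<Longrightarrow> AE x in M. X x \<le> Z x"
  by (simp add: is_ess_sup_def)

lemma is_ess_sup_least:
  "is_ess_sup M \<Phi> Z \<Longrightarrow> Z' \<in> borel_measurable M \<Longrightarrow> (\<And>X. X \<in> \<Phi> \<Longrightarrow> AE x in M. X x \<le> Z' x) \<Longrightarrow>
    AE x in M. Z x \<le> Z' x"
  by (simp add: is_ess_sup_def)

lemma is_ess_sup_unique:
  assumes "is_ess_sup M \<Phi> Y" "is_ess_sup M \<Phi> Z"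
  shows "AE x in M. Y x = Z x"
proof -
  have "AE x in M. Y x \<le> Z x" "AE x in M. Z x \<le> Y x" using assms unfolding is_ess_sup_def by blast+
  then show ?thesis by eventually_elim (rule antisym)
qed

lemma ess_sup_eq:
  assumes "is_ess_sup M \<Phi> Z"
  shows "AE x in M. ess_sup M \<Phi> x = Z x"
  using assms unfolding ess_sup_def by (metis is_ess_sup_unique someI_ex)

text \<open>Directedness yields an almost surely increasing sequence within \<open>\<Psi>\<close>
  that dominates the given one, and monotone convergence applies. Starting it at the nonnegative
  \<open>b\<close> keeps it nonnegative, so that its integrals in \<open>ennreal\<close> are the
  real integrals bounded by \<open>c\<close>.\<close>

lemma nn_integral_SUP_directed:
  fixes X :: "nat \<Rightarrow> 'a \<Rightarrow> real"
  assumes X: "range X \<subseteq> \<Psi>" and int: "\<And>f. f \<in> \<Psi> \<Longrightarrow> integrable M f"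
    and le: "\<And>f. f \<in> \<Psi> \<Longrightarrow> (\<integral>x. f x \<partial>M) \<le> c"
    and dir: "\<And>f g. f \<in> \<Psi> \<Longrightarrow> g \<in> \<Psi> \<Longrightarrow> \<exists>h\<in>\<Psi>. AE x in M. max (f x) (g x) \<le> h x"
    and b: "b \<in> \<Psi>" "AE x in M. 0 \<le> b x"
  shows "(\<integral>\<^sup>+x. (SUP n. ennreal (X n x)) \<partial>M) \<le> ennreal c"
proof -
  have "\<exists>h. \<forall>n. (h n \<in> \<Psi> \<and> (n = 0 \<longrightarrow> h n = b)) \<and> (AE x in M. max (h n x) (X n x) \<le> h (Suc n) x)"
  proof (rule dependent_nat_choice)
    show "\<exists>h. (h \<in> \<Psi> \<and> (Suc n = 0 \<longrightarrow> h = b)) \<and> (AE x in M. max (f x) (X n x) \<le> h x)"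
      if "f \<in> \<Psi> \<and> (n = 0 \<longrightarrow> f = b)" for f n
      using dir[of f "X n"] that X by auto
  qed (use b in auto)
  then obtain h where h: "\<And>n. h n \<in> \<Psi>" "h 0 = b" "\<And>n. AE x in M. max (h n x) (X n x) \<le> h (Suc n) x"
    by blast
  have step: "AE x in M. \<forall>n. max (h n x) (X n x) \<le> h (Suc n) x" using h(3) by (simp add: AE_all_countable)
  have [measurable]: "\<And>n. h n \<in> borel_measurable M" using h(1) int by blast
  have nonneg: "AE x in M. 0 \<le> h n x" for n
    using step b(2)
  proof eventually_elim
    case (elim x)
    show ?case by (induction n) (use elim h(2) in \<open>auto intro: order_trans\<close>)
  qed
  have "(\<integral>\<^sup>+x. (SUP n. ennreal (X n x)) \<partial>M) \<le> (\<integral>\<^sup>+x. (SUP n. ennreal (h n x)) \<partial>M)"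
  proof (rule nn_integral_mono_AE)
    show "AE x in M. (SUP n. ennreal (X n x)) \<le> (SUP n. ennreal (h n x))"
      using step
    proof eventually_elim
      case (elim x)
      show ?case
      proof (rule SUP_least)
        fix n
        have "X n x \<le> h (Suc n) x" using elim by simp
        then show "ennreal (X n x) \<le> (SUP n. ennreal (h n x))" by (intro SUP_upper2[of "Suc n"]) (auto intro: ennreal_leI)
      qed
    qed
  qed
  also have "\<dots> = (SUP n. \<integral>\<^sup>+x. ennreal (h n x) \<partial>M)"
  proof (rule nn_integral_monotone_convergence_SUP_AE)
    show "AE x in M. ennreal (h n x) \<le> ennreal (h (Suc n) x)" for n
      using h(3)[of n] by eventually_elim (auto intro: ennreal_leI)
  qed measurable
  also have "\<dots> \<le> ennreal c"
  proof (rule SUP_least)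
    fix n
    have "(\<integral>\<^sup>+x. ennreal (h n x) \<partial>M) = ennreal (\<integral>x. h n x \<partial>M)"
      using h(1) int nonneg by (intro nn_integral_eq_integral) auto
    then show "(\<integral>\<^sup>+x. ennreal (h n x) \<partial>M) \<le> ennreal c" using le[OF h(1)] by (simp add: ennreal_leI)
  qed
  finally show ?thesis .
qed

subsection \<open>Conditional subgradients and the dual representation\<close>

lemma Linf_one_iff: "H \<in> Linf M M (\<lambda>_. 1) \<longleftrightarrow> (\<exists>r. H \<in> ess_ball M r)"
  by (auto simp: Linf_def ess_ball_def)

text \<open>Covers both modifications of an evaluation for which subgradients are constructed,
  \<open>max (\<pi> H x) (- 1)\<close> and \<open>indicator B x * \<pi> H x\<close>. An integrable
  minorant for each ball, \<open>lower_bound\<close>, is what Fatou's lemma needs and what the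
  axioms of an evaluation do not provide directly.\<close>

locale local_convex_map = prob_space M + sigma_finite_subalgebra M A for M A :: "'a measure" +
  fixes p :: "('a \<Rightarrow> real) \<Rightarrow> 'a \<Rightarrow> real"
  assumes measurable: "\<And>H r. H \<in> ess_ball M r \<Longrightarrow> p H \<in> borel_measurable A"
    and integrable: "\<And>H r. H \<in> ess_ball M r \<Longrightarrow> integrable M (p H)"
    and convex: "\<And>H1 H2 r t. H1 \<in> ess_ball M r \<Longrightarrow> H2 \<in> ess_ball M r \<Longrightarrow> 0 \<le> t \<Longrightarrow> t \<le> 1 \<Longrightarrow>
      AE x in M. p (\<lambda>y. t * H1 y + (1 - t) * H2 y) x \<le> t * p H1 x + (1 - t) * p H2 x"
    and local: "\<And>H1 H2 r B. H1 \<in> ess_ball M r \<Longrightarrow> H2 \<in> ess_ball M r \<Longrightarrow> B \<in> sets A \<Longrightarrow>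
      AE x in M. p (\<lambda>y. indicator B y * H1 y + indicator (space M - B) y * H2 y) x
        = indicator B x * p H1 x + indicator (space M - B) x * p H2 x"
    and fatou: "\<And>Hs H r. (\<And>k::nat. Hs k \<in> ess_ball M r) \<Longrightarrow> H \<in> ess_ball M r \<Longrightarrow>
      (AE x in M. (\<lambda>k. Hs k x) \<longlonglongrightarrow> H x) \<Longrightarrow>
      AE x in M. ereal (p H x) \<le> liminf (\<lambda>k. ereal (p (Hs k) x))"
    and lower_bound: "\<And>r. \<exists>l. integrable M l \<and> (\<forall>H\<in>ess_ball M r. AE x in M. l x \<le> p H x)"
begin

lemma integral_le_of_fatou:
  assumes Hs: "\<And>k::nat. Hs k \<in> ess_ball M r" and H: "H \<in> ess_ball M r"
    and lim: "AE x in M. (\<lambda>k. Hs k x) \<longlonglongrightarrow> H x" and c: "\<And>k. (\<integral>x. p (Hs k) x \<partial>M) \<le> c"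
  shows "(\<integral>x. p H x \<partial>M) \<le> c"
proof -
  obtain l where l: "integrable M l" "\<And>H. H \<in> ess_ball M r \<Longrightarrow> AE x in M. l x \<le> p H x"
    using lower_bound by blast
  have [measurable]: "l \<in> borel_measurable M" "p H \<in> borel_measurable M" "\<And>k. p (Hs k) \<in> borel_measurable M"
    using l(1) integrable[OF H] integrable[OF Hs] by auto
  have eq: "(\<integral>\<^sup>+x. ennreal (p K x - l x) \<partial>M) = ennreal ((\<integral>x. p K x \<partial>M) - (\<integral>x. l x \<partial>M))"
    if "K \<in> ess_ball M r" for K
    using that l integrable[OF that]
    by (subst nn_integral_eq_integral) (auto elim!: eventually_mono)
  have "ennreal ((\<integral>x. p H x \<partial>M) - (\<integral>x. l x \<partial>M)) = (\<integral>\<^sup>+x. ennreal (p H x - l x) \<partial>M)"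
    using eq[OF H] by simp
  also have "\<dots> \<le> (\<integral>\<^sup>+x. liminf (\<lambda>k. ennreal (p (Hs k) x - l x)) \<partial>M)"
  proof (rule nn_integral_mono_AE)
    show "AE x in M. ennreal (p H x - l x) \<le> liminf (\<lambda>k. ennreal (p (Hs k) x - l x))"
      using fatou[OF Hs H lim]
    proof eventually_elim
      case (elim x)
      show ?case
        unfolding le_Liminf_iff
      proof (intro allI impI)
        fix y assume "y < ennreal (p H x - l x)"
        then obtain z where z: "y = ennreal z" "0 \<le> z" "z < p H x - l x"
          by (cases y) (auto simp: ennreal_less_iff)
        then have "ereal (z + l x) < ereal (p H x)" by simp
        then have "\<forall>\<^sub>F k in sequentially. ereal (z + l x) < ereal (p (Hs k) x)"
          using elim unfolding le_Liminf_iff by blast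
        then show "\<forall>\<^sub>F k in sequentially. y < ennreal (p (Hs k) x - l x)"
          by eventually_elim (use z in \<open>auto simp: ennreal_less_iff\<close>)
      qed
    qed
  qed
  also have "\<dots> \<le> liminf (\<lambda>k. \<integral>\<^sup>+x. ennreal (p (Hs k) x - l x) \<partial>M)"
    by (rule nn_integral_liminf) measurable
  also have "\<dots> \<le> liminf (\<lambda>k::nat. ennreal (c - (\<integral>x. l x \<partial>M)))"
    using c eq[OF Hs] by (intro Liminf_mono always_eventually allI) (simp add: ennreal_leI)
  also have "\<dots> = ennreal (c - (\<integral>x. l x \<partial>M))" by (simp add: Liminf_const)
  finally have "ennreal ((\<integral>x. p H x \<partial>M) - (\<integral>x. l x \<partial>M)) \<le> ennreal (c - (\<integral>x. l x \<partial>M))" .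
  \<comment> \<open>\<open>ennreal\<close> sends negative numbers to \<open>0\<close>; its arguments
    can be compared once \<open>c - (\<integral>x. l x \<partial>M)\<close> is known to be
    nonnegative.\<close>
  moreover have "(\<integral>x. l x \<partial>M) \<le> (\<integral>x. p (Hs 0) x \<partial>M)"
    using l integrable[OF Hs] Hs by (intro integral_mono_AE) auto
  ultimately show ?thesis using c[of 0] by (simp add: ennreal_le_iff)
qed

text \<open>The \<open>gap\<close> of \<open>H\<close> is the amount by which the conditional
  subgradient inequality fails. An approximate subgradient of the mean of \<open>p\<close> shows
  that every gap has mean at most \<open>\<epsilon>\<close>. Pasting payoffs along sets of
  \<open>A\<close> makes the gaps directed upwards, so even their essential supremum, represented by
  \<open>Y\<close>, has mean at most \<open>\<epsilon>\<close>.\<close>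

theorem conditional_subgradient:
  assumes H0: "H0 \<in> ess_ball M r0" and "0 < \<epsilon>"
  obtains \<xi> Y where "integrable M \<xi>" "Y \<in> borel_measurable A" "(\<integral>\<^sup>+x. Y x \<partial>M) \<le> ennreal \<epsilon>"
    "\<And>H r. H \<in> ess_ball M r \<Longrightarrow>
      AE x in M. ennreal (real_cond_exp M A (\<lambda>y. \<xi> y * (H y - H0 y)) x - (p H x - p H0 x)) \<le> Y x"
proof -
  have plus: "(\<lambda>x. H0 x + K x) \<in> ess_ball M (r0 + r)" if "K \<in> ess_ball M r" for K r
  proof (rule ess_ballI)
    show "AE x in M. \<bar>H0 x + K x\<bar> \<le> r0 + r"
      using ess_ballD(2)[OF H0] ess_ballD(2)[OF that] by eventually_elim linarith
  qed (use ess_ballD(1)[OF H0] ess_ballD(1)[OF that] in measurable)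
  interpret shifted: convex_functional M "\<lambda>K. \<integral>x. p (\<lambda>y. H0 y + K y) x \<partial>M"
  proof unfold_locales
    fix H1 H2 r and t :: real
    assume H: "H1 \<in> ess_ball M r" "H2 \<in> ess_ball M r" and t: "0 \<le> t" "t \<le> 1"
    let ?K1 = "\<lambda>y. H0 y + H1 y" and ?K2 = "\<lambda>y. H0 y + H2 y"
    have eq: "(\<lambda>y. H0 y + (t * H1 y + (1 - t) * H2 y)) = (\<lambda>y. t * ?K1 y + (1 - t) * ?K2 y)"
      by (simp add: fun_eq_iff algebra_simps)
    have "(\<integral>x. p (\<lambda>y. t * ?K1 y + (1 - t) * ?K2 y) x \<partial>M) \<le> (\<integral>x. t * p ?K1 x + (1 - t) * p ?K2 x \<partial>M)"
    proof (rule integral_mono_AE)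
      show "integrable M (p (\<lambda>y. t * ?K1 y + (1 - t) * ?K2 y))"
        using ess_ball_convex[OF plus[OF H(1)] plus[OF H(2)] t] by (rule integrable)
    qed (use convex[OF plus[OF H(1)] plus[OF H(2)] t] integrable[OF plus] H in auto)
    also have "\<dots> = t * (\<integral>x. p ?K1 x \<partial>M) + (1 - t) * (\<integral>x. p ?K2 x \<partial>M)"
      using integrable[OF plus[OF H(1)]] integrable[OF plus[OF H(2)]] by simp
    finally show "(\<integral>x. p (\<lambda>y. H0 y + (t * H1 y + (1 - t) * H2 y)) x \<partial>M)
      \<le> t * (\<integral>x. p ?K1 x \<partial>M) + (1 - t) * (\<integral>x. p ?K2 x \<partial>M)" unfolding eq .
  next
    fix Hs :: "nat \<Rightarrow> 'a \<Rightarrow> real" and H r c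
    assume *: "\<And>k. Hs k \<in> ess_ball M r" "H \<in> ess_ball M r" "AE x in M. (\<lambda>k. Hs k x) \<longlonglongrightarrow> H x"
      "\<And>k. (\<integral>x. p (\<lambda>y. H0 y + Hs k y) x \<partial>M) \<le> c"
    show "(\<integral>x. p (\<lambda>y. H0 y + H y) x \<partial>M) \<le> c"
    proof (rule integral_le_of_fatou[OF plus[OF *(1)] plus[OF *(2)] _ *(4)])
      show "AE x in M. (\<lambda>k. H0 x + Hs k x) \<longlonglongrightarrow> H0 x + H x"
        using *(3) by eventually_elim (intro tendsto_intros)
    qed
  next
    fix r
    obtain l where l: "integrable M l"
      "\<And>H. H \<in> ess_ball M (r0 + r) \<Longrightarrow> AE x in M. l x \<le> p H x"
      using lower_bound by blast
    have "(\<integral>x. l x \<partial>M) \<le> (\<integral>x. p (\<lambda>y. H0 y + K y) x \<partial>M)" if "K \<in> ess_ball M r" for K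
      using l plus[OF that] integrable[OF plus[OF that]] by (intro integral_mono_AE) auto
    then show "\<exists>L. \<forall>K\<in>ess_ball M r. L \<le> (\<integral>x. p (\<lambda>y. H0 y + K y) x \<partial>M)" by blast
  qed
  obtain \<xi> where \<xi>: "integrable M \<xi>" and
    sub: "\<And>K r. K \<in> ess_ball M r \<Longrightarrow>
      (\<integral>x. p (\<lambda>y. H0 y + 0) x \<partial>M) + (\<integral>x. \<xi> x * K x \<partial>M) - \<epsilon> \<le> (\<integral>x. p (\<lambda>y. H0 y + K y) x \<partial>M)"
    using shifted.approximate_subgradient[OF \<open>0 < \<epsilon>\<close>] by blast
  have diff: "(\<lambda>x. H x - H0 x) \<in> ess_ball M (r + r0)" if "H \<in> ess_ball M r" for H r
  proof (rule ess_ballI)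
    show "AE x in M. \<bar>H x - H0 x\<bar> \<le> r + r0"
      using ess_ballD(2)[OF H0] ess_ballD(2)[OF that] by eventually_elim linarith
  qed (use ess_ballD(1)[OF H0] ess_ballD(1)[OF that] in measurable)
  define gap where "gap H x = real_cond_exp M A (\<lambda>y. \<xi> y * (H y - H0 y)) x - (p H x - p H0 x)" for H x
  define \<Psi> where "\<Psi> = {gap H |H. \<exists>r. H \<in> ess_ball M r}"
  have \<xi>_int: "integrable M (\<lambda>y. \<xi> y * (H y - H0 y))" if "H \<in> ess_ball M r" for H r
    using \<xi> diff[OF that] by (rule integrable_mult_ess_ball)
  have gap_int: "integrable M (gap H)" if "H \<in> ess_ball M r" for H r
    unfolding gap_def using real_cond_exp_int(1)[OF \<xi>_int[OF that]] integrable[OF that] integrable[OF H0]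
    by (intro Bochner_Integration.integrable_diff) auto
  have gap_meas: "gap H \<in> borel_measurable A" if "H \<in> ess_ball M r" for H r
    unfolding gap_def using measurable[OF that] measurable[OF H0] by measurable
  have gap_le: "(\<integral>x. gap H x \<partial>M) \<le> \<epsilon>" if "H \<in> ess_ball M r" for H r
  proof -
    have "(\<integral>x. gap H x \<partial>M) = (\<integral>x. \<xi> x * (H x - H0 x) \<partial>M) - ((\<integral>x. p H x \<partial>M) - (\<integral>x. p H0 x \<partial>M))"
      unfolding gap_def using real_cond_exp_int[OF \<xi>_int[OF that]] integrable[OF that] integrable[OF H0] by simp
    also have "\<dots> \<le> \<epsilon>" using sub[OF diff[OF that]] by simp
    finally show ?thesis .
  qed
  have dir: "\<exists>h\<in>\<Psi>. AE x in M. max (f x) (g x) \<le> h x" if "f \<in> \<Psi>" "g \<in> \<Psi>" for f g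
  proof -
    obtain H1 r1 H2 r2 where H1: "f = gap H1" "H1 \<in> ess_ball M r1" and H2: "g = gap H2" "H2 \<in> ess_ball M r2"
      using \<open>f \<in> \<Psi>\<close> \<open>g \<in> \<Psi>\<close> unfolding \<Psi>_def by blast
    define r where "r = max r1 r2"
    have H1r: "H1 \<in> ess_ball M r" and H2r: "H2 \<in> ess_ball M r"
      using H1(2) H2(2) by (auto simp: r_def intro: ess_ball_mono)
    \<comment> \<open>On \<open>B\<close> the first payoff has the larger gap. Since both gaps are
      \<open>A\<close>-measurable, \<open>local\<close> permits switching payoffs along
      \<open>B\<close>, and the pasted payoff realises the maximum.\<close>
    define B where "B = {x \<in> space A. gap H2 x \<le> gap H1 x}"
    have B[measurable]: "B \<in> sets A"
      unfolding B_def using gap_meas[OF H1r] gap_meas[OF H2r] by measurable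
    have space: "space A = space M" using subalg by (simp add: subalgebra_def)
    have BM: "B \<in> sets M" using B subalg by (auto simp: subalgebra_def)
    have BcA[measurable]: "space M - B \<in> sets A" using sets.compl_sets[OF B] by (simp add: space)
    have BcM: "space M - B \<in> sets M" using BM by auto
    define H where "H y = indicator B y * H1 y + indicator (space M - B) y * H2 y" for y
    have H: "H \<in> ess_ball M r"
    proof (rule ess_ballI)
      show "H \<in> borel_measurable M"
        unfolding H_def using ess_ballD(1)[OF H1r] ess_ballD(1)[OF H2r] BM by measurable
      show "AE x in M. \<bar>H x\<bar> \<le> r"
        using ess_ballD(2)[OF H1r] ess_ballD(2)[OF H2r] AE_space
        by eventually_elim (auto simp: H_def indicator_def)
    qed
    let ?E = "\<lambda>H. real_cond_exp M A (\<lambda>y. \<xi> y * (H y - H0 y))"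
    have ind_int: "integrable M (\<lambda>y. indicator C y * (\<xi> y * (K y - H0 y)))"
      if "C \<in> sets M" "K \<in> ess_ball M r" for C and K :: "'a \<Rightarrow> real"
      using integrable_mult_indicator[OF that(1) \<xi>_int[OF that(2)]] by simp
    have "AE x in M. ?E H x = real_cond_exp M A (\<lambda>y. indicator B y * (\<xi> y * (H1 y - H0 y))
        + indicator (space M - B) y * (\<xi> y * (H2 y - H0 y))) x"
    proof (rule real_cond_exp_cong)
      show "AE x in M. \<xi> x * (H x - H0 x) = indicator B x * (\<xi> x * (H1 x - H0 x))
          + indicator (space M - B) x * (\<xi> x * (H2 x - H0 x))"
        using AE_space by eventually_elim (auto simp: H_def indicator_def)
    qed (use \<xi>_int[OF H] ind_int H1r H2r BM in auto)
    moreover have "AE x in M. real_cond_exp M A (\<lambda>y. indicator B y * (\<xi> y * (H1 y - H0 y))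
        + indicator (space M - B) y * (\<xi> y * (H2 y - H0 y))) x
      = real_cond_exp M A (\<lambda>y. indicator B y * (\<xi> y * (H1 y - H0 y))) x
        + real_cond_exp M A (\<lambda>y. indicator (space M - B) y * (\<xi> y * (H2 y - H0 y))) x"
      using ind_int H1r H2r BM by (intro real_cond_exp_add) auto
    moreover have "AE x in M. real_cond_exp M A (\<lambda>y. indicator B y * (\<xi> y * (H1 y - H0 y))) x = indicator B x * ?E H1 x"
      using ind_int[OF BM H1r] \<xi>_int[OF H1r] by (intro real_cond_exp_mult) auto
    moreover have "AE x in M. real_cond_exp M A (\<lambda>y. indicator (space M - B) y * (\<xi> y * (H2 y - H0 y))) x
        = indicator (space M - B) x * ?E H2 x"
      using ind_int[OF BcM H2r] \<xi>_int[OF H2r] by (intro real_cond_exp_mult) auto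
    moreover have "AE x in M. p H x = indicator B x * p H1 x + indicator (space M - B) x * p H2 x"
      using local[OF H1r H2r B] unfolding H_def .
    ultimately have "AE x in M. max (gap H1 x) (gap H2 x) \<le> gap H x"
      using AE_space
    proof eventually_elim
      case (elim x)
      then show ?case
        by (cases "x \<in> B") (auto simp: gap_def B_def space)
    qed
    then show ?thesis using H H1(1) H2(1) unfolding \<Psi>_def by blast
  qed
  let ?\<Phi> = "(\<lambda>f x. ereal (f x)) ` \<Psi>"
  have "\<Psi> \<noteq> {}" using H0 by (auto simp: \<Psi>_def)
  then have "?\<Phi> \<noteq> {}" by simp
  have "?\<Phi> \<subseteq> borel_measurable M"
    using gap_int by (auto simp: \<Psi>_def intro!: borel_measurable_ereal borel_measurable_integrable)
  then obtain Z :: "nat \<Rightarrow> 'a \<Rightarrow> ereal" where Z: "range Z \<subseteq> ?\<Phi>" "is_ess_sup M ?\<Phi> (\<lambda>x. SUP n. Z n x)"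
    using ess_sup_countable[of ?\<Phi>] \<open>?\<Phi> \<noteq> {}\<close> by blast
  have "\<exists>f. f \<in> \<Psi> \<and> Z n = (\<lambda>x. ereal (f x))" for n using Z(1) by blast
  then obtain X where X: "\<And>n. X n \<in> \<Psi>" "\<And>n. Z n = (\<lambda>x. ereal (X n x))" by metis
  define Y where "Y x = (SUP n. ennreal (X n x))" for x
  show thesis
  proof (rule that[OF \<xi>, of Y])
    have [measurable]: "X n \<in> borel_measurable A" for n using X(1)[of n] gap_meas by (auto simp: \<Psi>_def)
    show "Y \<in> borel_measurable A" unfolding Y_def by measurable
    show "(\<integral>\<^sup>+x. Y x \<partial>M) \<le> ennreal \<epsilon>"
      unfolding Y_def
    proof (rule nn_integral_SUP_directed[where b="gap H0" and \<Psi>=\<Psi>])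
      \<comment> \<open>\<open>gap H0\<close> vanishes almost surely and is the nonnegative member
        with which the increasing sequence starts.\<close>
      have "AE x in M. real_cond_exp M A (\<lambda>y. 0) x = 0" by (rule real_cond_exp_F_meas) auto
      then show "AE x in M. 0 \<le> gap H0 x" by eventually_elim (simp add: gap_def)
    qed (use X(1) gap_int gap_le dir H0 in \<open>auto simp: \<Psi>_def\<close>)
    fix H r assume "H \<in> ess_ball M r"
    then have "(\<lambda>x. ereal (gap H x)) \<in> ?\<Phi>" by (auto simp: \<Psi>_def)
    with Z(2) have "AE x in M. ereal (gap H x) \<le> (SUP n. Z n x)" by (rule is_ess_sup_upper)
    then show "AE x in M. ennreal (real_cond_exp M A (\<lambda>y. \<xi> y * (H y - H0 y)) x - (p H x - p H0 x)) \<le> Y x"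
      unfolding gap_def[symmetric]
    proof eventually_elim
      case (elim x)
      show ?case
        unfolding Y_def le_SUP_iff
      proof (intro allI impI)
        fix y assume "y < ennreal (gap H x)"
        then obtain z where z: "y = ennreal z" "0 \<le> z" "z < gap H x"
          by (cases y) (auto simp: ennreal_less_iff)
        then have "ereal z < (SUP n. Z n x)" using elim by (meson less_ereal.simps(1) less_le_trans)
        then obtain n where "ereal z < Z n x" by (auto simp: less_SUP_iff)
        then show "\<exists>n\<in>UNIV. y < ennreal (X n x)" using z X(2)[of n] by (auto simp: ennreal_less_iff)
      qed
    qed
  qed
qed

end

section \<open>Minorants and duality for an evaluation of cash payoffs\<close>

lemma conditional_evaluationD:
  assumes "conditional_evaluation M A N \<pi>"
  shows conditional_evaluation_cong: "\<And>H H'. H \<in> Linf M M N \<Longrightarrow> H' \<in> Linf M M N \<Longrightarrow>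
        (AE x in M. H x = H' x) \<Longrightarrow> AE x in M. \<pi> H x = \<pi> H' x"
    and conditional_evaluation_Linf: "\<And>H. H \<in> Linf M M N \<Longrightarrow> \<pi> H \<in> Linf M A N"
    and conditional_evaluation_zero: "AE x in M. \<pi> (\<lambda>_. 0) x = 0"
    and conditional_evaluation_translate: "\<And>H m. H \<in> Linf M M N \<Longrightarrow> m \<in> Linf M A N \<Longrightarrow>
        AE x in M. \<pi> (\<lambda>y. H y + m y) x = \<pi> H x + m x"
    and conditional_evaluation_convex: "\<And>H1 H2 w. H1 \<in> Linf M M N \<Longrightarrow> H2 \<in> Linf M M N \<Longrightarrow>
        w \<in> borel_measurable A \<Longrightarrow> (AE x in M. 0 \<le> w x \<and> w x \<le> 1) \<Longrightarrow>
        AE x in M. \<pi> (\<lambda>y. w y * H1 y + (1 - w y) * H2 y) x \<le> w x * \<pi> H1 x + (1 - w x) * \<pi> H2 x"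
    and conditional_evaluation_local: "\<And>H1 H2 B. H1 \<in> Linf M M N \<Longrightarrow> H2 \<in> Linf M M N \<Longrightarrow>
        B \<in> sets A \<Longrightarrow> AE x in M. \<pi> (\<lambda>y. indicator B y * H1 y + indicator (space M - B) y * H2 y) x
                     = indicator B x * \<pi> H1 x + indicator (space M - B) x * \<pi> H2 x"
    and conditional_evaluation_fatou: "\<And>H Hs C. H \<in> Linf M M N \<Longrightarrow> (\<And>k. Hs k \<in> Linf M M N) \<Longrightarrow>
        (\<And>k. AE x in M. \<bar>N x * Hs k x\<bar> \<le> C) \<Longrightarrow> (AE x in M. (\<lambda>k. Hs k x) \<longlonglongrightarrow> H x) \<Longrightarrow>
        AE x in M. ereal (\<pi> H x) \<le> liminf (\<lambda>k. ereal (\<pi> (Hs k) x))"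
  using assms unfolding conditional_evaluation_def by (simp_all, blast+)

lemma ess_ball_in_Linf: "H \<in> ess_ball M r \<Longrightarrow> H \<in> Linf M M (\<lambda>_. 1)"
  using Linf_one_iff by blast

lemma ereal_max_le_Liminf:
  assumes "ereal a \<le> liminf (\<lambda>k. ereal (b k))"
  shows "ereal (max a c) \<le> liminf (\<lambda>k. ereal (max (b k) c))"
  unfolding le_Liminf_iff
proof (intro allI impI)
  fix y assume y: "y < ereal (max a c)"
  show "\<forall>\<^sub>F k in sequentially. y < ereal (max (b k) c)"
  proof (cases "y < ereal c")
    case True
    then show ?thesis
      by (intro always_eventually allI) (metis ereal_less_eq(3) less_le_trans max.cobounded2)
  next
    case False
    then have "y < ereal a" using y by (auto simp: max_def split: if_splits)
    then have "\<forall>\<^sub>F k in sequentially. y < ereal (b k)" using assms unfolding le_Liminf_iff by blast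
    then show ?thesis
      by eventually_elim (metis ereal_less_eq(3) less_le_trans max.cobounded1)
  qed
qed

context
  fixes M A :: "'a measure" and \<pi>
  assumes prob: "prob_space M" and sub: "subalgebra M A"
    and eval: "conditional_evaluation M A (\<lambda>_. 1) \<pi>"
begin

interpretation prob_space M by (rule prob)
interpretation finite_measure_subalgebra M A using sub by unfold_locales

lemma evaluation_bounded:
  assumes "H \<in> ess_ball M r"
  shows "\<pi> H \<in> borel_measurable A" "\<exists>C. AE x in M. \<bar>\<pi> H x\<bar> \<le> C"
  using conditional_evaluation_Linf[OF eval ess_ball_in_Linf[OF assms]] by (auto simp: Linf_def)

lemma evaluation_integrable:
  assumes "H \<in> ess_ball M r"
  shows "integrable M (\<pi> H)"
proof -
  obtain C where "AE x in M. \<bar>\<pi> H x\<bar> \<le> C" using evaluation_bounded(2)[OF assms] by blast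
  then show ?thesis
    using measurable_from_subalg[OF sub evaluation_bounded(1)[OF assms]]
    by (intro integrable_const_bound[where B=C]) auto
qed

lemma evaluation_fatou:
  assumes "\<And>k::nat. Hs k \<in> ess_ball M r" "H \<in> ess_ball M r" "AE x in M. (\<lambda>k. Hs k x) \<longlonglongrightarrow> H x"
  shows "AE x in M. ereal (\<pi> H x) \<le> liminf (\<lambda>k. ereal (\<pi> (Hs k) x))"
  by (rule conditional_evaluation_fatou[OF eval, where C=r])
     (use assms ess_ballD(2)[OF assms(1)] in \<open>auto intro: ess_ball_in_Linf\<close>)

text \<open>Truncation from below supplies the integrable minorant and preserves convexity, locality
  and the Fatou property. The level \<open>-1\<close> lies strictly below the value \<open>0\<close>
  of the zero payoff, which leaves room for the estimates in
  \<open>evaluation_lower_bound\<close>.\<close>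

lemma evaluation_truncated: "local_convex_map M A (\<lambda>H x. max (\<pi> H x) (- 1))"
proof unfold_locales
  fix H :: "'a \<Rightarrow> real" and r assume H: "H \<in> ess_ball M r"
  show "(\<lambda>x. max (\<pi> H x) (- 1)) \<in> borel_measurable A" using evaluation_bounded(1)[OF H] by measurable
  show "integrable M (\<lambda>x. max (\<pi> H x) (- 1))" using evaluation_integrable[OF H] by auto
next
  fix H1 H2 :: "'a \<Rightarrow> real" and r and t :: real
  assume H: "H1 \<in> ess_ball M r" "H2 \<in> ess_ball M r" and t: "0 \<le> t" "t \<le> 1"
  have "AE x in M. \<pi> (\<lambda>y. t * H1 y + (1 - t) * H2 y) x \<le> t * \<pi> H1 x + (1 - t) * \<pi> H2 x"
    using conditional_evaluation_convex[OF eval H[THEN ess_ball_in_Linf], of "\<lambda>_. t"] t by simp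
  then show "AE x in M. max (\<pi> (\<lambda>y. t * H1 y + (1 - t) * H2 y) x) (- 1)
      \<le> t * max (\<pi> H1 x) (- 1) + (1 - t) * max (\<pi> H2 x) (- 1)"
  proof eventually_elim
    case (elim x)
    have "t * \<pi> H1 x + (1 - t) * \<pi> H2 x \<le> t * max (\<pi> H1 x) (- 1) + (1 - t) * max (\<pi> H2 x) (- 1)"
      using t by (intro add_mono mult_left_mono) auto
    moreover have "t * (- 1) + (1 - t) * (- 1) \<le> t * max (\<pi> H1 x) (- 1) + (1 - t) * max (\<pi> H2 x) (- 1)"
      using t by (intro add_mono mult_left_mono) auto
    ultimately show ?case using elim by simp
  qed
next
  fix H1 H2 :: "'a \<Rightarrow> real" and r B
  assume H: "H1 \<in> ess_ball M r" "H2 \<in> ess_ball M r" and B: "B \<in> sets A"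
  show "AE x in M. max (\<pi> (\<lambda>y. indicator B y * H1 y + indicator (space M - B) y * H2 y) x) (- 1)
      = indicator B x * max (\<pi> H1 x) (- 1) + indicator (space M - B) x * max (\<pi> H2 x) (- 1)"
    using conditional_evaluation_local[OF eval H[THEN ess_ball_in_Linf] B] AE_space
    by eventually_elim (auto simp: indicator_def)
next
  fix Hs :: "nat \<Rightarrow> 'a \<Rightarrow> real" and H r
  assume *: "\<And>k. Hs k \<in> ess_ball M r" "H \<in> ess_ball M r" "AE x in M. (\<lambda>k. Hs k x) \<longlonglongrightarrow> H x"
  show "AE x in M. ereal (max (\<pi> H x) (- 1)) \<le> liminf (\<lambda>k. ereal (max (\<pi> (Hs k) x) (- 1)))"
    using evaluation_fatou[OF *] by eventually_elim (rule ereal_max_le_Liminf)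
next
  show "\<exists>l. integrable M l \<and> (\<forall>H\<in>ess_ball M r. AE x in M. l x \<le> max (\<pi> H x) (- 1))" for r
    by (intro exI[of _ "\<lambda>_. - 1"]) auto
qed

text \<open>
  The truncated evaluation has an approximate subgradient at \<open>0\<close>; convexity with an \<open>A\<close>-measurable weight
  \<open>w\<close> so small that \<open>w H\<close> is out of reach of the truncation carries the bound over to \<open>\<pi> H\<close>.
\<close>

lemma evaluation_lower_bound:
  assumes "0 < \<epsilon>"
  obtains B where "B \<in> sets A" "measure M (space M - B) \<le> \<epsilon>"
    "\<And>r. \<exists>l. integrable M l \<and> (\<forall>H\<in>ess_ball M r. AE x in M. x \<in> B \<longrightarrow> l x \<le> \<pi> H x)"
proof -
  interpret trunc: local_convex_map M A "\<lambda>H x. max (\<pi> H x) (- 1)" by (rule evaluation_truncated)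
  obtain \<xi> Y where \<xi>: "integrable M \<xi>" and Y[measurable]: "Y \<in> borel_measurable A"
    and Y_le: "(\<integral>\<^sup>+x. Y x \<partial>M) \<le> ennreal (\<epsilon> / 2)"
    and dom: "\<And>H r. H \<in> ess_ball M r \<Longrightarrow> AE x in M.
      ennreal (real_cond_exp M A (\<lambda>y. \<xi> y * (H y - 0)) x - (max (\<pi> H x) (- 1) - max (\<pi> (\<lambda>_. 0) x) (- 1))) \<le> Y x"
    using trunc.conditional_subgradient[OF zero_in_ess_ball[of 0], of "\<epsilon> / 2"] assms by auto
  have YM[measurable]: "Y \<in> borel_measurable M" using sub Y by (rule measurable_from_subalg)
  \<comment> \<open>Half of the room between \<open>0\<close> and \<open>-1\<close> is granted to
    the error \<open>Y\<close>, the other half to the scaled payoff below. Markov's inequality at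
    \<open>1 / 2\<close> doubles the mean \<open>\<epsilon> / 2\<close>.\<close>
  define B where "B = {x \<in> space A. Y x < ennreal (1 / 2)}"
  have B: "B \<in> sets A" unfolding B_def by measurable
  have space: "space A = space M" using sub by (simp add: subalgebra_def)
  show thesis
  proof (rule that[OF B])
    have "emeasure M (space M - B) = emeasure M ({x \<in> space M. 1 \<le> 2 * Y x})"
    proof (rule arg_cong[where f="emeasure M"])
      have "Y x < ennreal (1 / 2) \<longleftrightarrow> \<not> 1 \<le> 2 * Y x" for x
      proof (cases "Y x")
        case (real z)
        then have eq: "2 * Y x = ennreal (2 * z)" by (simp add: ennreal_mult)
        have "1 \<le> 2 * Y x \<longleftrightarrow> 1 \<le> 2 * z"
          unfolding eq ennreal_1[symmetric] using real(1) by (subst ennreal_le_iff) auto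
        moreover have "Y x < ennreal (1 / 2) \<longleftrightarrow> z < 1 / 2"
          unfolding real(2) using real(1) by (rule ennreal_less_iff)
        ultimately show ?thesis by linarith
      qed (simp add: ennreal_mult_top)
      then show "space M - B = {x \<in> space M. 1 \<le> 2 * Y x}" by (auto simp: B_def space)
    qed
    also have "\<dots> \<le> 2 * (\<integral>\<^sup>+x. Y x * indicator (space M) x \<partial>M)"
      using nn_integral_Markov_inequality[of Y "space M" M 2] by simp
    also have "(\<integral>\<^sup>+x. Y x * indicator (space M) x \<partial>M) = (\<integral>\<^sup>+x. Y x \<partial>M)"
      by (intro nn_integral_cong) auto
    also have "2 * (\<integral>\<^sup>+x. Y x \<partial>M) \<le> 2 * ennreal (\<epsilon> / 2)" using Y_le by (intro mult_left_mono) auto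
    also have "\<dots> = ennreal \<epsilon>"
      using assms ennreal_mult[of 2 "\<epsilon> / 2"] by simp
    finally show "measure M (space M - B) \<le> \<epsilon>"
      using assms by (simp add: measure_def enn2real_leI)
  next
    fix r :: real
    define R where "R = \<bar>r\<bar>"
    have R: "0 \<le> R" by (simp add: R_def)
    define e where "e = real_cond_exp M A (\<lambda>x. \<bar>\<xi> x\<bar>)"
    have e_meas[measurable]: "e \<in> borel_measurable A" by (simp add: e_def)
    have e_int: "integrable M e" unfolding e_def using \<xi> by (intro real_cond_exp_int) auto
    have e_nonneg: "AE x in M. 0 \<le> e x" unfolding e_def by (rule real_cond_exp_pos) (use \<xi> in auto)
    \<comment> \<open>The weight satisfies \<open>w x * (R * \<bar>e x\<bar> + 1) = 1 / 2\<close>.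
      Hence the conditional expectation of \<open>\<xi>\<close> times the scaled payoff is at least
      \<open>w x - 1 / 2\<close>, and on \<open>B\<close> the truncated value of that payoff exceeds
      \<open>w x - 1\<close>: the truncation is inactive.\<close>
    define w where "w x = 1 / (2 * (R * \<bar>e x\<bar> + 1))" for x
    have w_meas[measurable]: "w \<in> borel_measurable A" unfolding w_def by measurable
    have w_measM[measurable]: "w \<in> borel_measurable M" using sub w_meas by (rule measurable_from_subalg)
    have den: "0 < R * \<bar>e x\<bar> + 1" for x using R by (simp add: add_nonneg_pos)
    have w: "0 < w x" "w x \<le> 1" for x
    proof -
      show "0 < w x" using den[of x] by (simp add: w_def)
      have "1 \<le> 2 * (R * \<bar>e x\<bar> + 1)" using R by simp
      then show "w x \<le> 1" using den[of x] by (simp add: w_def)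
    qed
    have wR: "w x * (R * \<bar>e x\<bar>) = 1 / 2 - w x" for x
      using den[of x] by (simp add: w_def field_simps)
    \<comment> \<open>Arises from dividing
      \<open>- (w x * (R * e x)) - 1 / 2 < w x * \<pi> H x\<close> by \<open>w x\<close>, with
      \<open>1 / 2\<close> written as \<open>w x * (R * e x + 1)\<close>.\<close>
    define l where "l x = - (2 * R * e x + 1)" for x
    have "AE x in M. x \<in> B \<longrightarrow> l x \<le> \<pi> H x" if "H \<in> ess_ball M r" for H
    proof -
      have H: "H \<in> ess_ball M R" using that by (rule ess_ball_mono) (simp add: R_def)
      have [measurable]: "H \<in> borel_measurable M" using ess_ballD(1)[OF H] .
      define K where "K y = w y * H y + (1 - w y) * 0" for y
      have K: "K \<in> ess_ball M R"
      proof (rule ess_ballI)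
        show "AE x in M. \<bar>K x\<bar> \<le> R"
          using ess_ballD(2)[OF H]
        proof eventually_elim
          case (elim x)
          have "\<bar>K x\<bar> = w x * \<bar>H x\<bar>" using w[of x] by (simp add: K_def abs_mult)
          also have "\<dots> \<le> 1 * R" using elim w[of x] by (intro mult_mono) auto
          finally show ?case by simp
        qed
      qed (unfold K_def, measurable)
      have conv: "AE x in M. \<pi> K x \<le> w x * \<pi> H x + (1 - w x) * \<pi> (\<lambda>_. 0) x"
        unfolding K_def using w
        by (intro conditional_evaluation_convex[OF eval] ess_ball_in_Linf[OF H]
              ess_ball_in_Linf[OF zero_in_ess_ball[of 0]])
           (auto intro: less_imp_le)
      have bound_int: "integrable M (\<lambda>x. (- R * w x) * \<bar>\<xi> x\<bar>)"
      proof (rule Bochner_Integration.integrable_bound[OF integrable_mult_right[OF integrable_abs[OF \<xi>], of R]])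
        show "AE x in M. norm ((- R * w x) * \<bar>\<xi> x\<bar>) \<le> norm (R * \<bar>\<xi> x\<bar>)"
        proof (rule AE_I2)
          fix x
          have "\<bar>\<xi> x\<bar> * (R * w x) \<le> \<bar>\<xi> x\<bar> * R" using w[of x] R by (intro mult_left_mono mult_left_le) auto
          then show "norm ((- R * w x) * \<bar>\<xi> x\<bar>) \<le> norm (R * \<bar>\<xi> x\<bar>)"
            using w(1)[of x] R by (simp add: abs_mult mult.commute)
        qed
      qed (use borel_measurable_integrable[OF \<xi>] in measurable)
      have "AE x in M. real_cond_exp M A (\<lambda>x. (- R * w x) * \<bar>\<xi> x\<bar>) x \<le> real_cond_exp M A (\<lambda>y. \<xi> y * (K y - 0)) x"
      proof (rule real_cond_exp_mono)
        show "AE x in M. (- R * w x) * \<bar>\<xi> x\<bar> \<le> \<xi> x * (K x - 0)"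
          using ess_ballD(2)[OF H]
        proof eventually_elim
          case (elim x)
          have "\<bar>\<xi> x * K x\<bar> = w x * (\<bar>\<xi> x\<bar> * \<bar>H x\<bar>)" using w[of x] by (simp add: K_def abs_mult)
          also have "\<dots> \<le> w x * (\<bar>\<xi> x\<bar> * R)" using elim w[of x] by (intro mult_left_mono) auto
          finally show ?case by (simp add: mult_ac abs_le_iff)
        qed
        show "integrable M (\<lambda>x. \<xi> x * (K x - 0))" using integrable_mult_ess_ball[OF \<xi> K] by simp
      qed (rule bound_int)
      moreover have "AE x in M. real_cond_exp M A (\<lambda>x. (- R * w x) * \<bar>\<xi> x\<bar>) x = (- R * w x) * e x"
        unfolding e_def using bound_int borel_measurable_integrable[OF \<xi>] by (intro real_cond_exp_mult) auto
      ultimately show ?thesis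
        using dom[OF K] conv conditional_evaluation_zero[OF eval] e_nonneg
      proof eventually_elim
        case (elim x)
        show ?case
        proof
          assume "x \<in> B"
          let ?E = "real_cond_exp M A (\<lambda>y. \<xi> y * (K y - 0)) x"
          have "max (\<pi> (\<lambda>_. 0) x) (- 1) = 0" using elim(5) by simp
          then have "ennreal (?E - max (\<pi> K x) (- 1)) \<le> Y x" using elim(3) by simp
          also have "\<dots> < ennreal (1 / 2)" using \<open>x \<in> B\<close> unfolding B_def by blast
          finally have "ennreal (?E - max (\<pi> K x) (- 1)) < ennreal (1 / 2)" .
          then have "?E - max (\<pi> K x) (- 1) < 1 / 2"
            by (metis ennreal_leI leD leI)
          moreover have "- (w x * (R * e x)) \<le> ?E" using elim by (simp add: mult_ac)
          moreover have "w x * (R * e x) = 1 / 2 - w x" using wR[of x] elim by simp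
          ultimately have "- (w x * (R * e x)) - 1 / 2 < w x * \<pi> H x"
            using w[of x] elim by (auto simp: max_def split: if_splits)
          then have "- (w x * (R * e x)) - (w x * (R * e x) + w x) < w x * \<pi> H x"
            using \<open>w x * (R * e x) = 1 / 2 - w x\<close> by simp
          then have "w x * l x < w x * \<pi> H x" by (simp add: l_def algebra_simps)
          then show "l x \<le> \<pi> H x" using w(1)[of x] by simp
        qed
      qed
    qed
    moreover have "integrable M l" unfolding l_def using e_int by auto
    ultimately show "\<exists>l. integrable M l \<and> (\<forall>H\<in>ess_ball M r. AE x in M. x \<in> B \<longrightarrow> l x \<le> \<pi> H x)" by blast
  qed
qed

text \<open>Setting the evaluation to \<open>0\<close> off \<open>B\<close> turns minorants that
  hold on \<open>B\<close> into global ones, while on \<open>B\<close> its values are those of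
  \<open>\<pi>\<close>. As \<open>B\<close> belongs to \<open>A\<close>, measurability with respect
  to \<open>A\<close> survives.\<close>

lemma evaluation_restricted:
  assumes B: "B \<in> sets A"
    and low: "\<And>r. \<exists>l. integrable M l \<and> (\<forall>H\<in>ess_ball M r. AE x in M. x \<in> B \<longrightarrow> l x \<le> \<pi> H x)"
  shows "local_convex_map M A (\<lambda>H x. indicator B x * \<pi> H x)"
proof unfold_locales
  have BM: "B \<in> sets M" using B sub by (auto simp: subalgebra_def)
  {
    fix H :: "'a \<Rightarrow> real" and r assume H: "H \<in> ess_ball M r"
    show "(\<lambda>x. indicator B x * \<pi> H x) \<in> borel_measurable A" using evaluation_bounded(1)[OF H] B by measurable
    show "integrable M (\<lambda>x. indicator B x * \<pi> H x)"
      using integrable_mult_indicator[OF BM evaluation_integrable[OF H]] by simp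
  next
    fix H1 H2 :: "'a \<Rightarrow> real" and r and t :: real
    assume H: "H1 \<in> ess_ball M r" "H2 \<in> ess_ball M r" and t: "0 \<le> t" "t \<le> 1"
    have "AE x in M. \<pi> (\<lambda>y. t * H1 y + (1 - t) * H2 y) x \<le> t * \<pi> H1 x + (1 - t) * \<pi> H2 x"
      using conditional_evaluation_convex[OF eval H[THEN ess_ball_in_Linf], of "\<lambda>_. t"] t by simp
    then show "AE x in M. indicator B x * \<pi> (\<lambda>y. t * H1 y + (1 - t) * H2 y) x
        \<le> t * (indicator B x * \<pi> H1 x) + (1 - t) * (indicator B x * \<pi> H2 x)"
      by eventually_elim (simp add: indicator_def)
  next
    fix H1 H2 :: "'a \<Rightarrow> real" and r C
    assume H: "H1 \<in> ess_ball M r" "H2 \<in> ess_ball M r" and C: "C \<in> sets A"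
    show "AE x in M. indicator B x * \<pi> (\<lambda>y. indicator C y * H1 y + indicator (space M - C) y * H2 y) x
        = indicator C x * (indicator B x * \<pi> H1 x) + indicator (space M - C) x * (indicator B x * \<pi> H2 x)"
      using conditional_evaluation_local[OF eval H[THEN ess_ball_in_Linf] C]
      by eventually_elim (simp add: algebra_simps)
  next
    fix Hs :: "nat \<Rightarrow> 'a \<Rightarrow> real" and H r
    assume *: "\<And>k. Hs k \<in> ess_ball M r" "H \<in> ess_ball M r" "AE x in M. (\<lambda>k. Hs k x) \<longlonglongrightarrow> H x"
    show "AE x in M. ereal (indicator B x * \<pi> H x) \<le> liminf (\<lambda>k. ereal (indicator B x * \<pi> (Hs k) x))"
      using evaluation_fatou[OF *] by eventually_elim (auto simp: indicator_def Liminf_const)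
  next
    fix r
    obtain l where l: "integrable M l" "\<And>H. H \<in> ess_ball M r \<Longrightarrow> AE x in M. x \<in> B \<longrightarrow> l x \<le> \<pi> H x"
      using low by blast
    have "integrable M (\<lambda>x. indicator B x * l x)"
      using integrable_mult_indicator[OF BM l(1)] by simp
    moreover have "AE x in M. indicator B x * l x \<le> indicator B x * \<pi> H x" if "H \<in> ess_ball M r" for H
      using l(2)[OF that] by eventually_elim (auto simp: indicator_def)
    ultimately show "\<exists>l. integrable M l \<and> (\<forall>H\<in>ess_ball M r. AE x in M. l x \<le> indicator B x * \<pi> H x)" by blast
  }
qed

lemma is_ess_sup_penalty:
  "is_ess_sup M {\<lambda>x. ereal (real_cond_exp M A (\<lambda>y. \<xi> y * H y) x - \<pi> H x) |H. H \<in> Linf M M (\<lambda>_. 1)}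
     (penalty M A (\<lambda>_. 1) \<pi> \<xi>)"
  unfolding penalty_def
proof (rule is_ess_sup_ess_sup)
  show "{\<lambda>x. ereal (real_cond_exp M A (\<lambda>y. \<xi> y * H y) x - \<pi> H x) |H. H \<in> Linf M M (\<lambda>_. 1)}
    \<subseteq> borel_measurable M"
    using measurable_from_subalg[OF sub evaluation_bounded(1)]
    by (auto simp: Linf_one_iff intro!: borel_measurable_ereal borel_measurable_diff)
  show "{\<lambda>x. ereal (real_cond_exp M A (\<lambda>y. \<xi> y * H y) x - \<pi> H x) |H. H \<in> Linf M M (\<lambda>_. 1)} \<noteq> {}"
    using ess_ball_in_Linf[OF zero_in_ess_ball[of 0 M]] by blast
qed

text \<open>That the dual expressions stay below \<open>\<pi> H0\<close> is built into the penalty.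
  Conversely, let \<open>Z\<close> dominate them all. For given \<open>a\<close> and
  \<open>\<epsilon>\<close> a single approximate subgradient at \<open>H0\<close> shows that
  \<open>Z + a < \<pi> H0\<close> has probability at most \<open>\<epsilon>\<close>; its density
  depends on \<open>a\<close> and \<open>\<epsilon>\<close>, whereas \<open>Z\<close> does
  not.\<close>

theorem evaluation_dual:
  assumes "H0 \<in> Linf M M (\<lambda>_. 1)"
  shows "is_ess_sup M {\<lambda>x. ereal (real_cond_exp M A (\<lambda>y. \<xi> y * H0 y) x) - penalty M A (\<lambda>_. 1) \<pi> \<xi> x |\<xi>.
    integrable M \<xi>} (\<lambda>x. ereal (\<pi> H0 x))"
  unfolding is_ess_sup_def
proof (intro conjI ballI impI)
  obtain r0 where H0: "H0 \<in> ess_ball M r0" using assms by (auto simp: Linf_one_iff)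
  have \<pi>H0[measurable]: "\<pi> H0 \<in> borel_measurable M"
    using measurable_from_subalg[OF sub evaluation_bounded(1)[OF H0]] .
  show "(\<lambda>x. ereal (\<pi> H0 x)) \<in> borel_measurable M" by measurable
  {
    fix X
    assume "X \<in> {\<lambda>x. ereal (real_cond_exp M A (\<lambda>y. \<xi> y * H0 y) x) - penalty M A (\<lambda>_. 1) \<pi> \<xi> x |\<xi>. integrable M \<xi>}"
    then obtain \<xi> where X: "X = (\<lambda>x. ereal (real_cond_exp M A (\<lambda>y. \<xi> y * H0 y) x) - penalty M A (\<lambda>_. 1) \<pi> \<xi> x)"
      by blast
    have "AE x in M. ereal (real_cond_exp M A (\<lambda>y. \<xi> y * H0 y) x - \<pi> H0 x) \<le> penalty M A (\<lambda>_. 1) \<pi> \<xi> x"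
      using assms by (intro is_ess_sup_upper[OF is_ess_sup_penalty]) blast
    then show "AE x in M. X x \<le> ereal (\<pi> H0 x)"
    proof eventually_elim
      case (elim x)
      then show ?case unfolding X by (cases "penalty M A (\<lambda>_. 1) \<pi> \<xi> x") auto
    qed
  next
    fix Z assume Z[measurable]: "Z \<in> borel_measurable M"
      and Z_ge: "\<forall>X\<in>{\<lambda>x. ereal (real_cond_exp M A (\<lambda>y. \<xi> y * H0 y) x) - penalty M A (\<lambda>_. 1) \<pi> \<xi> x |\<xi>.
        integrable M \<xi>}. AE x in M. X x \<le> Z x"
    have small: "measure M {x \<in> space M. Z x + ereal a < ereal (\<pi> H0 x)} \<le> \<epsilon>" if "0 < a" "0 < \<epsilon>" for a \<epsilon> :: real
    proof -
      obtain B where B: "B \<in> sets A" "measure M (space M - B) \<le> \<epsilon> / 2"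
        "\<And>r. \<exists>l. integrable M l \<and> (\<forall>H\<in>ess_ball M r. AE x in M. x \<in> B \<longrightarrow> l x \<le> \<pi> H x)"
        using evaluation_lower_bound[of "\<epsilon> / 2"] \<open>0 < \<epsilon>\<close> by auto
      have BM[measurable]: "B \<in> sets M" using B(1) sub by (auto simp: subalgebra_def)
      interpret restr: local_convex_map M A "\<lambda>H x. indicator B x * \<pi> H x"
        using B(1,3) by (rule evaluation_restricted)
      \<comment> \<open>With mean at most \<open>a * \<epsilon> / 2\<close>, \<open>Y\<close>
        reaches \<open>a\<close> with probability at most \<open>\<epsilon> / 2\<close>; the other
        half of \<open>\<epsilon>\<close> is spent on the complement of \<open>B\<close>.\<close>
      have a\<epsilon>: "0 < a * \<epsilon> / 2" using that by simp
      obtain \<xi> Y where \<xi>: "integrable M \<xi>" and YA: "Y \<in> borel_measurable A"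
        and Y_le: "(\<integral>\<^sup>+x. Y x \<partial>M) \<le> ennreal (a * \<epsilon> / 2)"
        and dom: "\<And>H r. H \<in> ess_ball M r \<Longrightarrow> AE x in M. ennreal (real_cond_exp M A (\<lambda>y. \<xi> y * (H y - H0 y)) x
          - (indicator B x * \<pi> H x - indicator B x * \<pi> H0 x)) \<le> Y x"
        using restr.conditional_subgradient[OF H0 a\<epsilon>] by blast
      have [measurable]: "Y \<in> borel_measurable M" using sub YA by (rule measurable_from_subalg)
      let ?E = "\<lambda>H. real_cond_exp M A (\<lambda>y. \<xi> y * H y)"
      \<comment> \<open>An upper bound for the penalty of \<open>\<xi>\<close>: on \<open>B\<close>
        it is the subgradient inequality rearranged, elsewhere nothing is known. Being an essential
        supremum, the penalty inherits the bound from the single payoffs.\<close>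
      define W where "W x = (if x \<in> B then ereal (?E H0 x - \<pi> H0 x) + enn2ereal (Y x) else \<infinity>)" for x
      have W: "W \<in> borel_measurable M" unfolding W_def by measurable
      have "AE x in M. X x \<le> W x"
        if X_in: "X \<in> {\<lambda>x. ereal (?E H x - \<pi> H x) |H. H \<in> Linf M M (\<lambda>_. 1)}" for X
      proof -
        obtain H r where X: "X = (\<lambda>x. ereal (?E H x - \<pi> H x))" and H: "H \<in> ess_ball M r"
          using X_in unfolding Linf_one_iff by blast
        have "AE x in M. real_cond_exp M A (\<lambda>y. \<xi> y * H y - \<xi> y * H0 y) x = ?E H x - ?E H0 x"
          using integrable_mult_ess_ball[OF \<xi>] H H0 by (intro real_cond_exp_diff) auto
        then show ?thesis
          using dom[OF H] unfolding X
        proof eventually_elim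
          case (elim x)
          show ?case
          proof (cases "x \<in> B")
            case True
            have "ennreal ((?E H x - ?E H0 x) - (\<pi> H x - \<pi> H0 x)) \<le> Y x"
              using elim True by (simp add: right_diff_distrib)
            then have "ereal ((?E H x - ?E H0 x) - (\<pi> H x - \<pi> H0 x)) \<le> enn2ereal (Y x)"
              by (metis enn2ereal_ennreal ennreal_neg enn2ereal_nonneg ereal_less_eq(3,5) less_eq_ennreal.rep_eq linear order_trans)
            then show ?thesis using True by (cases "enn2ereal (Y x)") (auto simp: W_def)
          qed (simp add: W_def)
        qed
      qed
      then have "AE x in M. penalty M A (\<lambda>_. 1) \<pi> \<xi> x \<le> W x"
        by (rule is_ess_sup_least[OF is_ess_sup_penalty W])
      moreover have "AE x in M. ereal (?E H0 x) - penalty M A (\<lambda>_. 1) \<pi> \<xi> x \<le> Z x"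
        using \<xi> by (intro Z_ge[rule_format, of "\<lambda>x. ereal (?E H0 x) - penalty M A (\<lambda>_. 1) \<pi> \<xi> x"]) blast
      ultimately have incl: "AE x in M. x \<in> {x \<in> space M. Z x + ereal a < ereal (\<pi> H0 x)}
          \<longrightarrow> x \<in> (space M - B) \<union> {x \<in> space M. 1 \<le> ennreal (1 / a) * Y x}"
      proof eventually_elim
        case (elim x)
        show ?case
        proof
          assume x: "x \<in> {x \<in> space M. Z x + ereal a < ereal (\<pi> H0 x)}"
          have "1 \<le> ennreal (1 / a) * Y x" if "x \<in> B"
          proof (cases "Y x")
            case (real z)
            then have "penalty M A (\<lambda>_. 1) \<pi> \<xi> x \<le> ereal (?E H0 x - \<pi> H0 x + z)"
              using elim(1) \<open>x \<in> B\<close> by (simp add: W_def enn2ereal_ennreal)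
            then have "ereal (\<pi> H0 x - z) \<le> ereal (?E H0 x) - penalty M A (\<lambda>_. 1) \<pi> \<xi> x"
              by (cases "penalty M A (\<lambda>_. 1) \<pi> \<xi> x") auto
            then have "ereal (\<pi> H0 x - z) \<le> Z x" using elim(2) by (rule order_trans)
            then have "a < z" using x by (cases "Z x") auto
            then show ?thesis using real \<open>0 < a\<close> by (simp add: ennreal_mult[symmetric] field_simps)
          qed (use \<open>0 < a\<close> in \<open>simp add: ennreal_mult_top\<close>)
          then show "x \<in> (space M - B) \<union> {x \<in> space M. 1 \<le> ennreal (1 / a) * Y x}" using x by auto
        qed
      qed
      have "emeasure M {x \<in> space M. 1 \<le> ennreal (1 / a) * Y x}
          \<le> ennreal (1 / a) * (\<integral>\<^sup>+x. Y x * indicator (space M) x \<partial>M)"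
        using nn_integral_Markov_inequality[of Y "space M" M "ennreal (1 / a)"] by simp
      also have "(\<integral>\<^sup>+x. Y x * indicator (space M) x \<partial>M) = (\<integral>\<^sup>+x. Y x \<partial>M)"
        by (intro nn_integral_cong) auto
      also have "ennreal (1 / a) * (\<integral>\<^sup>+x. Y x \<partial>M) \<le> ennreal (1 / a) * ennreal (a * \<epsilon> / 2)"
        using Y_le by (intro mult_left_mono) auto
      also have "\<dots> = ennreal (\<epsilon> / 2)" using that by (simp add: ennreal_mult[symmetric])
      finally have Y_small: "measure M {x \<in> space M. 1 \<le> ennreal (1 / a) * Y x} \<le> \<epsilon> / 2"
        unfolding measure_def using that by (intro enn2real_leI) auto
      have "measure M {x \<in> space M. Z x + ereal a < ereal (\<pi> H0 x)}
          \<le> measure M ((space M - B) \<union> {x \<in> space M. 1 \<le> ennreal (1 / a) * Y x})"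
        using incl by (intro finite_measure_mono_AE) auto
      also have "\<dots> \<le> measure M (space M - B) + measure M {x \<in> space M. 1 \<le> ennreal (1 / a) * Y x}"
        by (intro measure_Un_le) auto
      finally show ?thesis using B(2) Y_small by linarith
    qed
    \<comment> \<open>Letting \<open>\<epsilon>\<close> tend to \<open>0\<close> at fixed
      \<open>a\<close> gives a null set; countably many values of \<open>a\<close> suffice.\<close>
    have "AE x in M. \<not> Z x + ereal (1 / real (Suc n)) < ereal (\<pi> H0 x)" for n
    proof -
      have "measure M {x \<in> space M. Z x + ereal (1 / real (Suc n)) < ereal (\<pi> H0 x)} \<le> 0"
        by (rule field_le_epsilon) (use small[of "1 / real (Suc n)"] in simp)
      then have "measure M {x \<in> space M. Z x + ereal (1 / real (Suc n)) < ereal (\<pi> H0 x)} = 0"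
        by (simp add: measure_le_0_iff)
      then show ?thesis by (subst (asm) prob_Collect_eq_0) auto
    qed
    then have "AE x in M. \<forall>n. \<not> Z x + ereal (1 / real (Suc n)) < ereal (\<pi> H0 x)"
      by (simp add: AE_all_countable)
    then show "AE x in M. ereal (\<pi> H0 x) \<le> Z x"
    proof eventually_elim
      case (elim x)
      show ?case
      proof (rule ereal_le_epsilon2)
        fix e :: real assume "0 < e"
        then obtain n where "1 / real (Suc n) < e" using nat_approx_posE by blast
        then have "Z x + ereal (1 / real (Suc n)) \<le> Z x + ereal e" by (intro add_left_mono) simp
        then show "ereal (\<pi> H0 x) \<le> Z x + ereal e" using elim by (meson leI order_trans)
      qed
    qed
  }
qed

end

subsection \<open>Change of numeraire\<close>

context sigma_finite_subalgebra
begin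

text \<open>
  Unlike \<open>real_cond_exp_mult\<close> this needs no integrability: where a conditional expectation is
  infinite, \<open>enn2real\<close> turns it into \<open>0\<close> on both sides.
\<close>

lemma real_cond_exp_pull_out:
  assumes f: "f \<in> borel_measurable F" and g[measurable]: "g \<in> borel_measurable M"
  shows "AE x in M. real_cond_exp M F (\<lambda>x. f x * g x) x = f x * real_cond_exp M F g x"
proof -
  have [measurable]: "f \<in> borel_measurable M" using subalg f by (rule measurable_from_subalg)
  have f_pos: "(\<lambda>x. ennreal (f x)) \<in> borel_measurable F" "(\<lambda>x. ennreal (- f x)) \<in> borel_measurable F"
    using f by measurable
  let ?n = "nn_cond_exp M F"
  let ?gp = "\<lambda>x. ennreal (g x)" and ?gn = "\<lambda>x. ennreal (- g x)"
  have pos: "(\<lambda>x. ennreal (f x * g x)) = (\<lambda>x. ennreal (f x) * ?gp x + ennreal (- f x) * ?gn x)"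
  proof
    fix x show "ennreal (f x * g x) = ennreal (f x) * ?gp x + ennreal (- f x) * ?gn x"
      by (cases "0 \<le> f x"; cases "0 \<le> g x")
         (auto simp: ennreal_neg mult_nonneg_nonpos mult_nonpos_nonneg simp flip: ennreal_mult ennreal_mult')
  qed
  have neg: "(\<lambda>x. ennreal (- (f x * g x))) = (\<lambda>x. ennreal (f x) * ?gn x + ennreal (- f x) * ?gp x)"
  proof
    fix x show "ennreal (- (f x * g x)) = ennreal (f x) * ?gn x + ennreal (- f x) * ?gp x"
      by (cases "0 \<le> f x"; cases "0 \<le> g x")
         (auto simp: ennreal_neg mult_nonpos_nonpos simp flip: ennreal_mult ennreal_mult')
  qed
  have prod: "AE x in M. ?n (\<lambda>x. ennreal (f x) * h x) x = ennreal (f x) * ?n h x"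
    "AE x in M. ?n (\<lambda>x. ennreal (- f x) * h x) x = ennreal (- f x) * ?n h x"
    if "h \<in> borel_measurable M" for h
    using nn_cond_exp_prod[OF f_pos(1) that] nn_cond_exp_prod[OF f_pos(2) that] by (auto simp: eq_commute)
  have sum: "AE x in M. ?n (\<lambda>x. ennreal (f x) * h x + ennreal (- f x) * k x) x
      = ?n (\<lambda>x. ennreal (f x) * h x) x + ?n (\<lambda>x. ennreal (- f x) * k x) x"
    if "h \<in> borel_measurable M" "k \<in> borel_measurable M" for h k
  proof -
    have "(\<lambda>x. ennreal (f x) * h x) \<in> borel_measurable M" "(\<lambda>x. ennreal (- f x) * k x) \<in> borel_measurable M"
      using that by measurable
    from nn_cond_exp_sum[OF this] show ?thesis by (simp add: eq_commute)
  qed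
  have gM: "?gp \<in> borel_measurable M" "?gn \<in> borel_measurable M" by measurable
  show ?thesis
    unfolding real_cond_exp_def pos neg
    using sum[OF gM] sum[OF gM(2,1)] prod[OF gM(1)] prod[OF gM(2)]
  proof eventually_elim
    case (elim x)
    show ?case
      by (cases "0 \<le> f x") (simp_all add: elim ennreal_neg enn2real_mult right_diff_distrib)
  qed
qed

section \<open>Identifying conditional expectations through indicators\<close>

lemma nn_cond_exp_zero_of_nonpos:
  assumes "f \<in> borel_measurable M" "AE x in M. f x \<le> 0"
  shows "AE x in M. nn_cond_exp M F (\<lambda>x. ennreal (f x)) x = 0"
proof -
  have "AE x in M. nn_cond_exp M F (\<lambda>x. ennreal (f x)) x = nn_cond_exp M F (\<lambda>_. 0) x"
    using assms by (intro nn_cond_exp_cong) (auto elim!: eventually_mono simp: ennreal_neg)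
  moreover have "AE x in M. (0::ennreal) = nn_cond_exp M F (\<lambda>_. 0) x"
    by (rule nn_cond_exp_F_meas) simp
  ultimately show ?thesis by eventually_elim simp
qed

lemma real_cond_exp_of_nonneg:
  assumes [measurable]: "f \<in> borel_measurable M" and "AE x in M. 0 \<le> f x"
  shows "AE x in M. real_cond_exp M F f x = enn2real (nn_cond_exp M F (\<lambda>x. ennreal (f x)) x)"
proof -
  have "AE x in M. nn_cond_exp M F (\<lambda>x. ennreal (- f x)) x = 0"
    using assms(2) by (intro nn_cond_exp_zero_of_nonpos) (auto elim!: eventually_mono)
  then show ?thesis by eventually_elim (simp add: real_cond_exp_def)
qed

lemma nn_integral_nn_cond_exp:
  assumes "f \<in> borel_measurable M"
  shows "(\<integral>\<^sup>+x. nn_cond_exp M F f x \<partial>M) = (\<integral>\<^sup>+x. f x \<partial>M)"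
  using nn_cond_exp_intg[of "\<lambda>_. 1" f] assms by simp

text \<open>Seen as densities, \<open>u\<close> and \<open>v\<close> define the same measure on
  \<open>F'\<close>, so they agree when integrated against any nonnegative
  \<open>F'\<close>-measurable function, in particular against \<open>z\<close> times the indicator
  of a set of \<open>F\<close>.\<close>

lemma nn_cond_exp_eq_of_indicators:
  assumes sub: "subalgebra M F'" "sets F \<subseteq> sets F'"
    and [measurable]: "u \<in> borel_measurable M" "v \<in> borel_measurable M"
    and eq: "\<And>B. B \<in> sets F' \<Longrightarrow> (\<integral>\<^sup>+x. indicator B x * u x \<partial>M) = (\<integral>\<^sup>+x. indicator B x * v x \<partial>M)"
    and z: "z \<in> borel_measurable F'"
  shows "AE x in M. nn_cond_exp M F (\<lambda>x. z x * u x) x = nn_cond_exp M F (\<lambda>x. z x * v x) x"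
proof -
  have sub_density: "subalgebra (density M w) F'" for w
    using sub(1) by (simp add: subalgebra_def)
  have emeasure_density: "emeasure (density M w) B = (\<integral>\<^sup>+x. indicator B x * w x \<partial>M)"
    if "w \<in> borel_measurable M" "B \<in> sets F'" for w B
    using that sub(1) by (subst emeasure_density) (auto simp: subalgebra_def mult.commute)
  have "restr_to_subalg (density M u) F' = restr_to_subalg (density M v) F'"
  proof (rule measure_eqI)
    fix B assume "B \<in> sets (restr_to_subalg (density M u) F')"
    then have B: "B \<in> sets F'" using sets_restr_to_subalg[OF sub_density] by simp
    show "emeasure (restr_to_subalg (density M u) F') B = emeasure (restr_to_subalg (density M v) F') B"
      using B by (simp add: emeasure_restr_to_subalg[OF sub_density] emeasure_density eq)
  qed (simp add: sets_restr_to_subalg[OF sub_density])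
  then have int_eq: "(\<integral>\<^sup>+x. h x * u x \<partial>M) = (\<integral>\<^sup>+x. h x * v x \<partial>M)" if h: "h \<in> borel_measurable F'" for h
  proof -
    have hM: "h \<in> borel_measurable M" using sub(1) h by (rule measurable_from_subalg)
    have "(\<integral>\<^sup>+x. h x * w x \<partial>M) = (\<integral>\<^sup>+x. h x \<partial>restr_to_subalg (density M w) F')"
      if "w \<in> borel_measurable M" for w
      using that hM by (simp add: nn_integral_subalgebra2[OF sub_density h] nn_integral_density mult.commute)
    then show ?thesis using \<open>restr_to_subalg (density M u) F' = _\<close> by simp
  qed
  have zM[measurable]: "z \<in> borel_measurable M" using sub(1) z by (rule measurable_from_subalg)
  have "AE x in M. nn_cond_exp M F (\<lambda>x. z x * v x) x = nn_cond_exp M F (\<lambda>x. z x * u x) x"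
  proof (rule nn_cond_exp_charact)
    fix C assume C: "C \<in> sets F"
    then have "C \<in> sets F'" using sub(2) by blast
    then have "(\<lambda>x. indicator C x * z x) \<in> borel_measurable F'" using z by measurable
    from int_eq[OF this] have "(\<integral>\<^sup>+x\<in>C. (z x * u x) \<partial>M) = (\<integral>\<^sup>+x. indicator C x * (z x * v x) \<partial>M)"
      by (simp add: mult_ac)
    also have "\<dots> = (\<integral>\<^sup>+x. indicator C x * nn_cond_exp M F (\<lambda>x. z x * v x) x \<partial>M)"
      using C by (intro nn_cond_exp_intg[symmetric]) auto
    finally show "(\<integral>\<^sup>+x\<in>C. (z x * u x) \<partial>M) = (\<integral>\<^sup>+x\<in>C. nn_cond_exp M F (\<lambda>x. z x * v x) x \<partial>M)"
      by (simp add: mult.commute)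
  qed auto
  then show ?thesis by (simp add: eq_commute)
qed

text \<open>The martingale property tests with indicators; here it is extended to arbitrary
  \<open>F'\<close>-measurable factors \<open>z\<close>, for which \<open>z x * u x\<close> need not
  be integrable. Finiteness matters because \<open>real_cond_exp\<close> reads an infinite
  conditional expectation as \<open>0\<close>, and equality of such values would carry no
  information.\<close>

lemma real_cond_exp_eq_of_indicators:
  assumes sub: "subalgebra M F'" "sets F \<subseteq> sets F'"
    and [measurable]: "u \<in> borel_measurable M" "v \<in> borel_measurable M"
    and nonneg: "AE x in M. 0 \<le> u x" "AE x in M. 0 \<le> v x"
    and fin: "AE x in M. nn_cond_exp M F (\<lambda>x. ennreal (u x)) x < \<infinity>" "AE x in M. nn_cond_exp M F (\<lambda>x. ennreal (v x)) x < \<infinity>"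
    and eq: "\<And>B. B \<in> sets F' \<Longrightarrow> AE x in M. real_cond_exp M F (\<lambda>x. indicator B x * u x) x
      = real_cond_exp M F (\<lambda>x. indicator B x * v x) x"
  shows "\<And>z. z \<in> borel_measurable F' \<Longrightarrow> AE x in M. nn_cond_exp M F (\<lambda>x. z x * ennreal (u x)) x = nn_cond_exp M F (\<lambda>x. z x * ennreal (v x)) x"
    and "\<And>z. z \<in> borel_measurable F' \<Longrightarrow> AE x in M. real_cond_exp M F (\<lambda>x. z x * u x) x = real_cond_exp M F (\<lambda>x. z x * v x) x"
proof -
  have nn_ind: "AE x in M. ennreal (real_cond_exp M F (\<lambda>x. indicator B x * w x) x) = nn_cond_exp M F (\<lambda>x. indicator B x * ennreal (w x)) x"
    if B: "B \<in> sets F'" and [measurable]: "w \<in> borel_measurable M" and "AE x in M. 0 \<le> w x"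
      and "AE x in M. nn_cond_exp M F (\<lambda>x. ennreal (w x)) x < \<infinity>" for B w
  proof -
    have [measurable]: "B \<in> sets M" using B sub(1) by (auto simp: subalgebra_def)
    have eq: "(\<lambda>x. ennreal (indicator B x * w x)) = (\<lambda>x. indicator B x * ennreal (w x))"
      by (auto simp: indicator_def)
    have "AE x in M. real_cond_exp M F (\<lambda>x. indicator B x * w x) x
        = enn2real (nn_cond_exp M F (\<lambda>x. indicator B x * ennreal (w x)) x)"
      unfolding eq[symmetric] using that(3) by (intro real_cond_exp_of_nonneg) (auto elim!: eventually_mono)
    moreover have "AE x in M. nn_cond_exp M F (\<lambda>x. indicator B x * ennreal (w x)) x \<le> nn_cond_exp M F (\<lambda>x. ennreal (w x)) x"
      by (intro nn_cond_exp_mono) (auto simp: indicator_def)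
    ultimately show ?thesis using that(4)
    proof eventually_elim
      case (elim x)
      then have "nn_cond_exp M F (\<lambda>x. indicator B x * ennreal (w x)) x < top" by (simp add: le_less_trans)
      then show ?case using elim(1) by simp
    qed
  qed
  have int_eq: "(\<integral>\<^sup>+x. indicator B x * ennreal (u x) \<partial>M) = (\<integral>\<^sup>+x. indicator B x * ennreal (v x) \<partial>M)"
    if B: "B \<in> sets F'" for B
  proof -
    have [measurable]: "B \<in> sets M" using B sub(1) by (auto simp: subalgebra_def)
    have "(\<integral>\<^sup>+x. nn_cond_exp M F (\<lambda>x. indicator B x * ennreal (u x)) x \<partial>M)
        = (\<integral>\<^sup>+x. nn_cond_exp M F (\<lambda>x. indicator B x * ennreal (v x)) x \<partial>M)"
      using nn_ind[OF B _ nonneg(1) fin(1)] nn_ind[OF B _ nonneg(2) fin(2)] eq[OF B]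
      by (intro nn_integral_cong_AE) auto
    then show ?thesis by (simp add: nn_integral_nn_cond_exp)
  qed
  have uv: "(\<lambda>x. ennreal (u x)) \<in> borel_measurable M" "(\<lambda>x. ennreal (v x)) \<in> borel_measurable M" by measurable
  show nn_eq: "AE x in M. nn_cond_exp M F (\<lambda>x. z x * ennreal (u x)) x = nn_cond_exp M F (\<lambda>x. z x * ennreal (v x)) x"
    if "z \<in> borel_measurable F'" for z
    using nn_cond_exp_eq_of_indicators[OF sub uv int_eq that] .
  fix z :: "'a \<Rightarrow> real" assume z: "z \<in> borel_measurable F'"
  have zM[measurable]: "z \<in> borel_measurable M" using sub(1) z by (rule measurable_from_subalg)
  have zF: "(\<lambda>x. ennreal (z x)) \<in> borel_measurable F'" "(\<lambda>x. ennreal (- z x)) \<in> borel_measurable F'"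
    using z by measurable
  have split: "AE x in M. nn_cond_exp M F (\<lambda>x. ennreal (z x * w x)) x = nn_cond_exp M F (\<lambda>x. ennreal (z x) * ennreal (w x)) x"
    "AE x in M. nn_cond_exp M F (\<lambda>x. ennreal (- (z x * w x))) x = nn_cond_exp M F (\<lambda>x. ennreal (- z x) * ennreal (w x)) x"
    if [measurable]: "w \<in> borel_measurable M" and "AE x in M. 0 \<le> w x" for w
  proof -
    show "AE x in M. nn_cond_exp M F (\<lambda>x. ennreal (z x * w x)) x = nn_cond_exp M F (\<lambda>x. ennreal (z x) * ennreal (w x)) x"
    proof (rule nn_cond_exp_cong)
      show "AE x in M. ennreal (z x * w x) = ennreal (z x) * ennreal (w x)"
        using that(2) by eventually_elim (rule ennreal_mult'')
    qed measurable
    show "AE x in M. nn_cond_exp M F (\<lambda>x. ennreal (- (z x * w x))) x = nn_cond_exp M F (\<lambda>x. ennreal (- z x) * ennreal (w x)) x"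
    proof (rule nn_cond_exp_cong)
      show "AE x in M. ennreal (- (z x * w x)) = ennreal (- z x) * ennreal (w x)"
        using that(2) by eventually_elim (simp flip: ennreal_mult'')
    qed measurable
  qed
  \<comment> \<open>Positive and negative parts agree separately, before any subtraction, so this
    holds even where they are infinite.\<close>
  show "AE x in M. real_cond_exp M F (\<lambda>x. z x * u x) x = real_cond_exp M F (\<lambda>x. z x * v x) x"
    unfolding real_cond_exp_def
    using split[OF _ nonneg(1)] split[OF _ nonneg(2)] nn_eq[OF zF(1)] nn_eq[OF zF(2)] by auto
qed

end

section \<open>The information generated by the prices\<close>

context
  fixes M G :: "'a measure" and n :: nat and S :: "nat \<Rightarrow> real \<Rightarrow> 'a \<Rightarrow> real" and TT :: "real set"
  assumes initial_info: "subalgebra M G"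
    and prices: "\<And>j t. j \<in> {1..n} \<Longrightarrow> t \<in> TT \<Longrightarrow> S j t \<in> borel_measurable M"
begin

lemma price_info_generators:
  assumes "U \<subseteq> TT"
  shows "sets G \<union> (\<Union>j\<in>{1..n}. \<Union>t\<in>U. {S j t -` B \<inter> space M |B. B \<in> sets borel}) \<subseteq> sets M"
  using assms initial_info prices by (auto simp: subalgebra_def intro!: measurable_sets[OF prices])

lemma
  assumes "U \<subseteq> TT"
  shows space_price_info: "space (price_info M G n S U) = space M"
    and sets_price_info: "sets (price_info M G n S U) = sigma_sets (space M)
       (sets G \<union> (\<Union>j\<in>{1..n}. \<Union>t\<in>U. {S j t -` B \<inter> space M |B. B \<in> sets borel}))"
proof -
  have "sets G \<union> (\<Union>j\<in>{1..n}. \<Union>t\<in>U. {S j t -` B \<inter> space M |B. B \<in> sets borel}) \<subseteq> Pow (space M)"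
    using price_info_generators[OF assms] sets.space_closed by blast
  then show "space (price_info M G n S U) = space M" "sets (price_info M G n S U) = sigma_sets (space M)
       (sets G \<union> (\<Union>j\<in>{1..n}. \<Union>t\<in>U. {S j t -` B \<inter> space M |B. B \<in> sets borel}))"
    unfolding price_info_def by (simp_all only: space_measure_of sets_measure_of)
qed

lemma subalgebra_price_info:
  assumes "U \<subseteq> TT"
  shows "subalgebra M (price_info M G n S U)"
  unfolding subalgebra_def space_price_info[OF assms] sets_price_info[OF assms]
  using sets.sigma_sets_subset[OF price_info_generators[OF assms]] by simp

lemma subalgebra_price_info_initial:
  assumes "U \<subseteq> TT"
  shows "subalgebra (price_info M G n S U) G"
  using initial_info unfolding subalgebra_def space_price_info[OF assms] sets_price_info[OF assms] by auto

lemma subalgebra_price_info_mono: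
  assumes "U' \<subseteq> U" "U \<subseteq> TT"
  shows "subalgebra (price_info M G n S U) (price_info M G n S U')"
proof -
  have U': "U' \<subseteq> TT" using assms by simp
  show ?thesis
    unfolding subalgebra_def space_price_info[OF assms(2)] sets_price_info[OF assms(2)]
      space_price_info[OF U'] sets_price_info[OF U']
    using assms(1) by (intro conjI sigma_sets_mono') auto
qed

lemma measurable_price_info:
  assumes U: "U \<subseteq> TT" and "j \<in> {1..n}" "t \<in> U"
  shows "S j t \<in> borel_measurable (price_info M G n S U)"
proof (rule measurableI)
  fix B :: "real set" assume "B \<in> sets borel"
  then show "S j t -` B \<inter> space (price_info M G n S U) \<in> sets (price_info M G n S U)"
    unfolding space_price_info[OF U] sets_price_info[OF U]
    using assms(2,3) by (intro sigma_sets.Basic) blast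
qed simp

lemma asset_price_info:
  assumes "U \<subseteq> TT" "j \<le> n" "t \<in> U"
  shows "asset S j t \<in> borel_measurable (price_info M G n S U)"
proof (cases "j = 0")
  case True
  then have "asset S j t = (\<lambda>_. 1)" by (auto simp: asset_def)
  then show ?thesis by simp
next
  case False
  then have "asset S j t = S j t" by (auto simp: asset_def)
  then show ?thesis using measurable_price_info[OF assms(1) _ assms(3), of j] assms(2) False by simp
qed

context
  fixes T :: real
  assumes prob: "prob_space M" and times: "TT \<subseteq> {0..T}" "0 \<in> TT" "T \<in> TT"
begin

interpretation prob_space M by (rule prob)
interpretation finite_measure_subalgebra M G using initial_info by unfold_locales

abbreviation "info t \<equiv> price_info M G n S (TT \<inter> {..t})"

lemma subalgebra_info: "subalgebra M (info t)"
  by (rule subalgebra_price_info) auto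

lemma sets_initial_le_info: "sets G \<subseteq> sets (info t)"
  using subalgebra_price_info_initial[where U="TT \<inter> {..t}"] by (simp add: subalgebra_def)

lemma sets_info_mono: "s \<le> t \<Longrightarrow> sets (info s) \<subseteq> sets (info t)"
  using subalgebra_price_info_mono[of "TT \<inter> {..s}" "TT \<inter> {..t}"] by (fastforce simp: subalgebra_def)

lemma measurable_info_terminal:
  assumes "f \<in> borel_measurable (info t)"
  shows "f \<in> borel_measurable (price_info M G n S TT)"
  using subalgebra_price_info_mono[where U="TT" and U'="TT \<inter> {..t}"] assms
  by (auto intro: measurable_from_subalg)

lemma conditional_martingaleD:
  assumes "martingale_density M G TT n S N \<xi>" "j \<le> n"
  shows "\<And>t. t \<in> TT \<Longrightarrow> (\<lambda>x. asset S j t x / N t x) \<in> borel_measurable (info t)"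
    and "\<And>t. t \<in> TT \<Longrightarrow> AE x in M. nn_cond_exp M G (\<lambda>y. ennreal (\<xi> y * \<bar>asset S j t y / N t y\<bar>)) x < \<infinity>"
    and "\<And>s t B. s \<in> TT \<Longrightarrow> t \<in> TT \<Longrightarrow> s \<le> t \<Longrightarrow> B \<in> sets (info s) \<Longrightarrow>
      AE x in M. real_cond_exp M G (\<lambda>x. \<xi> x * (indicator B x * (asset S j t x / N t x))) x
        = real_cond_exp M G (\<lambda>x. \<xi> x * (indicator B x * (asset S j s x / N s x))) x"
  using assms unfolding martingale_density_def conditional_martingale_def cond_exp_under_def by simp_all

text \<open>
  Bayes' formula: the martingale property of the new numeraire \<open>V / U\<close> moves the density
  \<open>V T / U T\<close> from time \<open>T\<close> to time \<open>t\<close> in front of anything known at time \<open>t\<close>.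
\<close>

lemma change_of_numeraire:
  assumes \<xi>: "martingale_density M G TT n S U \<xi>" and k: "k \<le> n" "\<And>t. V t = asset S k t"
    and U: "\<And>t. t \<in> TT \<Longrightarrow> U t \<in> borel_measurable (info t)" "\<And>t. t \<in> TT \<Longrightarrow> AE x in M. 0 < U t x"
      "U 0 \<in> borel_measurable G"
    and V: "\<And>t. t \<in> TT \<Longrightarrow> AE x in M. 0 < V t x" "V 0 \<in> borel_measurable G"
  shows "martingale_density M G TT n S V (\<lambda>x. \<xi> x * (V T x / U T x) * (U 0 x / V 0 x))"
proof -
  have V_meas: "V t \<in> borel_measurable (info t)" if "t \<in> TT" for t
    unfolding k(2) using asset_price_info[where U="TT \<inter> {..t}"] k(1) that by auto
  have to_M: "f \<in> borel_measurable M" if "f \<in> borel_measurable (info t)" for f :: "'a \<Rightarrow> real" and t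
    using subalgebra_info that by (rule measurable_from_subalg)
  have G_M: "f \<in> borel_measurable M" if "f \<in> borel_measurable G" for f :: "'a \<Rightarrow> real"
    using initial_info that by (rule measurable_from_subalg)
  have \<xi>_FS: "\<xi> \<in> borel_measurable (price_info M G n S TT)" and \<xi>_nonneg: "AE x in M. 0 \<le> \<xi> x"
    and \<xi>_one: "AE x in M. real_cond_exp M G \<xi> x = 1"
    using \<xi> unfolding martingale_density_def conditional_density_def by auto
  have \<xi>M[measurable]: "\<xi> \<in> borel_measurable M"
    using subalgebra_price_info[of TT] \<xi>_FS by (auto intro: measurable_from_subalg)
  \<comment> \<open>The new density is split into \<open>r\<close>, known initially, and
    \<open>u T\<close>, the terminal price of the new numeraire in units of the old one weighted by
    \<open>\<xi>\<close>. Only \<open>u\<close> moves in time; \<open>r\<close> is pulled out of the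
    conditional expectations.\<close>
  define r where "r x = U 0 x / V 0 x" for x
  define u where "u t x = \<xi> x * (V t x / U t x)" for t x
  have UM: "U t \<in> borel_measurable M" and VM: "V t \<in> borel_measurable M" if "t \<in> TT" for t
    using to_M U(1) V_meas that by blast+
  have uM[measurable]: "u t \<in> borel_measurable M" if "t \<in> TT" for t
    unfolding u_def using UM[OF that] VM[OF that] by measurable
  have u_nonneg: "AE x in M. 0 \<le> u t x" if "t \<in> TT" for t
    using \<xi>_nonneg U(2)[OF that] V(1)[OF that] by eventually_elim (simp add: u_def)
  have u_fin: "AE x in M. nn_cond_exp M G (\<lambda>x. ennreal (u t x)) x < \<infinity>" if "t \<in> TT" for t
  proof -
    have "AE x in M. nn_cond_exp M G (\<lambda>x. ennreal (u t x)) x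
        = nn_cond_exp M G (\<lambda>y. ennreal (\<xi> y * \<bar>asset S k t y / U t y\<bar>)) x"
    proof (rule nn_cond_exp_cong)
      show "AE x in M. ennreal (u t x) = ennreal (\<xi> x * \<bar>asset S k t x / U t x\<bar>)"
        using U(2)[OF that] V(1)[OF that] by eventually_elim (simp add: u_def k(2))
      show "(\<lambda>x. ennreal (\<xi> x * \<bar>asset S k t x / U t x\<bar>)) \<in> borel_measurable M"
        using UM[OF that] VM[OF that] unfolding k(2) by measurable
    qed (use uM[OF that] in measurable)
    then show ?thesis using conditional_martingaleD(2)[OF \<xi> k(1) that] by eventually_elim simp
  qed
  have u_eq: "AE x in M. real_cond_exp M G (\<lambda>x. indicator B x * u T x) x = real_cond_exp M G (\<lambda>x. indicator B x * u t x) x"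
    if "t \<in> TT" "B \<in> sets (info t)" for t B
  proof -
    have "t \<le> T" using times(1) that(1) by auto
    then show ?thesis
      using conditional_martingaleD(3)[OF \<xi> k(1) that(1) times(3) _ that(2)] by (simp add: u_def k(2) mult_ac)
  qed
  have transfer:
    "AE x in M. nn_cond_exp M G (\<lambda>x. w x * ennreal (u T x)) x = nn_cond_exp M G (\<lambda>x. w x * ennreal (u t x)) x"
    "AE x in M. real_cond_exp M G (\<lambda>x. z x * u T x) x = real_cond_exp M G (\<lambda>x. z x * u t x) x"
    if t: "t \<in> TT" and wz: "w \<in> borel_measurable (info t)" "z \<in> borel_measurable (info t)" for t w z
  proof -
    note * = subalgebra_info sets_initial_le_info uM[OF times(3)] uM[OF t]
      u_nonneg[OF times(3)] u_nonneg[OF t] u_fin[OF times(3)] u_fin[OF t] u_eq[OF t]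
    show "AE x in M. nn_cond_exp M G (\<lambda>x. w x * ennreal (u T x)) x = nn_cond_exp M G (\<lambda>x. w x * ennreal (u t x)) x"
      by (rule real_cond_exp_eq_of_indicators(1)[OF * wz(1)])
    show "AE x in M. real_cond_exp M G (\<lambda>x. z x * u T x) x = real_cond_exp M G (\<lambda>x. z x * u t x) x"
      by (rule real_cond_exp_eq_of_indicators(2)[OF * wz(2)])
  qed
  have r_G[measurable]: "r \<in> borel_measurable G" unfolding r_def using U(3) V(2) by measurable
  have r_M[measurable]: "r \<in> borel_measurable M" using r_G by (rule G_M)
  have r_pos: "AE x in M. 0 < r x"
    using U(2)[OF times(2)] V(1)[OF times(2)] by eventually_elim (simp add: r_def)
  define \<xi>' where "\<xi>' x = \<xi> x * (V T x / U T x) * (U 0 x / V 0 x)" for x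
  have \<xi>'_eq: "\<xi>' = (\<lambda>x. r x * u T x)" by (rule ext) (simp add: \<xi>'_def r_def u_def mult_ac)
  have bayes: "AE x in M. real_cond_exp M G (\<lambda>x. \<xi>' x * z x) x = r x * real_cond_exp M G (\<lambda>x. u t x * z x) x"
    if "t \<in> TT" and z: "z \<in> borel_measurable (info t)" for t z
  proof -
    have [measurable]: "z \<in> borel_measurable M" "u T \<in> borel_measurable M"
      using to_M[OF z] uM[OF times(3)] by auto
    have eq: "(\<lambda>x. \<xi>' x * z x) = (\<lambda>x. r x * (u T x * z x))" by (auto simp: \<xi>'_eq mult_ac)
    have "AE x in M. real_cond_exp M G (\<lambda>x. r x * (u T x * z x)) x = r x * real_cond_exp M G (\<lambda>x. u T x * z x) x"
      by (rule real_cond_exp_pull_out) measurable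
    moreover have "AE x in M. real_cond_exp M G (\<lambda>x. u T x * z x) x = real_cond_exp M G (\<lambda>x. u t x * z x) x"
      using transfer(2)[OF that(1) borel_measurable_const z] by (simp add: mult.commute)
    ultimately show ?thesis unfolding eq by eventually_elim simp
  qed
  show ?thesis
    unfolding martingale_density_def \<xi>'_def[symmetric]
  proof (intro conjI allI impI)
    show "conditional_density M G (price_info M G n S TT) \<xi>'"
      unfolding conditional_density_def
    proof (intro conjI)
      have "V T \<in> borel_measurable (price_info M G n S TT)" "U T \<in> borel_measurable (price_info M G n S TT)"
        "V 0 \<in> borel_measurable (price_info M G n S TT)" "U 0 \<in> borel_measurable (price_info M G n S TT)"
        using V_meas U(1) times(2,3) by (auto intro: measurable_info_terminal)
      then show "\<xi>' \<in> borel_measurable (price_info M G n S TT)" unfolding \<xi>'_def using \<xi>_FS by measurable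
      show "AE x in M. 0 \<le> \<xi>' x"
        using r_pos u_nonneg[OF times(3)] by eventually_elim (simp add: \<xi>'_eq)
      have "AE x in M. real_cond_exp M G \<xi>' x = r x * real_cond_exp M G (\<lambda>x. u 0 x) x"
        using bayes[OF times(2), of "\<lambda>_. 1"] by simp
      \<comment> \<open>At time \<open>0\<close> the factor \<open>V 0 x / U 0 x\<close> is known
        and cancels \<open>r\<close>; this is the normalisation that the initial prices in the
        density are for.\<close>
      moreover have "AE x in M. real_cond_exp M G (\<lambda>x. u 0 x) x = (V 0 x / U 0 x) * real_cond_exp M G \<xi> x"
      proof -
        have "(\<lambda>x. u 0 x) = (\<lambda>x. (V 0 x / U 0 x) * \<xi> x)" by (auto simp: u_def)
        then show ?thesis using U(3) V(2) real_cond_exp_pull_out[of "\<lambda>x. V 0 x / U 0 x" \<xi>] by simp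
      qed
      ultimately show "AE x in M. real_cond_exp M G \<xi>' x = 1"
        using \<xi>_one U(2)[OF times(2)] V(1)[OF times(2)] by eventually_elim (simp add: r_def)
    qed
  next
    fix j assume j: "j \<le> n"
    have A_meas: "asset S j t \<in> borel_measurable (info t)" if "t \<in> TT" for t
      using asset_price_info[where U="TT \<inter> {..t}"] j that by auto
    show "conditional_martingale M G info TT \<xi>' (\<lambda>t x. asset S j t x / V t x)"
      unfolding conditional_martingale_def cond_exp_under_def
    proof (intro conjI ballI impI)
      fix t assume t: "t \<in> TT"
      show meas: "(\<lambda>x. asset S j t x / V t x) \<in> borel_measurable (info t)"
        using A_meas[OF t] V_meas[OF t] by measurable
      have [measurable]: "(\<lambda>x. asset S j t x / V t x) \<in> borel_measurable M" "asset S j t \<in> borel_measurable M"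
        "u T \<in> borel_measurable M" "u t \<in> borel_measurable M" "U t \<in> borel_measurable M"
        using to_M[OF meas] to_M[OF A_meas[OF t]] uM[OF times(3)] uM[OF t] UM[OF t] by auto
      define z where "z x = ennreal \<bar>asset S j t x / V t x\<bar>" for x
      have z[measurable]: "z \<in> borel_measurable (info t)" "z \<in> borel_measurable M"
        unfolding z_def using meas by measurable
      \<comment> \<open>Integrability is transferred in \<open>ennreal\<close>, since finiteness is
        invisible to \<open>real_cond_exp\<close>. Moving the density from \<open>T\<close> to
        \<open>t\<close> lets \<open>V t\<close> cancel, and integrability under
        \<open>\<xi>\<close> in units of \<open>U\<close> remains.\<close>
      have "AE x in M. nn_cond_exp M G (\<lambda>y. ennreal (\<xi>' y * \<bar>asset S j t y / V t y\<bar>)) x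
        = nn_cond_exp M G (\<lambda>y. ennreal (r y) * (z y * ennreal (u T y))) x"
      proof (rule nn_cond_exp_cong)
        show "AE x in M. ennreal (\<xi>' x * \<bar>asset S j t x / V t x\<bar>) = ennreal (r x) * (z x * ennreal (u T x))"
          using r_pos u_nonneg[OF times(3)]
        proof eventually_elim
          case (elim x)
          have "ennreal (r x) * (z x * ennreal (u T x)) = ennreal (r x * (\<bar>asset S j t x / V t x\<bar> * u T x))"
            using elim unfolding z_def by (simp only: ennreal_mult' ennreal_mult'' less_imp_le)
          then show ?case by (simp add: \<xi>'_eq mult_ac)
        qed
      qed (unfold \<xi>'_eq, measurable)
      moreover have "AE x in M. nn_cond_exp M G (\<lambda>y. ennreal (r y) * (z y * ennreal (u T y))) x
        = ennreal (r x) * nn_cond_exp M G (\<lambda>y. z y * ennreal (u T y)) x"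
      proof -
        have "AE x in M. ennreal (r x) * nn_cond_exp M G (\<lambda>y. z y * ennreal (u T y)) x
          = nn_cond_exp M G (\<lambda>y. ennreal (r y) * (z y * ennreal (u T y))) x"
          by (rule nn_cond_exp_prod) measurable
        then show ?thesis by eventually_elim (rule sym)
      qed
      moreover have "AE x in M. nn_cond_exp M G (\<lambda>y. z y * ennreal (u T y)) x = nn_cond_exp M G (\<lambda>y. z y * ennreal (u t y)) x"
        using transfer(1)[OF t z(1) borel_measurable_const] .
      moreover have "AE x in M. nn_cond_exp M G (\<lambda>y. z y * ennreal (u t y)) x
        = nn_cond_exp M G (\<lambda>y. ennreal (\<xi> y * \<bar>asset S j t y / U t y\<bar>)) x"
      proof (rule nn_cond_exp_cong)
        show "AE x in M. z x * ennreal (u t x) = ennreal (\<xi> x * \<bar>asset S j t x / U t x\<bar>)"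
          using U(2)[OF t] V(1)[OF t] u_nonneg[OF t]
        proof eventually_elim
          case (elim x)
          have "z x * ennreal (u t x) = ennreal (\<bar>asset S j t x / V t x\<bar> * u t x)"
            using elim(3) by (simp only: z_def ennreal_mult'')
          also have "\<bar>asset S j t x / V t x\<bar> * u t x = \<xi> x * \<bar>asset S j t x / U t x\<bar>"
            using elim by (simp add: u_def abs_divide)
          finally show ?case .
        qed
      qed measurable
      ultimately show "AE x in M. nn_cond_exp M G (\<lambda>y. ennreal (\<xi>' y * \<bar>asset S j t y / V t y\<bar>)) x < \<infinity>"
        using conditional_martingaleD(2)[OF \<xi> j t]
        by eventually_elim (simp add: ennreal_mult_less_top)
    next
      \<comment> \<open>Reduces either side of the new martingale identity to the old one:
        \<open>V t\<close> cancels, and the factor \<open>r\<close> is the same at all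
        times.\<close>
      have key: "AE x in M. real_cond_exp M G (\<lambda>x. \<xi>' x * (indicator B x * (asset S j t x / V t x))) x
          = r x * real_cond_exp M G (\<lambda>x. \<xi> x * (indicator B x * (asset S j t x / U t x))) x"
        if t: "t \<in> TT" and B: "B \<in> sets (info t)" for t B
      proof -
        have Bz: "(\<lambda>x. indicator B x * (asset S j t x / V t x)) \<in> borel_measurable (info t)"
          using A_meas[OF t] V_meas[OF t] B by measurable
        have [measurable]: "B \<in> sets M" "asset S j t \<in> borel_measurable M" "U t \<in> borel_measurable M"
          "u t \<in> borel_measurable M" "(\<lambda>x. indicator B x * (asset S j t x / V t x)) \<in> borel_measurable M"
          using B subalgebra_info[of t] to_M[OF A_meas[OF t]] UM[OF t] uM[OF t] to_M[OF Bz]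
          by (auto simp: subalgebra_def)
        have "AE x in M. real_cond_exp M G (\<lambda>x. u t x * (indicator B x * (asset S j t x / V t x))) x
          = real_cond_exp M G (\<lambda>x. \<xi> x * (indicator B x * (asset S j t x / U t x))) x"
        proof (rule real_cond_exp_cong)
          show "AE x in M. u t x * (indicator B x * (asset S j t x / V t x))
              = \<xi> x * (indicator B x * (asset S j t x / U t x))"
            using U(2)[OF t] V(1)[OF t] by eventually_elim (simp add: u_def)
        qed measurable
        with bayes[OF t Bz] show ?thesis by eventually_elim simp
      qed
      fix s t B assume s: "s \<in> TT" and t: "t \<in> TT" and "s \<le> t" and B: "B \<in> sets (info s)"
      have "B \<in> sets (info t)" using sets_info_mono[OF \<open>s \<le> t\<close>] B by blast
      show "AE x in M. real_cond_exp M G (\<lambda>x. \<xi>' x * (indicator B x * (asset S j t x / V t x))) x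
          = real_cond_exp M G (\<lambda>x. \<xi>' x * (indicator B x * (asset S j s x / V s x))) x"
        using key[OF t \<open>B \<in> sets (info t)\<close>] key[OF s B] conditional_martingaleD(3)[OF \<xi> j s t \<open>s \<le> t\<close> B]
        by eventually_elim simp
    qed
  qed
qed

text \<open>A price that becomes nonpositive at time \<open>t\<close> is nonpositive in conditional mean at time \<open>T\<close>.\<close>

lemma martingale_price_pos:
  assumes q: "martingale_density M G TT n S (\<lambda>_ _. 1) q" "AE x in M. 0 < q x"
    and j: "j \<in> {1..n}" "AE x in M. 0 < S j T x" and t: "t \<in> TT"
  shows "AE x in M. 0 < S j t x"
proof -
  have A: "asset S j u = S j u" for u using j(1) by (auto simp: asset_def)
  have "q \<in> borel_measurable (price_info M G n S TT)"
    using q(1) unfolding martingale_density_def conditional_density_def by simp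
  then have [measurable]: "q \<in> borel_measurable M"
    using subalgebra_price_info[of TT] by (auto intro: measurable_from_subalg)
  have [measurable]: "S j t \<in> borel_measurable M" "S j T \<in> borel_measurable M" using prices j(1) t times(3) by auto
  have space: "space (info t) = space M" using subalgebra_info[of t] by (simp add: subalgebra_def)
  have meas_t: "S j t \<in> borel_measurable (info t)"
    using conditional_martingaleD(1)[OF q(1), of j t] j(1) t A by simp
  define B where "B = {x \<in> space (info t). S j t x \<le> 0}"
  have B: "B \<in> sets (info t)" unfolding B_def using meas_t by measurable
  have [measurable]: "B \<in> sets M" using B subalgebra_info[of t] by (auto simp: subalgebra_def)
  let ?g = "\<lambda>x. q x * (indicator B x * S j T x)" and ?h = "\<lambda>x. q x * (indicator B x * S j t x)"
  have eq: "AE x in M. real_cond_exp M G ?g x = real_cond_exp M G ?h x"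
    using conditional_martingaleD(3)[OF q(1) _ t times(3) _ B, of j] j(1) A times(1) t by auto
  have "AE x in M. nn_cond_exp M G (\<lambda>x. ennreal (?h x)) x = 0"
  proof (rule nn_cond_exp_zero_of_nonpos)
    show "AE x in M. ?h x \<le> 0"
      using q(2) by eventually_elim (auto simp: B_def indicator_def mult_nonneg_nonpos)
  qed measurable
  then have h_le: "AE x in M. real_cond_exp M G ?h x \<le> 0"
    by eventually_elim (simp add: real_cond_exp_def)
  have g_nonneg: "AE x in M. 0 \<le> ?g x"
    using q(2) j(2) by eventually_elim (simp add: indicator_def)
  \<comment> \<open>A finite majorant is required to conclude from a vanishing
    \<open>enn2real\<close> that the conditional expectation itself is \<open>0\<close> and not
    infinite.\<close>
  have "AE x in M. nn_cond_exp M G (\<lambda>x. ennreal (?g x)) x \<le> nn_cond_exp M G (\<lambda>y. ennreal (q y * \<bar>asset S j T y / 1\<bar>)) x"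
  proof (rule nn_cond_exp_mono)
    show "AE x in M. ennreal (?g x) \<le> ennreal (q x * \<bar>asset S j T x / 1\<bar>)"
      using q(2) j(2) by eventually_elim (auto simp: A indicator_def intro!: ennreal_leI)
  qed (simp_all add: A)
  moreover have "AE x in M. nn_cond_exp M G (\<lambda>y. ennreal (q y * \<bar>asset S j T y / 1\<bar>)) x < \<infinity>"
    using conditional_martingaleD(2)[OF q(1) _ times(3), of j] j(1) by simp
  moreover have "AE x in M. real_cond_exp M G ?g x = enn2real (nn_cond_exp M G (\<lambda>x. ennreal (?g x)) x)"
    using g_nonneg by (intro real_cond_exp_of_nonneg) measurable
  ultimately have "AE x in M. nn_cond_exp M G (\<lambda>x. ennreal (?g x)) x = 0"
    using eq h_le
  proof eventually_elim
    case (elim x)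
    then have "enn2real (nn_cond_exp M G (\<lambda>x. ennreal (?g x)) x) = 0"
      using enn2real_nonneg[of "nn_cond_exp M G (\<lambda>x. ennreal (?g x)) x"] by linarith
    moreover have "nn_cond_exp M G (\<lambda>x. ennreal (?g x)) x < \<infinity>" using elim(1,2) by (rule le_less_trans)
    ultimately show ?case by (auto simp: enn2real_eq_0_iff)
  qed
  then have "(\<integral>\<^sup>+x. nn_cond_exp M G (\<lambda>x. ennreal (?g x)) x \<partial>M) = (\<integral>\<^sup>+x. 0 \<partial>M)"
    by (intro nn_integral_cong_AE)
  then have "(\<integral>\<^sup>+x. ennreal (?g x) \<partial>M) = 0" by (simp add: nn_integral_nn_cond_exp)
  then have "AE x in M. ennreal (?g x) = 0" by (subst (asm) nn_integral_0_iff_AE) auto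
  then show ?thesis
    using q(2) j(2) AE_space
  proof eventually_elim
    case (elim x)
    show ?case
    proof (rule ccontr)
      assume "\<not> 0 < S j t x"
      then have "x \<in> B" using elim by (simp add: B_def space)
      then have "0 < ?g x" using elim by simp
      then show False using elim(1) by (simp add: ennreal_eq_0_iff)
    qed
  qed
qed

theorem unique_density_change_of_numeraire:
  assumes initial: "\<And>j. j \<in> {1..n} \<Longrightarrow> S j 0 \<in> borel_measurable G"
    and q: "unique_equivalent_martingale_density M G TT n S (\<lambda>_ _. 1) q"
    and i: "i \<in> {1..n}" "AE x in M. 0 < S i T x"
  shows "unique_equivalent_martingale_density M G TT n S (S i) (\<lambda>x. S i T x / S i 0 x * q x)"
  unfolding unique_equivalent_martingale_density_def
proof (intro conjI allI impI)
  have q_mart: "martingale_density M G TT n S (\<lambda>_ _. 1) q" and q_pos: "AE x in M. 0 < q x"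
    and q_unique: "\<And>\<eta>. martingale_density M G TT n S (\<lambda>_ _. 1) \<eta> \<Longrightarrow> AE x in M. \<eta> x = q x"
    using q unfolding unique_equivalent_martingale_density_def by auto
  have A: "S i t = asset S i t" for t using i(1) by (auto simp: asset_def)
  have pos: "AE x in M. 0 < S i t x" if "t \<in> TT" for t
    using martingale_price_pos[OF q_mart q_pos i that] .
  have S_meas: "S i t \<in> borel_measurable (info t)" if "t \<in> TT" for t
    using measurable_price_info[where U="TT \<inter> {..t}"] i(1) that by auto
  have "martingale_density M G TT n S (S i) (\<lambda>x. q x * (S i T x / 1) * (1 / S i 0 x))"
  proof (rule change_of_numeraire[OF q_mart, where k=i and V="S i"])
    show "S i t = asset S i t" for t by (rule A)
    show "AE x in M. 0 < S i t x" if "t \<in> TT" for t using that by (rule pos)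
    show "S i 0 \<in> borel_measurable G" using i(1) by (rule initial)
  qed (use i(1) in simp_all)
  moreover have "(\<lambda>x. q x * (S i T x / 1) * (1 / S i 0 x)) = (\<lambda>x. S i T x / S i 0 x * q x)"
    by (simp add: fun_eq_iff)
  ultimately show "martingale_density M G TT n S (S i) (\<lambda>x. S i T x / S i 0 x * q x)" by simp
  show "AE x in M. 0 < S i T x / S i 0 x * q x"
    using i(2) pos[OF times(2)] q_pos by eventually_elim simp
  fix \<eta> assume \<eta>: "martingale_density M G TT n S (S i) \<eta>"
  \<comment> \<open>The way back takes the bank account, asset \<open>0\<close>, as the new
    numeraire. This is possible because \<open>martingale_density\<close> demands that the bank
    account in units of \<open>S i\<close> be a martingale as well.\<close>
  have "martingale_density M G TT n S (\<lambda>_ _. 1) (\<lambda>x. \<eta> x * (1 / S i T x) * (S i 0 x / 1))"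
    using S_meas pos initial i(1)
    by (intro change_of_numeraire[OF \<eta>, where k=0]) (auto simp: asset_def fun_eq_iff)
  from q_unique[OF this] i(2) pos[OF times(2)]
  show "AE x in M. \<eta> x = S i T x / S i 0 x * q x"
    by eventually_elim (auto simp: field_simps)
qed

end

end

subsection \<open>Evaluations in units of a numeraire\<close>

lemma Linf_scale:
  assumes "subalgebra M A" "N \<in> borel_measurable A"
  shows "X \<in> Linf M A N \<Longrightarrow> (\<lambda>y. N y * X y) \<in> Linf M A (\<lambda>_. 1)"
  using assms by (auto simp: Linf_def)

lemma Linf_unscale:
  assumes "N \<in> borel_measurable A" "X \<in> Linf M A (\<lambda>_. 1)" "AE x in M. 0 < N x"
  shows "(\<lambda>y. X y / N y) \<in> Linf M A N"
proof -
  obtain C where C: "AE x in M. \<bar>X x\<bar> \<le> C" and X: "X \<in> borel_measurable A" using assms(2) by (auto simp: Linf_def)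
  have "AE x in M. \<bar>N x * (X x / N x)\<bar> \<le> C" using C assms(3) by eventually_elim simp
  moreover have "(\<lambda>y. X y / N y) \<in> borel_measurable A" using assms(1) X by measurable
  ultimately show ?thesis unfolding Linf_def by blast
qed

lemma ereal_divide_le_Liminf:
  assumes "ereal a \<le> liminf (\<lambda>k. ereal (b k))" "0 < c"
  shows "ereal (a / c) \<le> liminf (\<lambda>k. ereal (b k / c))"
  unfolding le_Liminf_iff
proof (intro allI impI)
  fix y assume y: "y < ereal (a / c)"
  then have "y * ereal c < ereal a" using \<open>0 < c\<close> by (cases y) (auto simp: field_simps)
  then have "\<forall>\<^sub>F k in sequentially. y * ereal c < ereal (b k)" using assms(1) unfolding le_Liminf_iff by blast
  then show "\<forall>\<^sub>F k in sequentially. y < ereal (b k / c)"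
    by eventually_elim (use \<open>0 < c\<close> in \<open>cases y; auto simp: field_simps\<close>)
qed

text \<open>Multiplication by the positive \<open>N\<close> is an order isomorphism. The families
  are matched almost surely rather than pointwise, because dividing by \<open>N\<close> and
  multiplying again is the identity only where \<open>N\<close> does not vanish.\<close>

lemma is_ess_sup_divide:
  fixes N :: "'a \<Rightarrow> real"
  assumes Z: "is_ess_sup M \<Phi> Z" and N[measurable]: "N \<in> borel_measurable M" "AE x in M. 0 < N x"
    and \<Phi>': "\<And>X'. X' \<in> \<Phi>' \<Longrightarrow> \<exists>X\<in>\<Phi>. AE x in M. X' x = X x / ereal (N x)"
      "\<And>X. X \<in> \<Phi> \<Longrightarrow> \<exists>X'\<in>\<Phi>'. AE x in M. X' x = X x / ereal (N x)"
  shows "is_ess_sup M \<Phi>' (\<lambda>x. Z x / ereal (N x))"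
  unfolding is_ess_sup_def
proof (intro conjI ballI impI)
  have [measurable]: "Z \<in> borel_measurable M" using Z by (simp add: is_ess_sup_def)
  show "(\<lambda>x. Z x / ereal (N x)) \<in> borel_measurable M" by measurable
  fix X' assume "X' \<in> \<Phi>'"
  then obtain X where X: "X \<in> \<Phi>" "AE x in M. X' x = X x / ereal (N x)" using \<Phi>'(1) by blast
  show "AE x in M. X' x \<le> Z x / ereal (N x)"
    using is_ess_sup_upper[OF Z X(1)] X(2) N(2)
    by eventually_elim (simp add: ereal_divide_right_mono)
next
  fix Z' assume Z'[measurable]: "Z' \<in> borel_measurable M" and ge: "\<forall>X'\<in>\<Phi>'. AE x in M. X' x \<le> Z' x"
  have "AE x in M. Z x \<le> ereal (N x) * Z' x"
  proof (rule is_ess_sup_least[OF Z])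
    fix X assume "X \<in> \<Phi>"
    then obtain X' where X': "X' \<in> \<Phi>'" "AE x in M. X' x = X x / ereal (N x)" using \<Phi>'(2) by blast
    have "AE x in M. X' x \<le> Z' x" using ge X'(1) by (rule bspec)
    then show "AE x in M. X x \<le> ereal (N x) * Z' x"
      using X'(2) N(2) by eventually_elim (simp add: ereal_divide_le_pos)
  qed measurable
  then show "AE x in M. Z x / ereal (N x) \<le> Z' x"
    using N(2) by eventually_elim (simp add: ereal_divide_le_pos)
qed

definition in_units :: "('a \<Rightarrow> real) \<Rightarrow> (('a \<Rightarrow> real) \<Rightarrow> 'a \<Rightarrow> real) \<Rightarrow> ('a \<Rightarrow> real) \<Rightarrow> 'a \<Rightarrow> real" where
  "in_units N \<pi> Ht x = \<pi> (\<lambda>y. N y * Ht y) x / N x"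

context
  fixes M A :: "'a measure" and N :: "'a \<Rightarrow> real" and \<pi> :: "('a \<Rightarrow> real) \<Rightarrow> 'a \<Rightarrow> real"
  assumes prob: "prob_space M" and sub: "subalgebra M A"
    and N: "N \<in> borel_measurable A" "AE x in M. 0 < N x"
    and eval: "conditional_evaluation M A (\<lambda>_. 1) \<pi>"
begin

abbreviation "converted \<equiv> in_units N \<pi>"

interpretation prob_space M by (rule prob)
interpretation finite_measure_subalgebra M A using sub by unfold_locales

lemma N_meas: "N \<in> borel_measurable M"
  using sub N(1) by (rule measurable_from_subalg)

lemma cash_value: "X \<in> Linf M M N \<Longrightarrow> (\<lambda>y. N y * X y) \<in> Linf M M (\<lambda>_. 1)"
  by (rule Linf_scale[OF _ N_meas]) (simp_all add: subalgebra_def)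

lemma conditional_evaluation_converted: "conditional_evaluation M A N converted"
  unfolding conditional_evaluation_def
proof (intro conjI ballI allI impI)
  fix H H' assume H: "H \<in> Linf M M N" "H' \<in> Linf M M N" "AE x in M. H x = H' x"
  have "AE x in M. N x * H x = N x * H' x" using H(3) by eventually_elim simp
  from conditional_evaluation_cong[OF eval cash_value[OF H(1)] cash_value[OF H(2)] this]
  show "AE x in M. converted H x = converted H' x" by eventually_elim (simp add: in_units_def)
next
  fix H assume "H \<in> Linf M M N"
  then have "\<pi> (\<lambda>y. N y * H y) \<in> Linf M A (\<lambda>_. 1)"
    by (intro conditional_evaluation_Linf[OF eval] cash_value)
  from Linf_unscale[OF N(1) this N(2)] show "converted H \<in> Linf M A N" by (simp add: in_units_def[abs_def])
next
  show "AE x in M. converted (\<lambda>_. 0) x = 0"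
    using conditional_evaluation_zero[OF eval] by eventually_elim (simp add: in_units_def)
next
  fix H m assume H: "H \<in> Linf M M N" and m: "m \<in> Linf M A N"
  have "AE x in M. \<pi> (\<lambda>y. N y * H y + N y * m y) x = \<pi> (\<lambda>y. N y * H y) x + N x * m x"
    using cash_value[OF H] Linf_scale[OF sub N(1) m] by (rule conditional_evaluation_translate[OF eval])
  then show "AE x in M. converted (\<lambda>y. H y + m y) x = converted H x + m x"
    using N(2) by eventually_elim (simp add: in_units_def distrib_left add_divide_distrib)
next
  fix H1 H2 w :: "'a \<Rightarrow> real"
  assume H: "H1 \<in> Linf M M N" "H2 \<in> Linf M M N" and w: "w \<in> borel_measurable A" "AE x in M. 0 \<le> w x \<and> w x \<le> 1"
  have eq: "(\<lambda>y. N y * (w y * H1 y + (1 - w y) * H2 y)) = (\<lambda>y. w y * (N y * H1 y) + (1 - w y) * (N y * H2 y))"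
    by (simp add: fun_eq_iff algebra_simps)
  from conditional_evaluation_convex[OF eval cash_value[OF H(1)] cash_value[OF H(2)] w] N(2)
  show "AE x in M. converted (\<lambda>y. w y * H1 y + (1 - w y) * H2 y) x
      \<le> w x * converted H1 x + (1 - w x) * converted H2 x"
  proof eventually_elim
    case (elim x)
    then have "converted (\<lambda>y. w y * H1 y + (1 - w y) * H2 y) x
      \<le> (w x * \<pi> (\<lambda>y. N y * H1 y) x + (1 - w x) * \<pi> (\<lambda>y. N y * H2 y) x) / N x"
      unfolding in_units_def eq by (intro divide_right_mono) auto
    then show ?case by (simp add: in_units_def add_divide_distrib)
  qed
next
  fix H1 H2 B assume H: "H1 \<in> Linf M M N" "H2 \<in> Linf M M N" and B: "B \<in> sets A"
  have eq: "(\<lambda>y. N y * (indicator B y * H1 y + indicator (space M - B) y * H2 y))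
      = (\<lambda>y. indicator B y * (N y * H1 y) + indicator (space M - B) y * (N y * H2 y))"
    by (simp add: fun_eq_iff algebra_simps)
  from conditional_evaluation_local[OF eval cash_value[OF H(1)] cash_value[OF H(2)] B]
  show "AE x in M. converted (\<lambda>y. indicator B y * H1 y + indicator (space M - B) y * H2 y) x
      = indicator B x * converted H1 x + indicator (space M - B) x * converted H2 x"
    unfolding in_units_def eq by eventually_elim (simp add: add_divide_distrib)
next
  fix H Hs
  assume H: "H \<in> Linf M M N" and "(\<forall>k. Hs k \<in> Linf M M N) \<and> (\<exists>C. \<forall>k. AE x in M. \<bar>N x * Hs k x\<bar> \<le> C)
    \<and> (AE x in M. (\<lambda>k. Hs k x) \<longlonglongrightarrow> H x)"
  then obtain C where Hs: "\<And>k. Hs k \<in> Linf M M N" "\<And>k. AE x in M. \<bar>N x * Hs k x\<bar> \<le> C"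
    "AE x in M. (\<lambda>k. Hs k x) \<longlonglongrightarrow> H x" by blast
  \<comment> \<open>Boundedness of the sequence is measured in cash, so the constant
    \<open>C\<close> serves unchanged for the cash values.\<close>
  have "AE x in M. ereal (\<pi> (\<lambda>y. N y * H y) x) \<le> liminf (\<lambda>k. ereal (\<pi> (\<lambda>y. N y * Hs k y) x))"
  proof (rule conditional_evaluation_fatou[OF eval, where C=C])
    show "AE x in M. (\<lambda>k. N x * Hs k x) \<longlonglongrightarrow> N x * H x"
      using Hs(3) by eventually_elim (intro tendsto_intros)
  qed (use Hs(2) in \<open>auto intro: cash_value H Hs(1)\<close>)
  then show "AE x in M. ereal (converted H x) \<le> liminf (\<lambda>k. ereal (converted (Hs k) x))"
    using N(2) unfolding in_units_def by eventually_elim (rule ereal_divide_le_Liminf)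
qed

text \<open>\<open>H\<close> is bounded only after multiplication by \<open>N\<close>, so the
  product of \<open>\<xi>\<close> and \<open>H\<close> need not be integrable; this is why
  \<open>real_cond_exp_pull_out\<close> has to do without integrability.\<close>

lemma real_cond_exp_converted:
  assumes "integrable M \<xi>" "H \<in> Linf M M N"
  shows "AE x in M. real_cond_exp M A (\<lambda>y. \<xi> y * H y) x = real_cond_exp M A (\<lambda>y. \<xi> y * (N y * H y)) x / N x"
proof -
  have [measurable]: "H \<in> borel_measurable M" "\<xi> \<in> borel_measurable M"
    using assms by (auto simp: Linf_def)
  have "AE x in M. real_cond_exp M A (\<lambda>y. N y * (\<xi> y * H y)) x = N x * real_cond_exp M A (\<lambda>y. \<xi> y * H y) x"
    using N(1) by (rule real_cond_exp_pull_out) measurable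
  moreover have "(\<lambda>y. \<xi> y * (N y * H y)) = (\<lambda>y. N y * (\<xi> y * H y))" by (simp add: mult_ac)
  ultimately show ?thesis using N(2) by (auto elim!: eventually_rev_mp)
qed

lemma penalty_converted:
  assumes \<xi>: "integrable M \<xi>"
  shows "AE x in M. penalty M A N converted \<xi> x = penalty M A (\<lambda>_. 1) \<pi> \<xi> x / ereal (N x)"
  unfolding penalty_def[of M A N]
proof (rule ess_sup_eq, rule is_ess_sup_divide[OF is_ess_sup_penalty[OF prob sub eval] N_meas N(2)])
  let ?\<Phi> = "{\<lambda>x. ereal (real_cond_exp M A (\<lambda>y. \<xi> y * H y) x - \<pi> H x) |H. H \<in> Linf M M (\<lambda>_. 1)}"
  let ?\<Phi>' = "{\<lambda>x. ereal (real_cond_exp M A (\<lambda>y. \<xi> y * H y) x - converted H x) |H. H \<in> Linf M M N}"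
  have conv: "AE x in M. ereal (real_cond_exp M A (\<lambda>y. \<xi> y * H y) x - converted H x)
      = ereal (real_cond_exp M A (\<lambda>y. \<xi> y * (N y * H y)) x - \<pi> (\<lambda>y. N y * H y) x) / ereal (N x)"
    if "H \<in> Linf M M N" for H
    using real_cond_exp_converted[OF \<xi> that] N(2)
    by eventually_elim (simp add: in_units_def diff_divide_distrib)
  show "\<exists>X\<in>?\<Phi>. AE x in M. X' x = X x / ereal (N x)" if X': "X' \<in> ?\<Phi>'" for X'
  proof -
    obtain H where X': "X' = (\<lambda>x. ereal (real_cond_exp M A (\<lambda>y. \<xi> y * H y) x - converted H x))"
      and H: "H \<in> Linf M M N" using X' by blast
    show ?thesis
      unfolding X' using conv[OF H] cash_value[OF H]
      by (intro bexI[of _ "\<lambda>x. ereal (real_cond_exp M A (\<lambda>y. \<xi> y * (N y * H y)) x - \<pi> (\<lambda>y. N y * H y) x)"]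
            CollectI exI[of _ "\<lambda>y. N y * H y"] conjI refl)
  qed
  show "\<exists>X'\<in>?\<Phi>'. AE x in M. X' x = X x / ereal (N x)" if X: "X \<in> ?\<Phi>" for X
  proof -
    obtain K where X: "X = (\<lambda>x. ereal (real_cond_exp M A (\<lambda>y. \<xi> y * K y) x - \<pi> K x))"
      and K: "K \<in> Linf M M (\<lambda>_. 1)" using X by blast
    \<comment> \<open>The cash value of this payoff equals \<open>K\<close> only off a null set, so
      \<open>\<pi>\<close> has to be well defined on classes of almost surely equal payoffs.\<close>
    let ?H = "\<lambda>y. K y / N y"
    have H: "?H \<in> Linf M M N" using N_meas K N(2) by (rule Linf_unscale)
    have eq: "AE x in M. N x * ?H x = K x" using N(2) by eventually_elim simp
    have [measurable]: "K \<in> borel_measurable M" "\<xi> \<in> borel_measurable M" "N \<in> borel_measurable M"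
      using K \<xi> N_meas by (auto simp: Linf_def)
    have "AE x in M. real_cond_exp M A (\<lambda>y. \<xi> y * (N y * ?H y)) x = real_cond_exp M A (\<lambda>y. \<xi> y * K y) x"
    proof (rule real_cond_exp_cong)
      show "AE x in M. \<xi> x * (N x * ?H x) = \<xi> x * K x" using eq by eventually_elim simp
    qed measurable
    moreover have "AE x in M. \<pi> (\<lambda>y. N y * ?H y) x = \<pi> K x"
      using cash_value[OF H] K eq by (rule conditional_evaluation_cong[OF eval])
    ultimately have "AE x in M. ereal (real_cond_exp M A (\<lambda>y. \<xi> y * ?H y) x - converted ?H x) = X x / ereal (N x)"
      using conv[OF H] by eventually_elim (simp add: X)
    then show ?thesis
      using H by (intro bexI[of _ "\<lambda>x. ereal (real_cond_exp M A (\<lambda>y. \<xi> y * ?H y) x - converted ?H x)"]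
          CollectI exI[of _ ?H] conjI refl)
  qed
qed

lemma converted_dual:
  assumes Ht: "Ht \<in> Linf M M N"
  shows "AE x in M. ereal (converted Ht x) = ess_sup M {\<lambda>x. ereal (real_cond_exp M A (\<lambda>y. \<xi> y * Ht y) x)
    - penalty M A N converted \<xi> x |\<xi>. integrable M \<xi>} x"
proof -
  let ?\<Phi> = "{\<lambda>x. ereal (real_cond_exp M A (\<lambda>y. \<xi> y * (N y * Ht y)) x)
    - penalty M A (\<lambda>_. 1) \<pi> \<xi> x |\<xi>. integrable M \<xi>}"
  let ?\<Phi>' = "{\<lambda>x. ereal (real_cond_exp M A (\<lambda>y. \<xi> y * Ht y) x) - penalty M A N converted \<xi> x |\<xi>. integrable M \<xi>}"
  have conv: "AE x in M. ereal (real_cond_exp M A (\<lambda>y. \<xi> y * Ht y) x) - penalty M A N converted \<xi> x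
      = (ereal (real_cond_exp M A (\<lambda>y. \<xi> y * (N y * Ht y)) x) - penalty M A (\<lambda>_. 1) \<pi> \<xi> x) / ereal (N x)"
    if "integrable M \<xi>" for \<xi>
    using real_cond_exp_converted[OF that Ht] penalty_converted[OF that] N(2)
  proof eventually_elim
    case (elim x)
    \<comment> \<open>The penalty may be infinite; division by a positive real distributes over the
      difference in that case too.\<close>
    then show ?case by (cases "penalty M A (\<lambda>_. 1) \<pi> \<xi> x") (auto simp: diff_divide_distrib)
  qed
  have "is_ess_sup M ?\<Phi>' (\<lambda>x. ereal (\<pi> (\<lambda>y. N y * Ht y) x) / ereal (N x))"
  proof (rule is_ess_sup_divide[OF evaluation_dual[OF prob sub eval cash_value[OF Ht]] N_meas N(2)])
    show "\<exists>X\<in>?\<Phi>. AE x in M. X' x = X x / ereal (N x)" if X'_in: "X' \<in> ?\<Phi>'" for X'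
    proof -
      obtain \<xi> where X': "X' = (\<lambda>x. ereal (real_cond_exp M A (\<lambda>y. \<xi> y * Ht y) x) - penalty M A N converted \<xi> x)"
        and \<xi>: "integrable M \<xi>" using X'_in by blast
      show ?thesis
        unfolding X' using conv[OF \<xi>] \<xi>
        by (intro bexI[of _ "\<lambda>x. ereal (real_cond_exp M A (\<lambda>y. \<xi> y * (N y * Ht y)) x) - penalty M A (\<lambda>_. 1) \<pi> \<xi> x"]
              CollectI exI[of _ \<xi>] conjI refl)
    qed
    show "\<exists>X'\<in>?\<Phi>'. AE x in M. X' x = X x / ereal (N x)" if X_in: "X \<in> ?\<Phi>" for X
    proof -
      obtain \<xi> where X: "X = (\<lambda>x. ereal (real_cond_exp M A (\<lambda>y. \<xi> y * (N y * Ht y)) x) - penalty M A (\<lambda>_. 1) \<pi> \<xi> x)"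
        and \<xi>: "integrable M \<xi>" using X_in by blast
      show ?thesis
        unfolding X using conv[OF \<xi>] \<xi>
        by (intro bexI[of _ "\<lambda>x. ereal (real_cond_exp M A (\<lambda>y. \<xi> y * Ht y) x) - penalty M A N converted \<xi> x"]
              CollectI exI[of _ \<xi>] conjI refl)
    qed
  qed
  from ess_sup_eq[OF this] N(2) show ?thesis
    by eventually_elim (simp add: in_units_def)
qed

end

theorem proposition3p9:
  fixes M G FS :: "'a measure"
    and TT :: "real set" and T :: real and n i :: nat
    and S :: "nat \<Rightarrow> real \<Rightarrow> 'a \<Rightarrow> real"
    and q qt :: "'a \<Rightarrow> real"
    and \<pi>F \<pi>G \<pi>Gt :: "('a \<Rightarrow> real) \<Rightarrow> 'a \<Rightarrow> real"
  assumes "prob_space M"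
    and "subalgebra M G"
    and times: "TT \<subseteq> {0..T}" "0 \<in> TT" "T \<in> TT"
    and prices: "\<And>j t. j \<in> {1..n} \<Longrightarrow> t \<in> TT \<Longrightarrow> S j t \<in> borel_measurable M"
    and initial: "\<And>j. j \<in> {1..n} \<Longrightarrow> S j 0 \<in> borel_measurable G"
    and FS: "FS = price_info M G n S TT"
    and complete: "unique_equivalent_martingale_density M G TT n S (\<lambda>_ _. 1) q"
    and two_step: "two_step_evaluation M G FS (\<lambda>_. 1) (\<lambda>_. 1) q \<pi>F \<pi>G"
    and i: "i \<in> {1..n}" "AE x in M. 0 < S i T x"
    and \<pi>Gt_meas: "\<And>Ht. Ht \<in> Linf M M (S i T) \<Longrightarrow> \<pi>Gt Ht \<in> borel_measurable G"
    and \<pi>Gt: "\<And>Ht. Ht \<in> Linf M M (S i T) \<Longrightarrow>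
           AE x in M. S i 0 x * \<pi>Gt Ht x = \<pi>G (\<lambda>y. S i T y * Ht y) x"
    and qt: "qt = (\<lambda>x. S i T x / S i 0 x * q x)"
  shows "unique_equivalent_martingale_density M G TT n S (S i) qt \<and>
    (\<exists>\<pi>Ft.
       two_step_evaluation M G FS (S i 0) (S i T) qt \<pi>Ft \<pi>Gt \<and>
       (\<forall>\<xi>. integrable M \<xi> \<longrightarrow>
          (AE x in M. penalty M FS (S i T) \<pi>Ft \<xi> x = penalty M FS (\<lambda>_. 1) \<pi>F \<xi> x / ereal (S i T x))) \<and>
       (\<forall>Ht\<in>Linf M M (S i T).
          AE x in M. ereal (\<pi>Ft Ht x) =
            ess_sup M {\<lambda>x. ereal (real_cond_exp M FS (\<lambda>y. \<xi> y * Ht y) x)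
                            - penalty M FS (S i T) \<pi>Ft \<xi> x |\<xi>. integrable M \<xi>} x))"
proof -
  interpret prob_space M by fact
  interpret G: finite_measure_subalgebra M G using assms(2) by unfold_locales
  have sub: "subalgebra M FS"
    unfolding FS by (rule subalgebra_price_info[OF assms(2) prices]) auto
  have N: "S i T \<in> borel_measurable FS"
    unfolding FS by (rule measurable_price_info[OF assms(2) prices]) (use i(1) times(3) in auto)
  have q_meas: "q \<in> borel_measurable M"
    using complete sub unfolding FS unique_equivalent_martingale_density_def martingale_density_def conditional_density_def
    by (auto intro: measurable_from_subalg)
  have q: "martingale_density M G TT n S (\<lambda>_ _. 1) q" "AE x in M. 0 < q x"
    using complete unfolding unique_equivalent_martingale_density_def by auto
  have S0: "AE x in M. 0 < S i 0 x"
    by (rule martingale_price_pos[OF assms(2) prices assms(1) times q i times(2)])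
  have eval: "conditional_evaluation M FS (\<lambda>_. 1) \<pi>F"
    and \<pi>G_Linf: "\<And>H. H \<in> Linf M M (\<lambda>_. 1) \<Longrightarrow> \<pi>G H \<in> Linf M G (\<lambda>_. 1)"
    and \<pi>G_eq: "\<And>H. H \<in> Linf M M (\<lambda>_. 1) \<Longrightarrow> AE x in M. \<pi>G H x = cond_exp_under M G q (\<pi>F H) x"
    using two_step unfolding two_step_evaluation_def by auto
  note ctx = assms(1) sub N i(2) eval
  let ?\<pi>Ft = "in_units (S i T) \<pi>F"
  have "two_step_evaluation M G FS (S i 0) (S i T) qt ?\<pi>Ft \<pi>Gt"
    unfolding two_step_evaluation_def
  proof (intro conjI ballI)
    show "conditional_evaluation M FS (S i T) ?\<pi>Ft" by (rule conditional_evaluation_converted[OF ctx])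
    fix Ht assume Ht: "Ht \<in> Linf M M (S i T)"
    let ?H = "\<lambda>y. S i T y * Ht y"
    have H: "?H \<in> Linf M M (\<lambda>_. 1)" by (rule cash_value[OF ctx Ht])
    obtain C where C: "AE x in M. \<bar>\<pi>G ?H x\<bar> \<le> C" using \<pi>G_Linf[OF H] by (auto simp: Linf_def)
    \<comment> \<open>The initial cash value of \<open>\<pi>Gt Ht\<close> is the value under
      \<open>\<pi>G\<close> of the cash payoff, hence bounded, although \<open>\<pi>Gt Ht\<close>
      itself need not be.\<close>
    have "AE x in M. \<bar>S i 0 x * \<pi>Gt Ht x\<bar> \<le> C" using C \<pi>Gt[OF Ht] by eventually_elim simp
    then show "\<pi>Gt Ht \<in> Linf M G (S i 0)" using \<pi>Gt_meas[OF Ht] by (auto simp: Linf_def)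
    have [measurable]: "\<pi>F ?H \<in> borel_measurable M" "S i T \<in> borel_measurable M" "S i 0 \<in> borel_measurable M"
      using conditional_evaluation_Linf[OF eval H] measurable_from_subalg[OF sub] prices i(1) times
      by (auto simp: Linf_def)
    note q_meas[measurable]
    \<comment> \<open>\<open>S i T\<close> from the density cancels against the units of the
      converted value, and \<open>1 / S i 0\<close>, known initially, comes out of the conditional
      expectation.\<close>
    have "AE x in M. cond_exp_under M G qt (?\<pi>Ft Ht) x
        = real_cond_exp M G (\<lambda>x. 1 / S i 0 x * (q x * \<pi>F ?H x)) x"
      unfolding cond_exp_under_def
    proof (rule G.real_cond_exp_cong)
      show "AE x in M. qt x * ?\<pi>Ft Ht x = 1 / S i 0 x * (q x * \<pi>F ?H x)"
        using i(2) by eventually_elim (simp add: qt in_units_def)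
    qed (unfold qt in_units_def, measurable)
    moreover have "AE x in M. real_cond_exp M G (\<lambda>x. 1 / S i 0 x * (q x * \<pi>F ?H x)) x
        = 1 / S i 0 x * real_cond_exp M G (\<lambda>x. q x * \<pi>F ?H x) x"
      using initial[OF i(1)] by (intro G.real_cond_exp_pull_out) auto
    ultimately show "AE x in M. \<pi>Gt Ht x = cond_exp_under M G qt (?\<pi>Ft Ht) x"
      using \<pi>Gt[OF Ht] \<pi>G_eq[OF H] S0
    proof eventually_elim
      case (elim x)
      then have "S i 0 x * \<pi>Gt Ht x = S i 0 x * cond_exp_under M G qt (?\<pi>Ft Ht) x"
        by (simp add: cond_exp_under_def)
      moreover have "S i 0 x \<noteq> 0" using elim by simp
      ultimately show ?case by (metis mult_left_cancel)
    qed
  qed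
  moreover have "unique_equivalent_martingale_density M G TT n S (S i) qt"
    unfolding qt by (rule unique_density_change_of_numeraire[OF assms(2) prices assms(1) times initial complete i])
  ultimately show ?thesis
    using penalty_converted[OF ctx] converted_dual[OF ctx] by blast
qed

end
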